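(* Let $V$ be an MV-algebra over $R$. There is a natural one-to-one correspondence between solutions $S$ of the quantum master equation $\Delta e^S=0$ in $V$ and MV-morphisms $s\in\mathrm{MV}_R(\Bbbk,V)$, i.e. a natural isomorphism $$\mathrm{QME}_V(R)\cong\mathrm{MV}_R(\Bbbk,V),$$ given by $s(1)=S$. Here the MV structure on $\Bbbk$ is the one with its usual multiplication, $\delta(1):=1\otimes1$ and $\Delta=0$.
   Context: $\Bbbk$ is a field of characteristic zero, $\otimes=\otimes_\Bbbk$, and Koszul signs are used throughout. $R$ is a complete local Noetherian commutative ring (a $\Bbbk$-algebra, in degree $0$) with residue field $\Bbbk$ and maximal ideal $\mathfrak m$. For a graded vector space $V$, $V\widehat\otimes R:=\varprojlim_n V\otimes R/V\otimes\mathfrak m^n$ and $V\widehat\otimes\mathfrak m$ is the kernel of $V\widehat\otimes R\to V$; convergence is $\mathfrak m$-adic. Maps and their $R$-linear extensions are denoted by the same symbol. An MV-algebra over $R$ is $V=(V,\mu,\delta,\Delta)$ where (i) $(V,\mu)$ is a unital graded commutative associative $\Bbbk$-algebra; (ii) $(V,\delta)$ is a conilpotent counital graded cocommutative coassociative $\Bbbk$-coalgebra; (iii) $\Delta:V\widehat\otimes R\to V\widehat\otimes R$ is a continuous degree $+1$ $R$-linear map with $\Delta^2=0$, $\Delta(1)=0$. The unit $\eta:\Bbbk\to V$ of $\mu$ is required to be a coaugmentation for $(V,\delta)$ and the counit $\epsilon:V\to\Bbbk$ of $\delta$ an augmentation for $(V,\mu)$. Conilpotent means: with $\bar\delta(v)=\delta(v)-v\otimes1-1\otimes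 v$ for $v\in\ker\epsilon$ and $\bar\delta(1)=0$, for every $v$ the iterates $\bar\delta^{[k]}(v)$ vanish for $k$ large, where $\bar\delta^{[0]}(v)=v$, $\bar\delta^{[k]}=(\bar\delta\otimes \mathrm{id}^{\otimes k-1})\bar\delta^{[k-1]}$. No compatibility between $\mu$ and $\delta$ is required. For MV-algebras $V',V''$, $\mathrm{Lin}_R(V',V'')$ denotes the continuous degree-$0$ $R$-linear maps $V'\widehat\otimes R\to V''\widehat\otimes R$, a commutative algebra under convolution $f\star g=\mu''(f\otimes g)\delta'$ (extended $R$-linearly) with unit $\mathsf e=\eta''\circ\epsilon'$. $\mathrm{Lin}^0_R(V',V'')$ is the ideal of those $f$ with $\mathrm{Im}(f\circ\eta')\subset V''\widehat\otimes\mathfrak m$. For $f,g\in\mathrm{Lin}_R^0(V',V'')$ the (pointwise $\mathfrak m$-adically convergent) series, with powers with respect to $\star$, $\exp(f)=\mathsf e+f+f^2/2!+\cdots$ and $\log(\mathsf e+g)=g-g^2/2+g^3/3-\cdots$ define mutually inverse bijections between $\mathrm{Lin}_R^0$ and $\mathsf e+\mathrm{Lin}_R^0$. The category $\mathrm{MV}_R$ has MV-algebras over $R$ as objects, morphisms $\mathrm{MV}_R(V',V'')=\{f\in\mathrm{Lin}_R^0(V',V'')\mid \Delta''\circ\exp(f)=\exp(f)\circ\Delta'\}$, composition $f\diamond g=\log(\exp(f)\circ\exp(g))$, and identities $\mathbf 1_V=\log(\mathrm{id}_{V\widehat\otimes R})$. The quantum master equation in $V$ is $\Delta e^S=0$ for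 a degree-$0$ element $S\in V\widehat\otimes\mathfrak m$, where $e^S$ is the exponential in the graded commutative algebra $V\widehat\otimes R$; $\mathrm{QME}_V(R)$ is its set of solutions. *)

theory Defs
  imports Complex_Main "HOL-Library.Poly_Mapping" "HOL-Library.FuncSet"
begin

text \<open>
  The field \<open>\<Bbbk>\<close> is the type \<open>'k\<close>, the ring \<open>R\<close> is the type \<open>'r\<close>; \<open>emb\<close> is the structure map
  \<open>\<Bbbk> \<rightarrow> R\<close> and \<open>mid\<close> is the maximal ideal of \<open>R\<close>.
\<close>

record ('k, 'r) coeff =
  emb :: "'k \<Rightarrow> 'r"
  mid :: "'r set"

definition is_ideal :: "'r::comm_ring_1 set \<Rightarrow> bool" where
  "is_ideal I \<longleftrightarrow> module.subspace (*) I"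

definition is_maximal_ideal :: "'r::comm_ring_1 set \<Rightarrow> bool" where
  "is_maximal_ideal I \<longleftrightarrow> is_ideal I \<and> I \<noteq> UNIV \<and>
     (\<forall>J. is_ideal J \<and> I \<subseteq> J \<longrightarrow> J = I \<or> J = UNIV)"

definition gen_ideal :: "'r::comm_ring_1 set \<Rightarrow> 'r set" where
  "gen_ideal B = module.span (*) B"

fun ideal_pow :: "'r::comm_ring_1 set \<Rightarrow> nat \<Rightarrow> 'r set" where
  "ideal_pow I 0 = UNIV"
| "ideal_pow I (Suc n) = gen_ideal {a * b | a b. a \<in> I \<and> b \<in> ideal_pow I n}"

text \<open>
  The last two conditions say respectively that \<open>R \<rightarrow> lim R/\<mm>\<^sup>n\<close> and \<open>\<Bbbk> \<rightarrow> R/\<mm>\<close> are bijective.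
\<close>

definition complete_local :: "('k::field_char_0, 'r::comm_ring_1) coeff \<Rightarrow> bool" where
  "complete_local R \<longleftrightarrow>
     emb R 1 = 1 \<and>
     (\<forall>a b. emb R (a + b) = emb R a + emb R b) \<and>
     (\<forall>a b. emb R (a * b) = emb R a * emb R b) \<and>
     (\<forall>I::'r set. is_ideal I \<longrightarrow> (\<exists>B. finite B \<and> I = gen_ideal B)) \<and>
     (\<forall>I. is_maximal_ideal I \<longleftrightarrow> I = mid R) \<and>
     (\<forall>x. (\<forall>n. x (Suc n) - x n \<in> ideal_pow (mid R) n) \<longrightarrow>
          (\<exists>!l. \<forall>n. l - x n \<in> ideal_pow (mid R) n)) \<and>
     (\<forall>r. \<exists>!c. r - emb R c \<in> mid R)"

definition residue :: "('k, 'r::comm_ring_1) coeff \<Rightarrow> 'r \<Rightarrow> 'k" where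
  "residue R r = (THE c. r - emb R c \<in> mid R)"

text \<open>
  \<open>'b \<Rightarrow>\<^sub>0 'k\<close> is the free vector space on \<open>'b\<close>. Tensor products are quotients of such spaces,
  and their elements are cosets. \<open>rep\<close> picks a representative of a coset; wherever it is used
  below, the outcome does not depend on the choice.
\<close>

definition fscale :: "'k::field \<Rightarrow> ('b \<Rightarrow>\<^sub>0 'k) \<Rightarrow> ('b \<Rightarrow>\<^sub>0 'k)" where
  "fscale c = Poly_Mapping.map ((*) c)"

text \<open>The linear extension of \<open>g\<close> to formal combinations, \<open>s\<close> being the scalar multiplication
  of the target.\<close>

definition lext :: "('k::field \<Rightarrow> 'a \<Rightarrow> 'a) \<Rightarrow> ('b \<Rightarrow> 'a::comm_monoid_add) \<Rightarrow> ('b \<Rightarrow>\<^sub>0 'k) \<Rightarrow> 'a" where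
  "lext s g p = (\<Sum>b\<in>Poly_Mapping.keys p. s (Poly_Mapping.lookup p b) (g b))"

abbreviation gen :: "'b \<Rightarrow> ('b \<Rightarrow>\<^sub>0 'k::field)" where
  "gen b \<equiv> Poly_Mapping.single b 1"

definition quo :: "'a::ab_group_add set \<Rightarrow> 'a \<Rightarrow> 'a set" where
  "quo N p = {q. q - p \<in> N}"

definition rep :: "'a set \<Rightarrow> 'a" where
  "rep t = (SOME p. p \<in> t)"

text \<open>
  The word \<open>[x\<^sub>1, \<dots>, x\<^sub>n]\<close> stands for \<open>x\<^sub>1 \<otimes> \<dots> \<otimes> x\<^sub>n\<close>. Here \<open>s\<close> is the scalar multiplication
  of \<open>V\<close>; \<open>mrel s n\<close> is spanned by the multilinearity relators in words of length \<open>n\<close>.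
\<close>

definition mrel :: "('k::field \<Rightarrow> 'v \<Rightarrow> 'v) \<Rightarrow> nat \<Rightarrow> ('v::ab_group_add list \<Rightarrow>\<^sub>0 'k) set" where
  "mrel s n = module.span fscale
     ({gen (xs @ (x + y) # ys) - gen (xs @ x # ys) - gen (xs @ y # ys) | xs x y ys.
         length xs + length ys + 1 = n} \<union>
      {gen (xs @ s c x # ys) - Poly_Mapping.single (xs @ x # ys) c | xs c x ys.
         length xs + length ys + 1 = n})"

definition tpow :: "('k::field \<Rightarrow> 'v \<Rightarrow> 'v) \<Rightarrow> nat \<Rightarrow> ('v::ab_group_add list \<Rightarrow>\<^sub>0 'k) set set" where
  "tpow s n = {quo (mrel s n) p | p. \<forall>xs\<in>Poly_Mapping.keys p. length xs = n}"

text \<open>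
  \<open>id\<^bsup>\<otimes>i\<^esup> \<otimes> D \<otimes> id\<^bsup>\<otimes>(n-2-i)\<^esup> : V\<^bsup>\<otimes>(n-1)\<^esup> \<rightarrow> V\<^bsup>\<otimes>n\<^esup>\<close> for a linear map \<open>D : V \<rightarrow> V \<otimes> V\<close> of degree 0;
  no Koszul sign arises.
\<close>

definition slot_map ::
  "('k::field \<Rightarrow> 'v \<Rightarrow> 'v) \<Rightarrow> nat \<Rightarrow> ('v \<Rightarrow> ('v list \<Rightarrow>\<^sub>0 'k) set) \<Rightarrow> nat \<Rightarrow>
   ('v::ab_group_add list \<Rightarrow>\<^sub>0 'k) set \<Rightarrow> ('v list \<Rightarrow>\<^sub>0 'k) set" where
  "slot_map s n D i t = quo (mrel s n)
     (lext fscale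
        (\<lambda>zs. lext fscale (\<lambda>ws. gen (take i zs @ ws @ drop (Suc i) zs)) (rep (D (zs ! i))))
        (rep t))"

text \<open>
  \<open>(v, r)\<close> stands for \<open>v \<otimes> r\<close>. The quotient of the free vector space by \<open>trel R s n\<close> is
  \<open>V\<otimes>R / V\<otimes>\<mm>\<^sup>n\<close>: the first four families of relators define \<open>V\<otimes>R\<close>, the last one divides
  by \<open>V\<otimes>\<mm>\<^sup>n\<close>.
\<close>

definition trel :: "('k::field, 'r::comm_ring_1) coeff \<Rightarrow> ('k \<Rightarrow> 'v \<Rightarrow> 'v) \<Rightarrow> nat \<Rightarrow>
    ('v::ab_group_add \<times> 'r \<Rightarrow>\<^sub>0 'k) set" where
  "trel R s n = module.span fscale
     ({gen (x + y, r) - gen (x, r) - gen (y, r) | x y r. True} \<union>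
      {gen (x, r + t) - gen (x, r) - gen (x, t) | x r t. True} \<union>
      {gen (s c x, r) - Poly_Mapping.single (x, r) c | c x r. True} \<union>
      {gen (x, emb R c * r) - Poly_Mapping.single (x, r) c | c x r. True} \<union>
      {gen (x, r) | x r. r \<in> ideal_pow (mid R) n})"

type_synonym ('k, 'r, 'v) ct = "nat \<Rightarrow> ('v \<times> 'r \<Rightarrow>\<^sub>0 'k) set"

text \<open>
  The inverse limit. The transition map sends a coset to the unique coset of the larger
  subspace containing it, hence the inclusion.
\<close>

definition ctens :: "('k::field, 'r::comm_ring_1) coeff \<Rightarrow> ('k \<Rightarrow> 'v \<Rightarrow> 'v) \<Rightarrow>
    ('k, 'r, 'v::ab_group_add) ct set" where
  "ctens R s = {x. (\<forall>n. x n \<in> range (quo (trel R s n))) \<and> (\<forall>n. x (Suc n) \<subseteq> x n)}"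

definition czero :: "('k::field, 'r::comm_ring_1) coeff \<Rightarrow> ('k \<Rightarrow> 'v \<Rightarrow> 'v) \<Rightarrow>
    ('k, 'r, 'v::ab_group_add) ct" where
  "czero R s = (\<lambda>n. quo (trel R s n) 0)"

definition cadd :: "('k::field, 'r::comm_ring_1) coeff \<Rightarrow> ('k \<Rightarrow> 'v \<Rightarrow> 'v) \<Rightarrow>
    ('k, 'r, 'v::ab_group_add) ct \<Rightarrow> ('k, 'r, 'v) ct \<Rightarrow> ('k, 'r, 'v) ct" where
  "cadd R s x y = (\<lambda>n. quo (trel R s n) (rep (x n) + rep (y n)))"

definition csub :: "('k::field, 'r::comm_ring_1) coeff \<Rightarrow> ('k \<Rightarrow> 'v \<Rightarrow> 'v) \<Rightarrow>
    ('k, 'r, 'v::ab_group_add) ct \<Rightarrow> ('k, 'r, 'v) ct \<Rightarrow> ('k, 'r, 'v) ct" where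
  "csub R s x y = (\<lambda>n. quo (trel R s n) (rep (x n) - rep (y n)))"

definition cscale :: "('k::field, 'r::comm_ring_1) coeff \<Rightarrow> ('k \<Rightarrow> 'v \<Rightarrow> 'v) \<Rightarrow>
    'r \<Rightarrow> ('k, 'r, 'v::ab_group_add) ct \<Rightarrow> ('k, 'r, 'v) ct" where
  "cscale R s r x = (\<lambda>n. quo (trel R s n) (lext fscale (\<lambda>(v, t). gen (v, r * t)) (rep (x n))))"

definition incl :: "('k::field, 'r::comm_ring_1) coeff \<Rightarrow> ('k \<Rightarrow> 'v \<Rightarrow> 'v) \<Rightarrow>
    'v \<Rightarrow> ('k, 'r, 'v::ab_group_add) ct" where
  "incl R s v = (\<lambda>n. quo (trel R s n) (gen (v, 1)))"

text \<open>The map \<open>V\<otimes>R \<rightarrow> V\<close> induced by \<open>R \<rightarrow> R/\<mm> = \<Bbbk>\<close>, on the completion; it factors through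
  \<open>V\<otimes>R / V\<otimes>\<mm>\<close>.\<close>

definition creduce :: "('k::field, 'r::comm_ring_1) coeff \<Rightarrow> ('k \<Rightarrow> 'v \<Rightarrow> 'v) \<Rightarrow>
    ('k, 'r, 'v::ab_group_add) ct \<Rightarrow> 'v" where
  "creduce R s x = lext s (\<lambda>(v, r). s (residue R r) v) (rep (x 1))"

definition cmax :: "('k::field, 'r::comm_ring_1) coeff \<Rightarrow> ('k \<Rightarrow> 'v \<Rightarrow> 'v) \<Rightarrow>
    ('k, 'r, 'v::ab_group_add) ct set" where
  "cmax R s = {x \<in> ctens R s. creduce R s x = 0}"

text \<open>The linear combination \<open>\<Sum>b. p b \<cdot> X b\<close> of elements \<open>X b\<close> of the completed tensor product.\<close>

definition clin :: "('k::field, 'r::comm_ring_1) coeff \<Rightarrow> ('k \<Rightarrow> 'v \<Rightarrow> 'v) \<Rightarrow>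
    ('b \<Rightarrow> ('k, 'r, 'v::ab_group_add) ct) \<Rightarrow> ('b \<Rightarrow>\<^sub>0 'k) \<Rightarrow> ('k, 'r, 'v) ct" where
  "clin R s X p = (\<lambda>n. quo (trel R s n) (lext fscale (\<lambda>b. rep (X b n)) p))"

text \<open>The sum of the series \<open>\<Sum>j. a j \<cdot> X j\<close>: a sequence converges iff each of its components in
  \<open>V\<otimes>R / V\<otimes>\<mm>\<^sup>n\<close> is eventually constant.\<close>

definition cseries :: "('k::field, 'r::comm_ring_1) coeff \<Rightarrow> ('k \<Rightarrow> 'v \<Rightarrow> 'v) \<Rightarrow>
    (nat \<Rightarrow> 'k) \<Rightarrow> (nat \<Rightarrow> ('k, 'r, 'v::ab_group_add) ct) \<Rightarrow> ('k, 'r, 'v) ct" where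
  "cseries R s a X = (\<lambda>n. THE c. \<forall>\<^sub>F N in sequentially.
     clin R s X (\<Sum>j<N. Poly_Mapping.single j (a j)) n = c)"

definition exp_coeff :: "nat \<Rightarrow> 'k::field_char_0" where
  "exp_coeff j = 1 / fact j"

definition log_coeff :: "nat \<Rightarrow> 'k::field_char_0" where
  "log_coeff j = (if j = 0 then 0 else (- 1) ^ (j + 1) / of_nat j)"

text \<open>The continuous \<open>R\<close>-linear extension of a linear map \<open>\<phi>\<close> from \<open>V\<close> to a completed tensor
  product with scalar multiplication \<open>s\<close>, sending \<open>v \<otimes> r\<close> to \<open>r \<cdot> \<phi> v\<close>.\<close>

definition cext :: "('k::field, 'r::comm_ring_1) coeff \<Rightarrow> ('k \<Rightarrow> 'w \<Rightarrow> 'w) \<Rightarrow>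
    ('v \<Rightarrow> ('k, 'r, 'w::ab_group_add) ct) \<Rightarrow> ('k, 'r, 'v) ct \<Rightarrow> ('k, 'r, 'w) ct" where
  "cext R s \<phi> z = (\<lambda>n. clin R s (\<lambda>(v, r). cscale R s r (\<phi> v)) (rep (z n)) n)"

definition clinear :: "('k::field, 'r::comm_ring_1) coeff \<Rightarrow> ('k \<Rightarrow> 'v \<Rightarrow> 'v) \<Rightarrow> ('k \<Rightarrow> 'w \<Rightarrow> 'w) \<Rightarrow>
    (('k, 'r, 'v::ab_group_add) ct \<Rightarrow> ('k, 'r, 'w::ab_group_add) ct) \<Rightarrow> bool" where
  "clinear R s s' f \<longleftrightarrow>
     (\<forall>x\<in>ctens R s. f x \<in> ctens R s') \<and>
     (\<forall>x\<in>ctens R s. \<forall>y\<in>ctens R s. f (cadd R s x y) = cadd R s' (f x) (f y)) \<and>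
     (\<forall>r. \<forall>x\<in>ctens R s. f (cscale R s r x) = cscale R s' r (f x))"

definition ccontinuous :: "('k::field, 'r::comm_ring_1) coeff \<Rightarrow> ('k \<Rightarrow> 'v \<Rightarrow> 'v) \<Rightarrow>
    (('k, 'r, 'v::ab_group_add) ct \<Rightarrow> ('k, 'r, 'w::ab_group_add) ct) \<Rightarrow> bool" where
  "ccontinuous R s f \<longleftrightarrow>
     (\<forall>x\<in>ctens R s. \<forall>n. \<exists>N. \<forall>y\<in>ctens R s. y N = x N \<longrightarrow> f y n = f x n)"

text \<open>
  The underlying space is the whole type \<open>'v\<close>. \<open>hom i\<close> is the component of degree \<open>i\<close>,
  \<open>unit = \<eta>(1)\<close>, and \<open>comul\<close> takes values in \<open>V \<otimes> V\<close>, that is in \<open>tpow (smul V) 2\<close>.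
\<close>

record (overloaded) ('k, 'r, 'v) mv =
  smul :: "'k \<Rightarrow> 'v \<Rightarrow> 'v"
  hom :: "int \<Rightarrow> 'v set"
  mult :: "'v \<Rightarrow> 'v \<Rightarrow> 'v"
  unit :: 'v
  comul :: "'v \<Rightarrow> ('v list \<Rightarrow>\<^sub>0 'k) set"
  counit :: "'v \<Rightarrow> 'k"
  Delta :: "('k, 'r, 'v) ct \<Rightarrow> ('k, 'r, 'v) ct"

definition is_decomp :: "('k, 'r, 'v::ab_group_add) mv \<Rightarrow> 'v \<Rightarrow> (int \<Rightarrow> 'v) \<Rightarrow> bool" where
  "is_decomp V v g \<longleftrightarrow>
     finite {i. g i \<noteq> 0} \<and> (\<forall>i. g i \<in> hom V i) \<and> v = (\<Sum>i | g i \<noteq> 0. g i)"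

definition component :: "('k, 'r, 'v::ab_group_add) mv \<Rightarrow> 'v \<Rightarrow> int \<Rightarrow> 'v" where
  "component V v = (THE g. is_decomp V v g)"

definition graded_space :: "('k::field, 'r, 'v::ab_group_add) mv \<Rightarrow> bool" where
  "graded_space V \<longleftrightarrow> vector_space (smul V) \<and>
     (\<forall>i. module.subspace (smul V) (hom V i)) \<and>
     (\<forall>v. \<exists>!g. is_decomp V v g)"

definition koszul :: "int \<Rightarrow> int \<Rightarrow> 'k::field" where
  "koszul i j = (if odd i \<and> odd j then - 1 else 1)"

definition graded_comm_algebra :: "('k::field, 'r, 'v::ab_group_add) mv \<Rightarrow> bool" where
  "graded_comm_algebra V \<longleftrightarrow>
     (\<forall>x y z. mult V (x + y) z = mult V x z + mult V y z) \<and>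
     (\<forall>x y z. mult V x (y + z) = mult V x y + mult V x z) \<and>
     (\<forall>c x y. mult V (smul V c x) y = smul V c (mult V x y)) \<and>
     (\<forall>c x y. mult V x (smul V c y) = smul V c (mult V x y)) \<and>
     (\<forall>i j. \<forall>x\<in>hom V i. \<forall>y\<in>hom V j. mult V x y \<in> hom V (i + j)) \<and>
     (\<forall>x y z. mult V (mult V x y) z = mult V x (mult V y z)) \<and>
     (\<forall>i j. \<forall>x\<in>hom V i. \<forall>y\<in>hom V j. mult V x y = smul V (koszul i j) (mult V y x)) \<and>
     unit V \<in> hom V 0 \<and>
     (\<forall>x. mult V (unit V) x = x \<and> mult V x (unit V) = x)"

text \<open>The symmetry \<open>x \<otimes> y \<mapsto> (-1)\<^bsup>|x||y|\<^esup> y \<otimes> x\<close> on representatives of elements of \<open>V \<otimes> V\<close>.\<close>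

definition swap :: "('k::field, 'r, 'v::ab_group_add) mv \<Rightarrow> ('v list \<Rightarrow>\<^sub>0 'k) \<Rightarrow> ('v list \<Rightarrow>\<^sub>0 'k)" where
  "swap V = lext fscale (\<lambda>xs.
     let f = component V (xs ! 0); g = component V (xs ! 1) in
     \<Sum>i | f i \<noteq> 0. \<Sum>j | g j \<noteq> 0. Poly_Mapping.single [g j, f i] (koszul i j))"

definition graded_cocomm_coalgebra :: "('k::field, 'r, 'v::ab_group_add) mv \<Rightarrow> bool" where
  "graded_cocomm_coalgebra V \<longleftrightarrow>
     (\<forall>v. comul V v \<in> tpow (smul V) 2) \<and>
     (\<forall>v w. \<forall>p\<in>comul V v. \<forall>q\<in>comul V w. p + q \<in> comul V (v + w)) \<and>
     (\<forall>c v. \<forall>p\<in>comul V v. fscale c p \<in> comul V (smul V c v)) \<and>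
     (\<forall>i. \<forall>v\<in>hom V i. \<exists>p\<in>comul V v. \<forall>xs\<in>Poly_Mapping.keys p. length xs = 2 \<and>
        (\<exists>a b. xs ! 0 \<in> hom V a \<and> xs ! 1 \<in> hom V b \<and> a + b = i)) \<and>
     (\<forall>v w. counit V (v + w) = counit V v + counit V w) \<and>
     (\<forall>c v. counit V (smul V c v) = c * counit V v) \<and>
     (\<forall>i. \<forall>v\<in>hom V i. i \<noteq> 0 \<longrightarrow> counit V v = 0) \<and>
     (\<forall>v. slot_map (smul V) 3 (comul V) 0 (comul V v) = slot_map (smul V) 3 (comul V) 1 (comul V v)) \<and>
     (\<forall>v. \<forall>p\<in>comul V v. lext (smul V) (\<lambda>xs. smul V (counit V (xs ! 0)) (xs ! 1)) p = v) \<and>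
     (\<forall>v. \<forall>p\<in>comul V v. lext (smul V) (\<lambda>xs. smul V (counit V (xs ! 1)) (xs ! 0)) p = v) \<and>
     (\<forall>v. \<forall>p\<in>comul V v. swap V p \<in> comul V v)"

text \<open>The unit is a coaugmentation, the counit is an augmentation; \<open>\<epsilon>(1) = 1\<close> belongs to both.\<close>

definition augmented :: "('k::field, 'r, 'v::ab_group_add) mv \<Rightarrow> bool" where
  "augmented V \<longleftrightarrow>
     comul V (unit V) = quo (mrel (smul V) 2) (gen [unit V, unit V]) \<and>
     counit V (unit V) = 1 \<and>
     (\<forall>x y. counit V (mult V x y) = counit V x * counit V y)"

text \<open>The reduced coproduct, extended from \<open>ker \<epsilon>\<close> to \<open>V = ker \<epsilon> \<oplus> \<Bbbk>1\<close> by zero on \<open>1\<close>.\<close>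

definition rcomul :: "('k::field, 'r, 'v::ab_group_add) mv \<Rightarrow> 'v \<Rightarrow> ('v list \<Rightarrow>\<^sub>0 'k) set" where
  "rcomul V v = (let w = v - smul V (counit V v) (unit V) in
     quo (mrel (smul V) 2) (rep (comul V w) - gen [w, unit V] - gen [unit V, w]))"

fun rcomul_iter :: "('k::field, 'r, 'v::ab_group_add) mv \<Rightarrow> nat \<Rightarrow> 'v \<Rightarrow> ('v list \<Rightarrow>\<^sub>0 'k) set" where
  "rcomul_iter V 0 v = quo (mrel (smul V) 1) (gen [v])"
| "rcomul_iter V (Suc k) v = slot_map (smul V) (k + 2) (rcomul V) 0 (rcomul_iter V k v)"

definition conilpotent :: "('k::field, 'r, 'v::ab_group_add) mv \<Rightarrow> bool" where
  "conilpotent V \<longleftrightarrow>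
     (\<forall>v. \<exists>K. \<forall>k\<ge>K. rcomul_iter V k v = quo (mrel (smul V) (k + 1)) 0)"

abbreviation carr :: "('k::field, 'r::comm_ring_1) coeff \<Rightarrow> ('k, 'r, 'v::ab_group_add) mv \<Rightarrow>
    ('k, 'r, 'v) ct set" where
  "carr R V \<equiv> ctens R (smul V)"

definition cunit :: "('k::field, 'r::comm_ring_1) coeff \<Rightarrow> ('k, 'r, 'v::ab_group_add) mv \<Rightarrow>
    ('k, 'r, 'v) ct" where
  "cunit R V = incl R (smul V) (unit V)"

text \<open>The part of degree \<open>i\<close> of the completed tensor product: \<open>R\<close> sits in degree 0.\<close>

definition chom :: "('k::field, 'r::comm_ring_1) coeff \<Rightarrow> ('k, 'r, 'v::ab_group_add) mv \<Rightarrow> int \<Rightarrow>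
    ('k, 'r, 'v) ct set" where
  "chom R V i = {x \<in> carr R V. \<forall>n. \<exists>p\<in>x n. fst ` Poly_Mapping.keys p \<subseteq> hom V i}"

definition has_degree :: "('k::field, 'r::comm_ring_1) coeff \<Rightarrow> ('k, 'r, 'v::ab_group_add) mv \<Rightarrow>
    ('k, 'r, 'w::ab_group_add) mv \<Rightarrow> int \<Rightarrow> (('k, 'r, 'v) ct \<Rightarrow> ('k, 'r, 'w) ct) \<Rightarrow> bool" where
  "has_degree R V W d f \<longleftrightarrow> (\<forall>i. \<forall>x\<in>chom R V i. f x \<in> chom R W (i + d))"

definition mv_algebra :: "('k::field, 'r::comm_ring_1) coeff \<Rightarrow> ('k, 'r, 'v::ab_group_add) mv \<Rightarrow> bool" where
  "mv_algebra R V \<longleftrightarrow>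
     graded_space V \<and> graded_comm_algebra V \<and> graded_cocomm_coalgebra V \<and>
     augmented V \<and> conilpotent V \<and>
     clinear R (smul V) (smul V) (Delta V) \<and> ccontinuous R (smul V) (Delta V) \<and>
     has_degree R V V 1 (Delta V) \<and>
     (\<forall>x\<in>carr R V. Delta V (Delta V x) = czero R (smul V)) \<and>
     Delta V (cunit R V) = czero R (smul V)"

definition ground :: "('k::field, 'r::comm_ring_1) coeff \<Rightarrow> ('k, 'r, 'k) mv" where
  "ground R = \<lparr> smul = (*), hom = (\<lambda>i. if i = 0 then UNIV else {0}), mult = (*), unit = 1,
     comul = (\<lambda>c. quo (mrel (*) 2) (Poly_Mapping.single [1, 1] c)), counit = (\<lambda>c. c),
     Delta = (\<lambda>_. czero R (*)) \<rparr>"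

definition cmult :: "('k::field, 'r::comm_ring_1) coeff \<Rightarrow> ('k, 'r, 'v::ab_group_add) mv \<Rightarrow>
    ('k, 'r, 'v) ct \<Rightarrow> ('k, 'r, 'v) ct \<Rightarrow> ('k, 'r, 'v) ct" where
  "cmult R V x y = (\<lambda>n. quo (trel R (smul V) n)
     (lext fscale (\<lambda>(v, r). lext fscale (\<lambda>(w, t). gen (mult V v w, r * t)) (rep (y n))) (rep (x n))))"

fun cpow :: "('k::field, 'r::comm_ring_1) coeff \<Rightarrow> ('k, 'r, 'v::ab_group_add) mv \<Rightarrow>
    ('k, 'r, 'v) ct \<Rightarrow> nat \<Rightarrow> ('k, 'r, 'v) ct" where
  "cpow R V x 0 = cunit R V"
| "cpow R V x (Suc n) = cmult R V x (cpow R V x n)"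

definition cexp :: "('k::field_char_0, 'r::comm_ring_1) coeff \<Rightarrow> ('k, 'r, 'v::ab_group_add) mv \<Rightarrow>
    ('k, 'r, 'v) ct \<Rightarrow> ('k, 'r, 'v) ct" where
  "cexp R V S = cseries R (smul V) exp_coeff (cpow R V S)"

text \<open>\<open>clog R V x\<close> is \<open>log(1 + g)\<close> for \<open>x = 1 + g\<close>.\<close>

definition clog :: "('k::field_char_0, 'r::comm_ring_1) coeff \<Rightarrow> ('k, 'r, 'v::ab_group_add) mv \<Rightarrow>
    ('k, 'r, 'v) ct \<Rightarrow> ('k, 'r, 'v) ct" where
  "clog R V x = cseries R (smul V) log_coeff (cpow R V (csub R (smul V) x (cunit R V)))"

definition QME :: "('k::field_char_0, 'r::comm_ring_1) coeff \<Rightarrow> ('k, 'r, 'v::ab_group_add) mv \<Rightarrow>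
    ('k, 'r, 'v) ct set" where
  "QME R V = {S \<in> chom R V 0 \<inter> cmax R (smul V). Delta V (cexp R V S) = czero R (smul V)}"

text \<open>Maps are extensional: they are \<open>undefined\<close> off the completed tensor product.\<close>

definition Lin :: "('k::field, 'r::comm_ring_1) coeff \<Rightarrow> ('k, 'r, 'v::ab_group_add) mv \<Rightarrow>
    ('k, 'r, 'w::ab_group_add) mv \<Rightarrow> (('k, 'r, 'v) ct \<Rightarrow> ('k, 'r, 'w) ct) set" where
  "Lin R V W = {f \<in> carr R V \<rightarrow>\<^sub>E carr R W.
     clinear R (smul V) (smul W) f \<and> ccontinuous R (smul V) f \<and> has_degree R V W 0 f}"

definition Lin0 :: "('k::field, 'r::comm_ring_1) coeff \<Rightarrow> ('k, 'r, 'v::ab_group_add) mv \<Rightarrow>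
    ('k, 'r, 'w::ab_group_add) mv \<Rightarrow> (('k, 'r, 'v) ct \<Rightarrow> ('k, 'r, 'w) ct) set" where
  "Lin0 R V W = {f \<in> Lin R V W.
     \<forall>c. f (incl R (smul V) (smul V c (unit V))) \<in> cmax R (smul W)}"

text \<open>The convolution product sends \<open>v\<close> to \<open>\<Sum> f(v') g(v'')\<close>, where \<open>\<delta>(v) = \<Sum> v' \<otimes> v''\<close>; there is no
  Koszul sign since \<open>g\<close> has degree 0.\<close>

definition conv :: "('k::field, 'r::comm_ring_1) coeff \<Rightarrow> ('k, 'r, 'v::ab_group_add) mv \<Rightarrow>
    ('k, 'r, 'w::ab_group_add) mv \<Rightarrow> (('k, 'r, 'v) ct \<Rightarrow> ('k, 'r, 'w) ct) \<Rightarrow>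
    (('k, 'r, 'v) ct \<Rightarrow> ('k, 'r, 'w) ct) \<Rightarrow> ('k, 'r, 'v) ct \<Rightarrow> ('k, 'r, 'w) ct" where
  "conv R V W f g = (\<lambda>z\<in>carr R V. cext R (smul W)
     (\<lambda>v. clin R (smul W)
        (\<lambda>xs. cmult R W (f (incl R (smul V) (xs ! 0))) (g (incl R (smul V) (xs ! 1))))
        (rep (comul V v))) z)"

definition conv_unit :: "('k::field, 'r::comm_ring_1) coeff \<Rightarrow> ('k, 'r, 'v::ab_group_add) mv \<Rightarrow>
    ('k, 'r, 'w::ab_group_add) mv \<Rightarrow> ('k, 'r, 'v) ct \<Rightarrow> ('k, 'r, 'w) ct" where
  "conv_unit R V W = (\<lambda>z\<in>carr R V. cext R (smul W)
     (\<lambda>v. incl R (smul W) (smul W (counit V v) (unit W))) z)"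

fun conv_pow :: "('k::field, 'r::comm_ring_1) coeff \<Rightarrow> ('k, 'r, 'v::ab_group_add) mv \<Rightarrow>
    ('k, 'r, 'w::ab_group_add) mv \<Rightarrow> (('k, 'r, 'v) ct \<Rightarrow> ('k, 'r, 'w) ct) \<Rightarrow> nat \<Rightarrow>
    ('k, 'r, 'v) ct \<Rightarrow> ('k, 'r, 'w) ct" where
  "conv_pow R V W f 0 = conv_unit R V W"
| "conv_pow R V W f (Suc n) = conv R V W f (conv_pow R V W f n)"

definition conv_exp :: "('k::field_char_0, 'r::comm_ring_1) coeff \<Rightarrow> ('k, 'r, 'v::ab_group_add) mv \<Rightarrow>
    ('k, 'r, 'w::ab_group_add) mv \<Rightarrow> (('k, 'r, 'v) ct \<Rightarrow> ('k, 'r, 'w) ct) \<Rightarrow>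
    ('k, 'r, 'v) ct \<Rightarrow> ('k, 'r, 'w) ct" where
  "conv_exp R V W f = (\<lambda>z\<in>carr R V. cseries R (smul W) exp_coeff (\<lambda>j. conv_pow R V W f j z))"

text \<open>\<open>conv_log R V W h\<close> is \<open>log(e + g)\<close> for \<open>h = e + g\<close>, where \<open>e\<close> is the unit for the
  convolution.\<close>

definition conv_log :: "('k::field_char_0, 'r::comm_ring_1) coeff \<Rightarrow> ('k, 'r, 'v::ab_group_add) mv \<Rightarrow>
    ('k, 'r, 'w::ab_group_add) mv \<Rightarrow> (('k, 'r, 'v) ct \<Rightarrow> ('k, 'r, 'w) ct) \<Rightarrow>
    ('k, 'r, 'v) ct \<Rightarrow> ('k, 'r, 'w) ct" where
  "conv_log R V W h =
     (let g = (\<lambda>z\<in>carr R V. csub R (smul W) (h z) (conv_unit R V W z)) in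
      (\<lambda>z\<in>carr R V. cseries R (smul W) log_coeff (\<lambda>j. conv_pow R V W g j z)))"

definition MV :: "('k::field_char_0, 'r::comm_ring_1) coeff \<Rightarrow> ('k, 'r, 'v::ab_group_add) mv \<Rightarrow>
    ('k, 'r, 'w::ab_group_add) mv \<Rightarrow> (('k, 'r, 'v) ct \<Rightarrow> ('k, 'r, 'w) ct) set" where
  "MV R V W = {f \<in> Lin0 R V W.
     \<forall>z\<in>carr R V. Delta W (conv_exp R V W f z) = conv_exp R V W f (Delta V z)}"

definition mv_comp :: "('k::field_char_0, 'r::comm_ring_1) coeff \<Rightarrow> ('k, 'r, 'u::ab_group_add) mv \<Rightarrow>
    ('k, 'r, 'v::ab_group_add) mv \<Rightarrow> ('k, 'r, 'w::ab_group_add) mv \<Rightarrow>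
    (('k, 'r, 'v) ct \<Rightarrow> ('k, 'r, 'w) ct) \<Rightarrow> (('k, 'r, 'u) ct \<Rightarrow> ('k, 'r, 'v) ct) \<Rightarrow>
    ('k, 'r, 'u) ct \<Rightarrow> ('k, 'r, 'w) ct" where
  "mv_comp R U V W f g =
     conv_log R U W (compose (carr R U) (conv_exp R V W f) (conv_exp R U V g))"

text \<open>The action of a morphism \<open>f\<close> on solutions of the quantum master equation, which makes
  \<open>QME\<close> a functor: \<open>S\<close> is sent to the \<open>S'\<close> with \<open>e\<^bsup>S'\<^esup> = exp(f)(e\<^bsup>S\<^esup>)\<close>.\<close>

definition QME_map :: "('k::field_char_0, 'r::comm_ring_1) coeff \<Rightarrow> ('k, 'r, 'v::ab_group_add) mv \<Rightarrow>
    ('k, 'r, 'w::ab_group_add) mv \<Rightarrow> (('k, 'r, 'v) ct \<Rightarrow> ('k, 'r, 'w) ct) \<Rightarrow>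
    ('k, 'r, 'v) ct \<Rightarrow> ('k, 'r, 'w) ct" where
  "QME_map R V W f S = clog R W (conv_exp R V W f (cexp R V S))"

end

theory Submission
  imports Defs "HOL-Computational_Algebra.Polynomial_FPS"
begin

text \<open>
  Why the theorem holds. The completion of \<open>\<Bbbk> \<otimes> R\<close> is \<open>R\<close> itself, because \<open>R\<close> is complete
  (\<open>carr_ground\<close>); so a continuous \<open>R\<close>-linear map \<open>s\<close> from it is determined by \<open>S = s(1)\<close>, which can
  be prescribed. Since \<open>\<delta>(1) = 1 \<otimes> 1\<close>, convolution with source \<open>\<Bbbk>\<close> is multiplication of the values at
  1, whence \<open>exp(s)(1) = e\<^sup>S\<close> (\<open>conv_exp_cunit\<close>). As the differential of \<open>\<Bbbk>\<close> is zero, \<open>s\<close> is a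
  morphism iff \<open>\<Delta> e\<^sup>S = 0\<close>. This is the bijection.

  For naturality, a morphism \<open>f\<close> from \<open>V\<close> to \<open>W\<close> sends \<open>S\<close> to the logarithm \<open>S'\<close> of \<open>exp(f)(e\<^sup>S)\<close>. Then
  \<open>e\<^bsup>S'\<^esup> = exp(f)(e\<^sup>S)\<close> is annihilated by \<open>\<Delta>\<close>, because \<open>exp(f)\<close> commutes with the differentials; and the
  composite of \<open>f\<close> and \<open>s\<close> has the value \<open>S'\<close> at 1, again because everything with source \<open>\<Bbbk>\<close> is
  determined by values at 1. Two facts carry this part.

  \<^item> \<open>e\<^bsup>log x\<^esup> = x\<close> for \<open>x\<close> congruent to 1 modulo \<open>\<mm>\<close> (\<open>cexp_clog\<close>). Modulo \<open>\<mm>\<^sup>n\<close> only finitely many terms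
    matter, and the identity follows from the one for formal power series by evaluating
    polynomials.

  \<^item> The series \<open>exp(f)\<close> converges and is linear, continuous and of degree 0 (\<open>conv_exp_eq_cext\<close>). This
    is where conilpotency enters: the \<open>j\<close>-th convolution power of \<open>f\<close> at \<open>v\<close> multiplies values of \<open>f\<close> on
    the factors of the \<open>j\<close>-fold coproduct of \<open>v\<close>; by conilpotency all but a number of these factors that
    is bounded in terms of \<open>v\<close> are equal to 1, and \<open>f(1)\<close> lies in \<open>W \<otimes> \<mm>\<close> (\<open>good_conilpotent\<close>).

  Tensors are cosets of formal combinations. Two devices reduce all computations with them to linear
  algebra. A linear section \<open>nf\<close> of each quotient map provides normal forms, so that elements of
  \<open>V \<otimes> R / V \<otimes> \<mm>\<^sup>n\<close> are compared by equality of vectors. Iterated coproducts are used only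
  through their pairings with multilinear functions (\<open>lext_slot_map\<close>).
\<close>

section \<open>Free vector spaces, linear extensions and sections of quotients\<close>

abbreviation lin :: "('k::field \<Rightarrow> 'a \<Rightarrow> 'a) \<Rightarrow> ('k \<Rightarrow> 'b \<Rightarrow> 'b) \<Rightarrow>
    ('a::ab_group_add \<Rightarrow> 'b::ab_group_add) \<Rightarrow> bool" where
  "lin \<equiv> Vector_Spaces.linear"

lemma lookup_fscale [simp]: "Poly_Mapping.lookup (fscale c p) b = c * Poly_Mapping.lookup p b"
  unfolding fscale_def by (simp add: Poly_Mapping.map.rep_eq when_def)

interpretation free: vector_space "fscale :: 'k::field \<Rightarrow> ('b \<Rightarrow>\<^sub>0 'k) \<Rightarrow> ('b \<Rightarrow>\<^sub>0 'k)"
  by unfold_locales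
    (rule poly_mapping_eqI; simp add: lookup_add algebra_simps)+

lemma fscale_single [simp]: "fscale c (Poly_Mapping.single b a) = Poly_Mapping.single b (c * a)"
  by (rule poly_mapping_eqI) (simp add: lookup_single when_def)

lemma lin_iff:
  "lin s t f \<longleftrightarrow> vector_space s \<and> vector_space t \<and>
     (\<forall>x y. f (x + y) = f x + f y) \<and> (\<forall>c x. f (s c x) = t c (f x))"
  by (fact Vector_Spaces.linear_iff)

lemma linI:
  assumes "vector_space s" "vector_space t"
    "\<And>x y. f (x + y) = f x + f y" "\<And>c x. f (s c x) = t c (f x)"
  shows "lin s t f"
  using assms by (simp add: lin_iff)

lemma
  assumes "lin s t f"
  shows lin_add: "f (x + y) = f x + f y"
    and lin_scale: "f (s c x) = t c (f x)"
    and lin_zero: "f 0 = 0"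
    and lin_diff: "f (x - y) = f x - f y"
    and lin_sum: "f (\<Sum>i\<in>I. g i) = (\<Sum>i\<in>I. f (g i))"
proof -
  interpret Vector_Spaces.linear s t f by fact
  show "f (x + y) = f x + f y" "f (s c x) = t c (f x)" "f 0 = 0" "f (x - y) = f x - f y"
    "f (\<Sum>i\<in>I. g i) = (\<Sum>i\<in>I. f (g i))"
    by (simp_all add: add scale diff neg sum)
qed

lemma linD:
  assumes "lin s t f"
  shows "vector_space s" "vector_space t"
  using assms by (simp_all add: lin_iff)

lemma lin_comp: "lin s t f \<Longrightarrow> lin t u g \<Longrightarrow> lin s u (\<lambda>x. g (f x))"
  by (simp add: lin_iff)

lemma lin_const_zero:
  assumes "vector_space s" "vector_space t"
  shows "lin s t (\<lambda>_. 0)"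
proof -
  interpret t: vector_space t by fact
  show ?thesis by (rule linI) (simp_all add: assms)
qed

lemma lin_plus: "lin s t f \<Longrightarrow> lin s t g \<Longrightarrow> lin s t (\<lambda>x. f x + g x)"
  by (simp add: lin_iff vector_space_def algebra_simps)

lemma lin_diff_fun:
  assumes "lin s t f" "lin s t g"
  shows "lin s t (\<lambda>x. f x - g x)"
proof -
  interpret t: vector_space t by (rule linD(2)[OF assms(1)])
  show ?thesis
    by (rule linI)
      (simp_all add: linD[OF assms(1)] lin_add[OF assms(1)] lin_add[OF assms(2)]
        lin_scale[OF assms(1)] lin_scale[OF assms(2)] t.scale_right_diff_distrib)
qed

lemma lin_sumI:
  assumes "vector_space s" "vector_space t" "\<And>i. i \<in> I \<Longrightarrow> lin s t (f i)"
  shows "lin s t (\<lambda>x. \<Sum>i\<in>I. f i x)"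
  using assms(3)
  by (induction I rule: infinite_finite_induct)
    (simp_all add: lin_const_zero lin_plus assms)

lemma lin_scaleI:
  assumes "lin s t f"
  shows "lin s t (\<lambda>x. t c (f x))"
  using assms by (auto simp add: lin_iff vector_space_def mult.commute)

lemma lin_id: "vector_space s \<Longrightarrow> lin s s (\<lambda>x. x)"
  by (simp add: lin_iff)

lemma lext_superset:
  assumes "vector_space t" "finite A" "Poly_Mapping.keys p \<subseteq> A"
  shows "lext t g p = (\<Sum>b\<in>A. t (Poly_Mapping.lookup p b) (g b))"
proof -
  interpret vector_space t by fact
  show ?thesis
    unfolding lext_def
    by (rule sum.mono_neutral_left) (use assms in \<open>auto simp: in_keys_iff\<close>)
qed

lemma lin_lext [simp, intro]:
  fixes t :: "'k::field \<Rightarrow> 'a::ab_group_add \<Rightarrow> 'a" and g :: "'b \<Rightarrow> 'a"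
  assumes "vector_space t"
  shows "lin fscale t (lext t g)"
proof -
  interpret vector_space t by fact
  show ?thesis
  proof (rule linI)
    fix p q :: "'b \<Rightarrow>\<^sub>0 'k" and c :: 'k
    let ?A = "Poly_Mapping.keys p \<union> Poly_Mapping.keys q"
    show "lext t g (p + q) = lext t g p + lext t g q"
      using lext_superset[OF assms, of ?A] keys_add[of p q]
      by (simp add: lookup_add scale_left_distrib sum.distrib)
    have "Poly_Mapping.keys (fscale c p) \<subseteq> Poly_Mapping.keys p"
      by (auto simp: in_keys_iff)
    then show "lext t g (fscale c p) = t c (lext t g p)"
      by (simp add: lext_superset[OF assms, of "Poly_Mapping.keys p"] scale_sum_right)
  qed (use assms free.vector_space_axioms in auto)
qed

lemmas vs_free = free.vector_space_axioms

lemma lext_single: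
  assumes "vector_space t"
  shows "lext t g (Poly_Mapping.single b c) = t c (g b)"
proof -
  interpret vector_space t by fact
  show ?thesis by (simp add: lext_superset[OF assms, of "{b}"])
qed

lemma lext_gen [simp]:
  assumes "vector_space t"
  shows "lext t g (gen b) = g b"
proof -
  interpret vector_space t by fact
  show ?thesis by (simp add: lext_superset[OF assms, of "{b}"])
qed

lemma lext_zero [simp]: "lext t g 0 = 0"
  by (simp add: lext_def)

lemma lext_cong:
  "(\<And>b. b \<in> Poly_Mapping.keys p \<Longrightarrow> g b = h b) \<Longrightarrow> lext t g p = lext t h p"
  by (simp add: lext_def)

lemma lext_gen_id [simp]: "lext fscale gen p = p"
  by (rule poly_mapping_eqI)
    (simp add: lext_def lookup_sum lookup_single when_def in_keys_iff sum.delta)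

lemma lin_lext_comp:
  assumes "lin s t f"
  shows "f (lext s g p) = lext t (\<lambda>b. f (g b)) p"
  by (simp add: lext_def lin_sum[OF assms] lin_scale[OF assms])

lemma lin_eq_lext:
  assumes "lin fscale t f"
  shows "f p = lext t (\<lambda>b. f (gen b)) p"
  using lin_lext_comp[OF assms, of gen p] by simp

lemma lin_eqI:
  assumes "lin fscale t f" "lin fscale t g" "\<And>b. f (gen b) = g (gen b)"
  shows "f p = g p"
  using lin_eq_lext[OF assms(1), of p] lin_eq_lext[OF assms(2), of p] assms(3) by simp

lemma lext_lext:
  assumes "vector_space t"
  shows "lext t f (lext fscale g p) = lext t (\<lambda>b. lext t f (g b)) p"
  by (rule lin_lext_comp) (simp add: assms)

lemma lext_fun:
  assumes "vector_space t"
  shows lext_add_fun: "lext t (\<lambda>b. f b + g b) p = lext t f p + lext t g p"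
    and lext_diff_fun: "lext t (\<lambda>b. f b - g b) p = lext t f p - lext t g p"
proof -
  interpret vector_space t by fact
  show "lext t (\<lambda>b. f b + g b) p = lext t f p + lext t g p"
    "lext t (\<lambda>b. f b - g b) p = lext t f p - lext t g p"
    by (simp_all add: lext_def scale_right_distrib scale_right_diff_distrib sum.distrib sum_subtractf)
qed

lemma lin_lext_param:
  assumes "vector_space s" "vector_space t" "\<And>b. b \<in> Poly_Mapping.keys p \<Longrightarrow> lin s t (\<lambda>x. g x b)"
  shows "lin s t (\<lambda>x. lext t (g x) p)"
  unfolding lext_def by (intro lin_sumI lin_scaleI assms)

lemma lin_span:
  assumes "lin s t f" "p \<in> module.span s A" "\<And>a. a \<in> A \<Longrightarrow> f a \<in> S" "module.subspace t S"
  shows "f p \<in> S"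
proof -
  interpret Vector_Spaces.linear s t f by fact
  show ?thesis
    using assms(2)
  proof (induction rule: vs1.span_induct_alt)
    case (step c x y)
    then show ?case
      using assms(3,4) by (simp add: add scale vs2.subspace_add vs2.subspace_scale)
  qed (use assms(4) vs2.subspace_0 in simp)
qed

lemma lin_span_kill:
  assumes "lin s t f" "p \<in> module.span s A" "\<And>a. a \<in> A \<Longrightarrow> f a = 0"
  shows "f p = 0"
proof -
  interpret Vector_Spaces.linear s t f by fact
  show ?thesis
    using lin_span[OF assms(1,2), of "{0}"] assms(3) by (simp add: vs2.subspace_single_0)
qed

lemma lext_mem_subspace:
  assumes "vector_space t" "module.subspace t S" "\<And>b. b \<in> Poly_Mapping.keys p \<Longrightarrow> g b \<in> S"
  shows "lext t g p \<in> S"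
proof -
  interpret vector_space t by fact
  show ?thesis
    unfolding lext_def using assms(2,3) by (intro subspace_sum subspace_scale)
qed

lemma lin_all_mem:
  assumes "lin fscale t f" "module.subspace t S" "\<And>b. f (gen b) \<in> S"
  shows "f p \<in> S"
  unfolding lin_eq_lext[OF assms(1), of p]
  by (rule lext_mem_subspace[OF linD(2)[OF assms(1)] assms(2,3)])

text \<open>The projection onto a complement of \<open>N\<close> with kernel \<open>N\<close>. It is a linear section of the
  quotient map: it turns equality of cosets into equality of normal forms, and computations with
  chosen representatives into computations with linear maps.\<close>

definition nf :: "('b \<Rightarrow>\<^sub>0 'k::field) set \<Rightarrow> ('b \<Rightarrow>\<^sub>0 'k) \<Rightarrow> ('b \<Rightarrow>\<^sub>0 'k)" where
  "nf N = (SOME f. lin fscale fscale f \<and> (\<forall>p. f p = 0 \<longleftrightarrow> p \<in> N) \<and> (\<forall>p. p - f p \<in> N))"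

lemma nf:
  fixes N :: "('b \<Rightarrow>\<^sub>0 'k::field) set"
  assumes "free.subspace N"
  shows lin_nf: "lin fscale fscale (nf N)"
    and nf_eq_0: "nf N p = 0 \<longleftrightarrow> p \<in> N"
    and diff_nf: "p - nf N p \<in> N"
proof -
  interpret vector_space_pair fscale "fscale :: 'k \<Rightarrow> ('b \<Rightarrow>\<^sub>0 'k) \<Rightarrow> _" by unfold_locales
  have "lin fscale fscale (\<lambda>p :: 'b \<Rightarrow>\<^sub>0 'k. p)" by (rule lin_id[OF vs_free])
  from linear_exists_left_inverse_on[OF this assms]
  obtain g :: "('b \<Rightarrow>\<^sub>0 'k) \<Rightarrow> ('b \<Rightarrow>\<^sub>0 'k)"
    where g: "range g \<subseteq> N" "lin fscale fscale g" "\<And>p. p \<in> N \<Longrightarrow> g p = p"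
    by (auto simp: inj_on_def)
  have "lin fscale fscale (\<lambda>p. p - g p)"
    by (rule linI)
      (simp_all add: vs_free lin_add[OF g(2)] lin_scale[OF g(2)] free.scale_right_diff_distrib)
  moreover have "p - g p = 0 \<longleftrightarrow> p \<in> N" for p
    using g(1) g(3)[of p] by (metis eq_iff_diff_eq_0 rangeI subsetD)
  moreover have "p - (p - g p) \<in> N" for p
    using g(1) by auto
  ultimately have "lin fscale fscale (\<lambda>p. p - g p) \<and> (\<forall>p. p - g p = 0 \<longleftrightarrow> p \<in> N) \<and>
      (\<forall>p. p - (p - g p) \<in> N)"
    by blast
  from someI[of "\<lambda>f. lin fscale fscale f \<and> (\<forall>p. f p = 0 \<longleftrightarrow> p \<in> N) \<and> (\<forall>p. p - f p \<in> N)", OF this,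
      folded nf_def]
  have *: "lin fscale fscale (nf N) \<and> (\<forall>p. nf N p = 0 \<longleftrightarrow> p \<in> N) \<and> (\<forall>p. p - nf N p \<in> N)" .
  show "lin fscale fscale (nf N)"
    using * by blast
  show "nf N p = 0 \<longleftrightarrow> p \<in> N" "p - nf N p \<in> N"
    using * by blast+
qed

lemma nf_eq_iff:
  assumes "free.subspace N"
  shows "nf N p = nf N q \<longleftrightarrow> p - q \<in> N"
  using nf_eq_0[OF assms, of "p - q"] lin_diff[OF lin_nf[OF assms], of p q] by auto

lemma nf_nf [simp]:
  assumes "free.subspace N"
  shows "nf N (nf N p) = nf N p"
  using nf_eq_iff[OF assms, of p "nf N p"] diff_nf[OF assms, of p] by simp

lemma mem_quo: "q \<in> quo N p \<longleftrightarrow> q - p \<in> N"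
  by (simp add: quo_def)

lemma quo_refl: "free.subspace N \<Longrightarrow> p \<in> quo N p"
  by (simp add: mem_quo free.subspace_0)

lemma quo_eq_iff:
  assumes "free.subspace N"
  shows "quo N p = quo N q \<longleftrightarrow> p - q \<in> N"
proof
  assume "p - q \<in> N"
  then have "r - p \<in> N \<longleftrightarrow> r - q \<in> N" for r
    using free.subspace_add[OF assms, of "r - p" "p - q"]
      free.subspace_diff[OF assms, of "r - q" "p - q"] by (auto simp: algebra_simps)
  then show "quo N p = quo N q" by (simp add: quo_def)
qed (use quo_refl[OF assms, of p] mem_quo in blast)

lemma mem_quo_eq: "free.subspace N \<Longrightarrow> q \<in> quo N p \<Longrightarrow> quo N q = quo N p"
  by (simp add: mem_quo quo_eq_iff)

lemma rep_mem: "p \<in> t \<Longrightarrow> rep t \<in> t"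
  unfolding rep_def by (rule someI)

lemma rep_quo: "free.subspace N \<Longrightarrow> rep (quo N p) - p \<in> N"
  using rep_mem[OF quo_refl] mem_quo by blast

lemma nf_rep_quo [simp]: "free.subspace N \<Longrightarrow> nf N (rep (quo N p)) = nf N p"
  by (simp add: nf_eq_iff rep_quo)

lemma quo_eq_nf_iff: "free.subspace N \<Longrightarrow> quo N p = quo N q \<longleftrightarrow> nf N p = nf N q"
  by (simp add: quo_eq_iff nf_eq_iff)

lemma quo_nf [simp]: "free.subspace N \<Longrightarrow> quo N (nf N p) = quo N p"
  by (simp add: quo_eq_nf_iff)

section \<open>Tensor powers and multilinear functions on words\<close>

text \<open>Multilinearity is only required on words of length \<open>n\<close>; other words never occur in
  representatives of elements of the \<open>n\<close>-th tensor power (\<open>length_keys_tpow\<close>).\<close>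

definition mlin :: "('k::field \<Rightarrow> 'v \<Rightarrow> 'v) \<Rightarrow> ('k \<Rightarrow> 'a \<Rightarrow> 'a) \<Rightarrow> nat \<Rightarrow>
    ('v::ab_group_add list \<Rightarrow> 'a::ab_group_add) \<Rightarrow> bool" where
  "mlin s t n \<Psi> \<longleftrightarrow>
     (\<forall>xs ys. length xs + length ys + 1 = n \<longrightarrow> lin s t (\<lambda>x. \<Psi> (xs @ x # ys)))"

lemma subspace_mrel [simp]: "free.subspace (mrel s n)"
  unfolding mrel_def by (rule free.subspace_span)

lemma lext_mrel:
  assumes "mlin s t n \<Psi>" "vector_space t" "p \<in> mrel s n"
  shows "lext t \<Psi> p = 0"
  using lin_lext[OF assms(2), of \<Psi>] assms(3)[unfolded mrel_def]
proof (rule lin_span_kill)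
  have *: "lin s t (\<lambda>x. \<Psi> (xs @ x # ys))" if "length xs + length ys + 1 = n" for xs ys
    using assms(1) that by (auto simp: mlin_def)
  interpret vector_space t by fact
  note l = lin_diff[OF lin_lext[OF assms(2), of \<Psi>]]
  fix a
  assume "a \<in> {gen (xs @ (x + y) # ys) - gen (xs @ x # ys) - gen (xs @ y # ys) | xs x y ys.
         length xs + length ys + 1 = n} \<union>
      {gen (xs @ s c x # ys) - Poly_Mapping.single (xs @ x # ys) c | xs c x ys.
         length xs + length ys + 1 = n}"
  then show "lext t \<Psi> a = 0"
    by (auto simp: l assms(2) lext_single lin_add[OF *] lin_scale[OF *])
qed

lemma lext_mem_coset:
  assumes "mlin s t n \<Psi>" "vector_space t" "p \<in> quo (mrel s n) q"
  shows "lext t \<Psi> p = lext t \<Psi> q"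
  using lext_mrel[OF assms(1,2), of "p - q"] assms(3) lin_diff[OF lin_lext[OF assms(2)], of \<Psi> p q]
  by (simp add: mem_quo)

lemma subspace_keys:
  fixes K :: "'b set"
  shows "free.subspace {p :: 'b \<Rightarrow>\<^sub>0 'k::field. Poly_Mapping.keys p \<subseteq> K}"
  unfolding free.subspace_def
  by (auto simp: in_keys_iff subset_iff lookup_add) (metis add_0)

lemma keys_subset_span:
  assumes "p \<in> free.span A" "\<And>a. a \<in> A \<Longrightarrow> Poly_Mapping.keys a \<subseteq> K"
  shows "Poly_Mapping.keys p \<subseteq> K"
  using lin_span[OF lin_id[OF vs_free] assms(1), of "{p. Poly_Mapping.keys p \<subseteq> K}"]
    assms(2) subspace_keys by auto

text \<open>The multilinearity relators are homogeneous in the length of words, so that no representative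
  of a tensor contains a word of the wrong length.\<close>

lemma length_keys_tpow:
  assumes "t \<in> tpow s n" "p \<in> t" "ws \<in> Poly_Mapping.keys p"
  shows "length ws = n"
proof -
  obtain q where q: "t = quo (mrel s n) q" "\<And>xs. xs \<in> Poly_Mapping.keys q \<Longrightarrow> length xs = n"
    using assms(1) by (auto simp: tpow_def)
  have "Poly_Mapping.keys (p - q) \<subseteq> {ws. length ws = n}"
  proof (rule keys_subset_span)
    show "p - q \<in> free.span (
     {gen (xs @ (x + y) # ys) - gen (xs @ x # ys) - gen (xs @ y # ys) | xs x y ys.
         length xs + length ys + 1 = n} \<union>
      {gen (xs @ s c x # ys) - Poly_Mapping.single (xs @ x # ys) c | xs c x ys.
         length xs + length ys + 1 = n})"
      using assms(2) q(1) by (simp add: mem_quo mrel_def)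
  next
    fix a
    assume "a \<in>
     {gen (xs @ (x + y) # ys) - gen (xs @ x # ys) - gen (xs @ y # ys) | xs x y ys.
         length xs + length ys + 1 = n} \<union>
      {gen (xs @ s c x # ys) - Poly_Mapping.single (xs @ x # ys) c | xs c x ys.
         length xs + length ys + 1 = n}"
    then show "Poly_Mapping.keys a \<subseteq> {ws. length ws = n}"
      by (auto simp: in_keys_iff lookup_minus lookup_single when_def split: if_splits)
  qed
  moreover have "ws \<in> Poly_Mapping.keys (p - q) \<union> Poly_Mapping.keys q"
    using assms(3) by (auto simp: in_keys_iff lookup_minus)
  ultimately show ?thesis using q(2) by auto
qed

lemma tpow_rep:
  assumes "t \<in> tpow s n"
  shows "rep t \<in> t" "t = quo (mrel s n) (rep t)"
    "\<And>ws. ws \<in> Poly_Mapping.keys (rep t) \<Longrightarrow> length ws = n"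
proof -
  obtain q where q: "t = quo (mrel s n) q"
    using assms by (auto simp: tpow_def)
  show 1: "rep t \<in> t" unfolding q by (rule rep_mem[OF quo_refl]) simp
  show "t = quo (mrel s n) (rep t)" using mem_quo_eq[OF _ 1[unfolded q]] q by simp
  show "length ws = n" if "ws \<in> Poly_Mapping.keys (rep t)" for ws
    using length_keys_tpow[OF assms 1 that] .
qed

lemma lext_rep_tpow:
  assumes "mlin s u n \<Psi>" "vector_space u" "t \<in> tpow s n" "p \<in> t"
  shows "lext u \<Psi> (rep t) = lext u \<Psi> p"
  using lext_mem_coset[OF assms(1,2), of p "rep t"] tpow_rep(2)[OF assms(3)] assms(4) by simp

text \<open>Evaluating a multilinear function after a coproduct has been inserted in slot \<open>i\<close> amounts to
  evaluating another function before the insertion. All identities between iterated coproducts are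
  used through this adjunction.\<close>

lemma lext_slot_map:
  assumes "mlin s u n \<Psi>" "vector_space u"
  shows "lext u \<Psi> (rep (slot_map s n D i t)) =
    lext u (\<lambda>zs. lext u (\<lambda>ws. \<Psi> (take i zs @ ws @ drop (Suc i) zs)) (rep (D (zs ! i)))) (rep t)"
  unfolding slot_map_def
  using lext_mem_coset[OF assms rep_mem[OF quo_refl[OF subspace_mrel]]]
  by (simp add: lext_lext assms(2))

lemma slot_map_tpow:
  assumes "\<And>zs. zs \<in> Poly_Mapping.keys (rep t) \<Longrightarrow> length zs = Suc n"
    and "\<And>v ws. ws \<in> Poly_Mapping.keys (rep (D v)) \<Longrightarrow> length ws = 2" and "i \<le> n"
  shows "slot_map s (n + 2) D i t \<in> tpow s (n + 2)"
proof -
  let ?f = "\<lambda>zs. lext fscale (\<lambda>ws. gen (take i zs @ ws @ drop (Suc i) zs)) (rep (D (zs ! i)))"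
  have "lext fscale ?f (rep t) \<in> {p. Poly_Mapping.keys p \<subseteq> {ws. length ws = n + 2}}"
    using assms by (intro lext_mem_subspace vs_free subspace_keys) auto
  then show ?thesis
    unfolding slot_map_def tpow_def by blast
qed

lemma mlin_2I:
  assumes "\<And>y. lin s u (\<lambda>x. \<Psi> [x, y])" "\<And>x. lin s u (\<lambda>y. \<Psi> [x, y])"
  shows "mlin s u 2 \<Psi>"
  unfolding mlin_def
proof (intro allI impI)
  fix xs ys :: "'a list"
  assume "length xs + length ys + 1 = 2"
  then consider y where "xs = []" "ys = [y]" | x where "xs = [x]" "ys = []"
    by (cases xs; cases ys) auto
  then show "lin s u (\<lambda>x. \<Psi> (xs @ x # ys))"
    using assms by cases auto
qed

lemma mlin_3I:
  assumes "\<And>y z. lin s u (\<lambda>x. \<Psi> [x, y, z])" "\<And>x z. lin s u (\<lambda>y. \<Psi> [x, y, z])"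
    "\<And>x y. lin s u (\<lambda>z. \<Psi> [x, y, z])"
  shows "mlin s u 3 \<Psi>"
  unfolding mlin_def
proof (intro allI impI)
  fix xs ys :: "'a list"
  assume "length xs + length ys + 1 = 3"
  then consider y z where "xs = []" "ys = [y, z]" | x z where "xs = [x]" "ys = [z]"
    | x y where "xs = [x, y]" "ys = []"
    by (cases xs; cases ys; cases "tl xs"; cases "tl ys") auto
  then show "lin s u (\<lambda>x. \<Psi> (xs @ x # ys))"
    using assms by cases auto
qed

section \<open>Powers of the maximal ideal\<close>

interpretation idl: module "(*) :: 'r::comm_ring_1 \<Rightarrow> 'r \<Rightarrow> 'r"
  by unfold_locales (simp_all add: algebra_simps)

declare idl.scale_scale [simp del]

lemma subspace_ideal_pow [simp]: "idl.subspace (ideal_pow I n)"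
  by (cases n) (simp_all add: gen_ideal_def)

lemma ideal_pow_mult:
  "a \<in> ideal_pow I i \<Longrightarrow> b \<in> ideal_pow I j \<Longrightarrow> a * b \<in> ideal_pow I (i + j)"
proof (induction i arbitrary: a)
  case 0
  then show ?case
    using idl.subspace_scale[OF subspace_ideal_pow, of b I j a] by simp
next
  case (Suc i)
  from Suc.prems(1) have "a \<in> idl.span {a * b | a b. a \<in> I \<and> b \<in> ideal_pow I i}"
    by (simp add: gen_ideal_def)
  then show ?case
  proof (induction rule: idl.span_induct_alt)
    case base
    show ?case using idl.subspace_0[OF subspace_ideal_pow] by (simp del: ideal_pow.simps)
  next
    case (step c x y)
    then obtain u v where x: "x = u * v" and "u \<in> I" "v \<in> ideal_pow I i" by auto
    then have "u * (v * b) \<in> {a * b | a b. a \<in> I \<and> b \<in> ideal_pow I (i + j)}"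
      using Suc.IH[OF _ Suc.prems(2)] by blast
    then have "x * b \<in> ideal_pow I (Suc i + j)"
      unfolding x add_Suc ideal_pow.simps gen_ideal_def mult.assoc by (rule idl.span_base)
    then have "c * (x * b) + y * b \<in> ideal_pow I (Suc i + j)"
      using step.IH
      by (intro idl.subspace_add[OF _ idl.subspace_scale] subspace_ideal_pow)
    then show ?case by (simp only: distrib_right mult.assoc)
  qed
qed

lemma ideal_pow_antimono: "m \<le> n \<Longrightarrow> ideal_pow I n \<subseteq> ideal_pow I m"
proof (induction n rule: dec_induct)
  case (step n)
  have "ideal_pow I (Suc n) \<subseteq> ideal_pow I n"
    unfolding ideal_pow.simps gen_ideal_def
    by (rule idl.span_minimal) (auto intro: idl.subspace_scale[OF subspace_ideal_pow])
  then show ?case using step by blast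
qed simp

lemma ideal_pow_1:
  assumes "idl.subspace I"
  shows "ideal_pow I (Suc 0) = I"
proof
  have "a * b \<in> I" if "a \<in> I" for a b
    using idl.subspace_scale[OF assms that, of b] by (simp add: mult.commute)
  then show "ideal_pow I (Suc 0) \<subseteq> I"
    unfolding ideal_pow.simps gen_ideal_def
    by (intro idl.span_minimal assms) auto
  have "a * 1 \<in> ideal_pow I (Suc 0)" if "a \<in> I" for a
    unfolding ideal_pow.simps gen_ideal_def using that by (intro idl.span_base) blast
  then show "I \<subseteq> ideal_pow I (Suc 0)" by (simp add: subset_iff)
qed

locale local_base =
  fixes R :: "('k::field_char_0, 'r::comm_ring_1) coeff"
  assumes complete_local: "complete_local R"
begin

lemma emb_1 [simp]: "emb R 1 = 1"
  and emb_add: "emb R (a + b) = emb R a + emb R b"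
  and emb_mult: "emb R (a * b) = emb R a * emb R b"
  using complete_local by (auto simp: complete_local_def)

lemma emb_0 [simp]: "emb R 0 = 0"
  using emb_add[of 0 0] by simp

lemma subspace_mid: "idl.subspace (mid R)"
  using complete_local by (auto simp: complete_local_def is_maximal_ideal_def is_ideal_def)

lemma complete:
  assumes "\<And>n. x (Suc n) - x n \<in> ideal_pow (mid R) n"
  shows "\<exists>!l. \<forall>n. l - x n \<in> ideal_pow (mid R) n"
proof -
  have "\<forall>x. (\<forall>n. x (Suc n) - x n \<in> ideal_pow (mid R) n) \<longrightarrow>
      (\<exists>!l. \<forall>n. l - x n \<in> ideal_pow (mid R) n)"
    using complete_local unfolding complete_local_def by (elim conjE)
  from this[THEN spec, of x] show ?thesis
    by (rule mp) (use assms in simp)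
qed

lemma ex1_residue: "\<exists>!c. r - emb R c \<in> mid R"
  using complete_local unfolding complete_local_def by (elim conjE) simp

lemma residue: "r - emb R (residue R r) \<in> mid R"
  unfolding residue_def by (rule theI'[OF ex1_residue])

lemma residue_eqI: "r - emb R c \<in> mid R \<Longrightarrow> residue R r = c"
  using ex1_residue[of r] residue[of r] by auto

lemma residue_add: "residue R (r + t) = residue R r + residue R t"
  by (rule residue_eqI)
    (use idl.subspace_add[OF subspace_mid residue[of r] residue[of t]]
      in \<open>simp add: emb_add algebra_simps\<close>)

lemma residue_emb_mult: "residue R (emb R c * r) = c * residue R r"
  by (rule residue_eqI)
    (use idl.subspace_scale[OF subspace_mid residue[of r], of "emb R c"]
      in \<open>simp add: emb_mult algebra_simps\<close>)

lemma residue_mid: "r \<in> mid R \<Longrightarrow> residue R r = 0"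
  by (rule residue_eqI) simp

end

section \<open>The filtration of \<open>V \<otimes> R\<close> by powers of the maximal ideal\<close>

text \<open>The relators that define \<open>V \<otimes> R\<close> itself, without those that divide by a power of the maximal
  ideal.\<close>

definition trel0 :: "('k::field, 'r::comm_ring_1) coeff \<Rightarrow> ('k \<Rightarrow> 'v \<Rightarrow> 'v) \<Rightarrow>
    ('v::ab_group_add \<times> 'r \<Rightarrow>\<^sub>0 'k) set" where
  "trel0 R s =
     {gen (x + y, r) - gen (x, r) - gen (y, r) | x y r. True} \<union>
      {gen (x, r + t) - gen (x, r) - gen (x, t) | x r t. True} \<union>
      {gen (s c x, r) - Poly_Mapping.single (x, r) c | c x r. True} \<union>
      {gen (x, emb R c * r) - Poly_Mapping.single (x, r) c | c x r. True}"

lemma trel_eq: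
  "trel R s n = free.span (trel0 R s \<union> {gen (x, r) | x r. r \<in> ideal_pow (mid R) n})"
  by (simp add: trel_def trel0_def)

lemma subspace_trel [simp]: "free.subspace (trel R s n)"
  unfolding trel_eq by (rule free.subspace_span)

lemma trel0_cases [consumes 1]:
  assumes "a \<in> trel0 R s"
  obtains x y r where "a = gen (x + y, r) - gen (x, r) - gen (y, r)"
    | x r t where "a = gen (x, r + t) - gen (x, r) - gen (x, t)"
    | c x r where "a = gen (s c x, r) - fscale c (gen (x, r))"
    | c x r where "a = gen (x, emb R c * r) - fscale c (gen (x, r))"
  using assms unfolding trel0_def by fastforce

lemma span_trel0_subset: "free.span (trel0 R s) \<subseteq> trel R s n"
  unfolding trel_eq by (rule free.span_mono) blast

lemma trel0_intros:
  "gen (x + y, r) - gen (x, r) - gen (y, r) \<in> free.span (trel0 R s)"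
  "gen (x, r + t) - gen (x, r) - gen (x, t) \<in> free.span (trel0 R s)"
  "gen (s c x, r) - fscale c (gen (x, r)) \<in> free.span (trel0 R s)"
  "gen (x, emb R c * r) - fscale c (gen (x, r)) \<in> free.span (trel0 R s)"
  by (rule free.span_base; simp add: trel0_def; blast)+

lemmas trel_intros = trel0_intros[THEN subsetD[OF span_trel0_subset]]

lemma gen_mem_trel: "r \<in> ideal_pow (mid R) n \<Longrightarrow> gen (x, r) \<in> trel R s n"
  unfolding trel_eq by (rule free.span_base) blast

lemma trel_antimono: "m \<le> n \<Longrightarrow> trel R s n \<subseteq> trel R s m"
  unfolding trel_eq by (rule free.span_mono) (use ideal_pow_antimono in blast)

lemma trel_0: "trel R s 0 = UNIV"
proof -
  have "p \<in> trel R s 0" for p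
  proof (rule lin_all_mem[OF lin_id[OF vs_free] subspace_trel])
    show "gen b \<in> trel R s 0" for b
      by (cases b) (simp add: gen_mem_trel)
  qed
  then show ?thesis by blast
qed

text \<open>The universal property of \<open>V \<otimes> R / V \<otimes> \<mm>\<^sup>n\<close>.\<close>

lemma lin_trel_kill:
  assumes "lin fscale t f" "p \<in> trel R s n"
    and "\<And>x y r. f (gen (x + y, r)) = f (gen (x, r)) + f (gen (y, r))"
    and "\<And>x r u. f (gen (x, r + u)) = f (gen (x, r)) + f (gen (x, u))"
    and "\<And>c x r. f (gen (s c x, r)) = t c (f (gen (x, r)))"
    and "\<And>c x r. f (gen (x, emb R c * r)) = t c (f (gen (x, r)))"
    and "\<And>x r. r \<in> ideal_pow (mid R) n \<Longrightarrow> f (gen (x, r)) = 0"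
  shows "f p = 0"
  using assms(1) assms(2)[unfolded trel_eq]
proof (rule lin_span_kill)
  fix a assume "a \<in> trel0 R s \<union> {gen (x, r) | x r. r \<in> ideal_pow (mid R) n}"
  then consider "a \<in> trel0 R s" | x r where "a = gen (x, r)" "r \<in> ideal_pow (mid R) n"
    by blast
  then show "f a = 0"
  proof cases
    case 1
    then show ?thesis
      by (cases rule: trel0_cases)
        (simp_all only: lin_diff[OF assms(1)] lin_scale[OF assms(1)] assms(3-6) add_diff_cancel_left'
          diff_self diff_add_eq_diff_diff_swap)
  qed (use assms(7) in simp)
qed

lemma lext_trel_kill:
  assumes "vector_space t" "p \<in> trel R s n"
    and "\<And>x y r. \<Phi> (x + y, r) = \<Phi> (x, r) + \<Phi> (y, r)"
    and "\<And>x r u. \<Phi> (x, r + u) = \<Phi> (x, r) + \<Phi> (x, u)"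
    and "\<And>c x r. \<Phi> (s c x, r) = t c (\<Phi> (x, r))"
    and "\<And>c x r. \<Phi> (x, emb R c * r) = t c (\<Phi> (x, r))"
    and "\<And>x r. r \<in> ideal_pow (mid R) n \<Longrightarrow> \<Phi> (x, r) = 0"
  shows "lext t \<Phi> p = 0"
  by (rule lin_trel_kill[OF lin_lext[OF assms(1)] assms(2)]) (simp_all add: assms)

text \<open>The action of \<open>R\<close> and the product of \<open>V \<otimes> R\<close> are lifted to the free vector space, where
  associativity and the unit laws hold on the nose.\<close>

definition rsc :: "'r \<Rightarrow> ('v \<times> 'r::comm_ring_1 \<Rightarrow>\<^sub>0 'k::field) \<Rightarrow> ('v \<times> 'r \<Rightarrow>\<^sub>0 'k)" where
  "rsc r = lext fscale (\<lambda>(v, t). gen (v, r * t))"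

lemma lin_rsc: "lin fscale fscale (rsc r)"
  unfolding rsc_def by (rule lin_lext[OF vs_free])

lemma rsc_gen [simp]: "rsc r (gen (v, t)) = gen (v, r * t)"
  unfolding rsc_def by (simp add: vs_free)

lemma rsc_rsc: "rsc r (rsc t p) = rsc (r * t) p"
proof (rule lin_eqI[of fscale "\<lambda>p. rsc r (rsc t p)" "rsc (r * t)"])
  show "lin fscale fscale (\<lambda>p :: 'a \<times> 'b \<Rightarrow>\<^sub>0 'c. rsc r (rsc t p))"
    by (rule lin_comp[OF lin_rsc lin_rsc])
qed (auto simp: mult.assoc lin_rsc)

lemma rsc_1 [simp]: "rsc 1 p = p"
  by (rule lin_eqI[of fscale "rsc 1" "\<lambda>p. p"]) (auto simp: lin_rsc lin_id vs_free)

lemma rsc_add_mod: "rsc (r + t) p - rsc r p - rsc t p \<in> trel R s n"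
proof (rule lin_all_mem[of fscale "\<lambda>p. rsc (r + t) p - rsc r p - rsc t p"])
  show "rsc (r + t) (gen b) - rsc r (gen b) - rsc t (gen b) \<in> trel R s n" for b
    by (cases b) (simp add: distrib_right trel_intros)
qed (intro lin_diff_fun lin_rsc subspace_trel)+

lemma rsc_emb_mod: "rsc (emb R c) p - fscale c p \<in> trel R s n"
proof (rule lin_all_mem[of fscale "\<lambda>p. rsc (emb R c) p - fscale c p"])
  show "rsc (emb R c) (gen b) - fscale c (gen b) \<in> trel R s n" for b
    by (cases b) (simp add: trel_intros del: fscale_single)
qed (intro lin_diff_fun lin_rsc subspace_trel lin_scaleI lin_id vs_free)+

lemma rsc_ideal_pow:
  assumes "r \<in> ideal_pow (mid R) n"
  shows "rsc r p \<in> trel R s n"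
proof (rule lin_all_mem[OF lin_rsc subspace_trel])
  show "rsc r (gen b) \<in> trel R s n" for b
    using idl.subspace_scale[OF subspace_ideal_pow assms]
    by (cases b) (auto intro!: gen_mem_trel simp: mult.commute)
qed

lemma rsc_trel:
  assumes "p \<in> trel R s n"
  shows "rsc r p \<in> trel R s n"
proof (rule lin_span[OF lin_rsc assms[unfolded trel_eq] _ subspace_trel])
  fix a assume "a \<in> trel0 R s \<union> {gen (x, r) | x r. r \<in> ideal_pow (mid R) n}"
  then consider "a \<in> trel0 R s" | x r where "a = gen (x, r)" "r \<in> ideal_pow (mid R) n"
    by blast
  then show "rsc r a \<in> trel R s n"
  proof cases
    case 1
    then have "rsc r a \<in> free.span (trel0 R s)"
      using trel0_intros
      by (cases rule: trel0_cases)
        (simp_all only: lin_diff[OF lin_rsc] lin_scale[OF lin_rsc] rsc_gen distrib_left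
          mult.left_commute[of r "emb R _"])
    then show ?thesis using span_trel0_subset by blast
  next
    case 2
    then show ?thesis
      using idl.subspace_scale[OF subspace_ideal_pow] by (auto intro!: gen_mem_trel)
  qed
qed

definition fmul :: "('v \<Rightarrow> 'v \<Rightarrow> 'v) \<Rightarrow> ('v \<times> 'r::comm_ring_1 \<Rightarrow>\<^sub>0 'k::field) \<Rightarrow>
    ('v \<times> 'r \<Rightarrow>\<^sub>0 'k) \<Rightarrow> ('v \<times> 'r \<Rightarrow>\<^sub>0 'k)" where
  "fmul m p q = lext fscale (\<lambda>(v, r). lext fscale (\<lambda>(w, t). gen (m v w, r * t)) q) p"

lemma lin_fmul_left: "lin fscale fscale (\<lambda>p. fmul m p q)"
  unfolding fmul_def by (rule lin_lext[OF vs_free])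

lemma lin_fmul_right: "lin fscale fscale (\<lambda>q. fmul m p q)"
  unfolding fmul_def
  by (intro lin_lext_param vs_free) (auto simp: case_prod_unfold vs_free)

lemma fmul_gen [simp]: "fmul m (gen (v, r)) (gen (w, t)) = gen (m v w, r * t)"
  by (simp add: fmul_def vs_free)

lemma fmul_assoc:
  assumes "\<And>x y z. m (m x y) z = m x (m y z)"
  shows "fmul m (fmul m p q) u = fmul m p (fmul m q u)"
proof (rule lin_eqI[of fscale "\<lambda>p. fmul m (fmul m p q) u" "\<lambda>p. fmul m p (fmul m q u)"])
  fix a
  show "fmul m (fmul m (gen a) q) u = fmul m (gen a) (fmul m q u)"
  proof (rule lin_eqI[of fscale "\<lambda>q. fmul m (fmul m (gen a) q) u" "\<lambda>q. fmul m (gen a) (fmul m q u)"])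
    fix b
    show "fmul m (fmul m (gen a) (gen b)) u = fmul m (gen a) (fmul m (gen b) u)"
    proof (rule lin_eqI[of fscale "fmul m (fmul m (gen a) (gen b))" "\<lambda>u. fmul m (gen a) (fmul m (gen b) u)"])
      fix c
      show "fmul m (fmul m (gen a) (gen b)) (gen c) = fmul m (gen a) (fmul m (gen b) (gen c))"
        by (cases a; cases b; cases c) (simp add: assms mult.assoc)
    qed (rule lin_fmul_right lin_comp[OF lin_fmul_right lin_fmul_right])+
  qed (rule lin_comp[OF lin_fmul_right lin_fmul_left] lin_comp[OF lin_fmul_left lin_fmul_right])+
qed (rule lin_comp[OF lin_fmul_left lin_fmul_left] lin_fmul_left)+

lemma fmul_unit_left:
  assumes "\<And>x. m e x = x"
  shows "fmul m (gen (e, 1)) p = p"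
  by (rule lin_eqI[of fscale "fmul m (gen (e, 1))" "\<lambda>p. p"])
    (auto simp: assms lin_fmul_right lin_id vs_free)

lemma fmul_unit_right:
  assumes "\<And>x. m x e = x"
  shows "fmul m p (gen (e, 1)) = p"
  by (rule lin_eqI[of fscale "\<lambda>p. fmul m p (gen (e, 1))" "\<lambda>p. p"])
    (auto simp: assms lin_fmul_left lin_id vs_free)

text \<open>The relators of \<open>V \<otimes> R\<close> span a two-sided ideal of the free algebra, and \<open>\<mm>\<^sup>i \<mm>\<^sup>j \<subseteq> \<mm>\<^bsup>i+j\<^esup>\<close>; so
  the filtration is multiplicative. Since \<open>trel R s 0\<close> is everything, each of its steps is in
  particular a two-sided ideal. All convergence below rests on this.\<close>

lemma fmul_trel:
  assumes m: "\<And>y. lin s s (\<lambda>x. m x y)" "\<And>x. lin s s (m x)"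
    and p: "p \<in> trel R s i" and q: "q \<in> trel R s j"
  shows "fmul m p q \<in> trel R s (i + j)"
proof -
  have left: "fmul m a q \<in> trel R s (i + j)" if a: "a \<in> trel0 R s" for a q
  proof (rule lin_all_mem[OF lin_fmul_right subspace_trel])
    fix b :: "'a \<times> 'c"
    obtain w u where b: "b = (w, u)" by force
    have "fmul m a (gen b) \<in> free.span (trel0 R s)"
      using a trel0_intros unfolding b
      by (cases rule: trel0_cases)
        (simp_all only: lin_diff[OF lin_fmul_left] lin_scale[OF lin_fmul_left] fmul_gen
          lin_add[OF m(1)] lin_scale[OF m(1)] distrib_right mult.assoc)
    then show "fmul m a (gen b) \<in> trel R s (i + j)" using span_trel0_subset by blast
  qed
  have right: "fmul m p a \<in> trel R s (i + j)" if a: "a \<in> trel0 R s" for a p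
  proof (rule lin_all_mem[OF lin_fmul_left subspace_trel])
    fix b :: "'a \<times> 'c"
    obtain w u where b: "b = (w, u)" by force
    have "fmul m (gen b) a \<in> free.span (trel0 R s)"
      using a trel0_intros unfolding b
      by (cases rule: trel0_cases)
        (simp_all only: lin_diff[OF lin_fmul_right] lin_scale[OF lin_fmul_right] fmul_gen
          lin_add[OF m(2)] lin_scale[OF m(2)] distrib_left mult.left_commute[of u "emb R _"])
    then show "fmul m (gen b) a \<in> trel R s (i + j)" using span_trel0_subset by blast
  qed
  show ?thesis
  proof (rule lin_span[OF lin_fmul_left p[unfolded trel_eq] _ subspace_trel])
    fix a assume a: "a \<in> trel0 R s \<union> {gen (x, r) | x r. r \<in> ideal_pow (mid R) i}"
    show "fmul m a q \<in> trel R s (i + j)"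
    proof (rule lin_span[OF lin_fmul_right q[unfolded trel_eq] _ subspace_trel])
      fix b assume "b \<in> trel0 R s \<union> {gen (x, r) | x r. r \<in> ideal_pow (mid R) j}"
      with a show "fmul m a b \<in> trel R s (i + j)"
        using left right by (auto intro!: gen_mem_trel ideal_pow_mult)
    qed
  qed
qed

section \<open>Normal forms of elements of the completed tensor product\<close>

text \<open>The normal form of the component of \<open>x\<close> in \<open>V \<otimes> R / V \<otimes> \<mm>\<^sup>n\<close>. An element of the completed
  tensor product is determined by these normal forms (\<open>ctens_eqI\<close>), and the lemmas \<open>lv_cadd\<close>,
  \<open>lv_cscale\<close>, \<open>lv_clin\<close>, \<open>lv_cext\<close> compute them for all operations.\<close>

definition lv :: "('k::field, 'r::comm_ring_1) coeff \<Rightarrow> ('k \<Rightarrow> 'v \<Rightarrow> 'v) \<Rightarrow> nat \<Rightarrow>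
    ('k, 'r, 'v::ab_group_add) ct \<Rightarrow> ('v \<times> 'r \<Rightarrow>\<^sub>0 'k)" where
  "lv R s n x = nf (trel R s n) (rep (x n))"

abbreviation nft :: "('k::field, 'r::comm_ring_1) coeff \<Rightarrow> ('k \<Rightarrow> 'v \<Rightarrow> 'v) \<Rightarrow> nat \<Rightarrow>
    ('v::ab_group_add \<times> 'r \<Rightarrow>\<^sub>0 'k) \<Rightarrow> ('v \<times> 'r \<Rightarrow>\<^sub>0 'k)" where
  "nft R s n \<equiv> nf (trel R s n)"

lemma lin_nft: "lin fscale fscale (nft R s n)"
  by (rule lin_nf) simp

lemmas nft_add = lin_add[OF lin_nft]
  and nft_diff = lin_diff[OF lin_nft]
  and nft_scale = lin_scale[OF lin_nft]
  and nft_zero [simp] = lin_zero[OF lin_nft]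

lemma nft_lv [simp]: "nft R s n (lv R s n x) = lv R s n x"
  by (simp add: lv_def)

lemma nft_nft_le: "m \<le> n \<Longrightarrow> nft R s m (nft R s n p) = nft R s m p"
  using diff_nf[of "trel R s n" p] trel_antimono[of m n R s]
  by (subst eq_commute) (auto simp: nf_eq_iff)

lemma lv_quo [simp]: "lv R s n (\<lambda>n. quo (trel R s n) (p n)) = nft R s n (p n)"
  by (simp add: lv_def)

lemma ctens_quo:
  assumes "x \<in> ctens R s"
  shows "x n = quo (trel R s n) (lv R s n x)"
proof -
  have "x n \<in> range (quo (trel R s n))"
    using assms by (simp add: ctens_def)
  then obtain p where p: "x n = quo (trel R s n) p"
    by blast
  show ?thesis
    unfolding lv_def p by (simp add: quo_eq_nf_iff)
qed

lemma ctens_eqI: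
  "x \<in> ctens R s \<Longrightarrow> y \<in> ctens R s \<Longrightarrow> (\<And>n. lv R s n x = lv R s n y) \<Longrightarrow> x = y"
  by (rule ext) (simp add: ctens_quo)

lemma quo_mono:
  assumes "free.subspace N" "M \<subseteq> N" "p - q \<in> N"
  shows "quo M p \<subseteq> quo N q"
proof
  fix r assume "r \<in> quo M p"
  then have "(r - p) + (p - q) \<in> N"
    using assms by (intro free.subspace_add) (auto simp: mem_quo)
  then show "r \<in> quo N q" by (simp add: mem_quo)
qed

text \<open>Compatible representatives define an element of the inverse limit because the filtration is
  descending.\<close>

lemma ctensI:
  assumes "\<And>n. nft R s n (p (Suc n)) = nft R s n (p n)"
  shows "(\<lambda>n. quo (trel R s n) (p n)) \<in> ctens R s"
proof -
  have "quo (trel R s (Suc n)) (p (Suc n)) \<subseteq> quo (trel R s n) (p n)" for n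
    using assms[of n] by (intro quo_mono subspace_trel trel_antimono) (simp_all add: nf_eq_iff)
  then show ?thesis
    unfolding ctens_def by blast
qed

lemma nft_rep_Suc:
  assumes "x \<in> ctens R s"
  shows "nft R s n (rep (x (Suc n))) = lv R s n x"
proof -
  have "rep (x (Suc n)) \<in> x (Suc n)"
    unfolding ctens_quo[OF assms, of "Suc n"] by (rule rep_mem[OF quo_refl]) simp
  then have "rep (x (Suc n)) \<in> quo (trel R s n) (lv R s n x)"
    using assms ctens_quo[OF assms, of n] unfolding ctens_def by blast
  then show ?thesis
    using nf_eq_iff[OF subspace_trel, of R s n "rep (x (Suc n))" "lv R s n x"]
    by (simp add: mem_quo)
qed

lemma nft_lv_le:
  assumes "x \<in> ctens R s" "m \<le> n"
  shows "nft R s m (lv R s n x) = lv R s m x"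
  using assms(2)
proof (induction n rule: dec_induct)
  case (step n)
  have "nft R s m (lv R s (Suc n) x) = nft R s m (nft R s n (lv R s (Suc n) x))"
    using step by (simp add: nft_nft_le)
  also have "nft R s n (lv R s (Suc n) x) = lv R s n x"
    using nft_rep_Suc[OF assms(1), of n] by (simp add: lv_def nft_nft_le)
  finally show ?case using step by simp
qed simp

text \<open>An element that vanishes at level \<open>m\<close> lies in \<open>V \<otimes> \<mm>\<^sup>m\<close> at every level.\<close>

lemma lv_trel:
  assumes "x \<in> ctens R s" "lv R s m x = 0"
  shows "lv R s n x \<in> trel R s m"
proof (cases "m \<le> n")
  case True
  then show ?thesis using nft_lv_le[OF assms(1) True] assms(2) by (simp add: nf_eq_0)
next
  case False
  then have "lv R s n x = 0" using nft_lv_le[OF assms(1), of n m] assms(2) by simp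
  then show ?thesis using free.subspace_0[OF subspace_trel] by simp
qed

lemma lv_czero [simp]: "lv R s n (czero R s) = 0"
  by (simp add: czero_def)

lemma czero_ctens [simp]: "czero R s \<in> ctens R s"
  unfolding czero_def by (rule ctensI) simp

lemma lv_cadd [simp]: "lv R s n (cadd R s x y) = lv R s n x + lv R s n y"
  by (simp add: cadd_def nft_add) (simp add: lv_def)

lemma cadd_ctens [simp]: "x \<in> ctens R s \<Longrightarrow> y \<in> ctens R s \<Longrightarrow> cadd R s x y \<in> ctens R s"
  unfolding cadd_def by (rule ctensI) (simp add: nft_add nft_rep_Suc, simp add: lv_def)

lemma lv_csub [simp]: "lv R s n (csub R s x y) = lv R s n x - lv R s n y"
  by (simp add: csub_def nft_diff) (simp add: lv_def)

lemma csub_ctens [simp]: "x \<in> ctens R s \<Longrightarrow> y \<in> ctens R s \<Longrightarrow> csub R s x y \<in> ctens R s"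
  unfolding csub_def by (rule ctensI) (simp add: nft_diff nft_rep_Suc, simp add: lv_def)

lemma nft_rsc: "nft R s n (rsc r (nft R s n p)) = nft R s n (rsc r p)"
proof -
  have "nft R s n p - p \<in> trel R s n"
    using nf_eq_iff[OF subspace_trel, of R s n "nft R s n p" p] by simp
  from rsc_trel[OF this, of r] show ?thesis
    by (simp add: nf_eq_iff lin_diff[OF lin_rsc])
qed

lemma lv_cscale: "lv R s n (cscale R s r x) = nft R s n (rsc r (lv R s n x))"
  unfolding cscale_def lv_quo rsc_def[symmetric] by (simp add: lv_def nft_rsc)

lemma cscale_ctens [simp]: "x \<in> ctens R s \<Longrightarrow> cscale R s r x \<in> ctens R s"
  unfolding cscale_def rsc_def[symmetric]
proof (rule ctensI)
  fix n assume x: "x \<in> ctens R s"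
  show "nft R s n (rsc r (rep (x (Suc n)))) = nft R s n (rsc r (rep (x n)))"
    using nft_rsc[of R s n r "rep (x (Suc n))"] nft_rsc[of R s n r "rep (x n)"] nft_rep_Suc[OF x, of n]
    by (simp add: lv_def)
qed

lemma lv_incl: "lv R s n (incl R s v) = nft R s n (gen (v, 1))"
  by (simp add: incl_def)

lemma incl_ctens [simp]: "incl R s v \<in> ctens R s"
  unfolding incl_def by (rule ctensI) simp

lemma lin_lv_incl:
  assumes "vector_space s"
  shows "lin s fscale (\<lambda>v. lv R s n (incl R s v))"
proof (rule linI[OF assms vs_free])
  show "lv R s n (incl R s (x + y)) = lv R s n (incl R s x) + lv R s n (incl R s y)" for x y
    using trel_intros(1)[of x y 1 R s n]
    by (simp add: lv_incl nft_add[symmetric] nf_eq_iff diff_diff_eq)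
  show "lv R s n (incl R s (s c x)) = fscale c (lv R s n (incl R s x))" for c x
    using trel_intros(3)[of s c x 1 R n]
    by (simp add: lv_incl nft_scale[symmetric] nf_eq_iff del: fscale_single)
qed

lemma lv_clin: "lv R s n (clin R s X p) = lext fscale (\<lambda>b. lv R s n (X b)) p"
  unfolding clin_def lv_quo lv_def by (rule lin_lext_comp[OF lin_nft])

lemma clin_ctens:
  assumes "\<And>b. b \<in> Poly_Mapping.keys p \<Longrightarrow> X b \<in> ctens R s"
  shows "clin R s X p \<in> ctens R s"
  unfolding clin_def
proof (rule ctensI)
  fix n
  show "nft R s n (lext fscale (\<lambda>b. rep (X b (Suc n))) p) = nft R s n (lext fscale (\<lambda>b. rep (X b n)) p)"
    unfolding lin_lext_comp[OF lin_nft]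
    by (rule lext_cong) (simp add: nft_rep_Suc assms, simp add: lv_def)
qed

text \<open>\<open>\<phi>\<close> is a \<open>\<Bbbk>\<close>-linear map from \<open>V\<close> to the completion of \<open>W \<otimes> R\<close>. Such a map extends uniquely to a
  continuous \<open>R\<close>-linear map on the completion of \<open>V \<otimes> R\<close>, namely \<open>cext R s' \<phi>\<close>.\<close>

definition klin :: "('k::field, 'r::comm_ring_1) coeff \<Rightarrow> ('k \<Rightarrow> 'v \<Rightarrow> 'v) \<Rightarrow> ('k \<Rightarrow> 'w \<Rightarrow> 'w) \<Rightarrow>
    ('v::ab_group_add \<Rightarrow> ('k, 'r, 'w::ab_group_add) ct) \<Rightarrow> bool" where
  "klin R s s' \<phi> \<longleftrightarrow>
     (\<forall>v. \<phi> v \<in> ctens R s') \<and> (\<forall>n. lin s fscale (\<lambda>v. lv R s' n (\<phi> v)))"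

lemma klinD:
  assumes "klin R s s' \<phi>"
  shows "\<phi> v \<in> ctens R s'" "lin s fscale (\<lambda>v. lv R s' n (\<phi> v))"
  using assms by (simp_all add: klin_def)

lemma nft_rsc_add: "nft R s n (rsc (r + t) p) = nft R s n (rsc r p) + nft R s n (rsc t p)"
  using rsc_add_mod[of r t p R s n]
  by (simp add: nft_add[symmetric] nf_eq_iff diff_diff_eq)

lemma nft_rsc_emb: "nft R s n (rsc (emb R c * r) p) = fscale c (nft R s n (rsc r p))"
  using rsc_emb_mod[of R c "rsc r p" s n]
  by (simp add: nft_scale[symmetric] nf_eq_iff rsc_rsc)

text \<open>The extension is well defined: \<open>v \<otimes> r \<mapsto> r \<cdot> \<phi> v\<close> respects the relators at each level.\<close>

lemma cext_kill:
  assumes "klin R s s' \<phi>" "p \<in> trel R s n"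
  shows "lext fscale (\<lambda>(v, r). nft R s' n (rsc r (lv R s' n (\<phi> v)))) p = 0"
proof (rule lext_trel_kill[OF vs_free assms(2)])
  have L: "lin s fscale (\<lambda>v. nft R s' n (rsc r (lv R s' n (\<phi> v))))" for r
    by (intro lin_comp[OF klinD(2)[OF assms(1)]] lin_comp[OF lin_rsc lin_nft])
  show "(case (x + y, r) of (v, r) \<Rightarrow> nft R s' n (rsc r (lv R s' n (\<phi> v)))) =
     (case (x, r) of (v, r) \<Rightarrow> nft R s' n (rsc r (lv R s' n (\<phi> v)))) +
     (case (y, r) of (v, r) \<Rightarrow> nft R s' n (rsc r (lv R s' n (\<phi> v))))" for x y r
    using lin_add[OF L] by simp
  show "(case (s c x, r) of (v, r) \<Rightarrow> nft R s' n (rsc r (lv R s' n (\<phi> v)))) =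
     fscale c (case (x, r) of (v, r) \<Rightarrow> nft R s' n (rsc r (lv R s' n (\<phi> v))))" for c x r
    using lin_scale[OF L] by simp
qed (simp_all add: nft_rsc_add nft_rsc_emb nf_eq_0 rsc_ideal_pow)

lemma lext_nft:
  assumes "\<And>p. p \<in> trel R s n \<Longrightarrow> lext t F p = 0" "vector_space t"
  shows "lext t F (nft R s n p) = lext t F p"
  using assms(1)[OF diff_nf[OF subspace_trel], of p] lin_diff[OF lin_lext[OF assms(2)], of F p]
  by simp

lemma lext_cext_nft:
  assumes "klin R s s' \<phi>"
  shows "lext fscale (\<lambda>(v, r). nft R s' n (rsc r (lv R s' n (\<phi> v)))) (nft R s n p) =
    lext fscale (\<lambda>(v, r). nft R s' n (rsc r (lv R s' n (\<phi> v)))) p"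
  by (rule lext_nft[OF _ vs_free]) (rule cext_kill[OF assms])

lemma lv_cext:
  assumes "klin R s s' \<phi>"
  shows "lv R s' n (cext R s' \<phi> z) = lext fscale (\<lambda>(v, r). nft R s' n (rsc r (lv R s' n (\<phi> v)))) (lv R s n z)"
proof -
  have "lv R s' n (cext R s' \<phi> z) = lv R s' n (clin R s' (\<lambda>(v, r). cscale R s' r (\<phi> v)) (rep (z n)))"
    by (simp add: cext_def lv_def)
  also have "\<dots> = lext fscale (\<lambda>(v, r). nft R s' n (rsc r (lv R s' n (\<phi> v)))) (rep (z n))"
    by (simp add: lv_clin case_prod_unfold lv_cscale)
  finally show ?thesis
    by (simp add: lv_def[of R s n] lext_cext_nft[OF assms])
qed

lemma cext_ctens:
  assumes "klin R s s' \<phi>" "z \<in> ctens R s"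
  shows "cext R s' \<phi> z \<in> ctens R s'"
proof -
  let ?X = "\<lambda>(v, r). cscale R s' r (\<phi> v)"
  let ?F = "\<lambda>n. (\<lambda>(v, r). nft R s' n (rsc r (lv R s' n (\<phi> v))))"
  have X: "?X b \<in> ctens R s'" for b
    using klinD(1)[OF assms(1)] by (auto split: prod.split)
  have "cext R s' \<phi> z = (\<lambda>n. quo (trel R s' n) (lext fscale (\<lambda>b. rep (?X b n)) (rep (z n))))"
    by (simp add: cext_def clin_def)
  also have "\<dots> \<in> ctens R s'"
  proof (rule ctensI)
    fix n
    have *: "nft R s' n (rep (?X b n)) = ?F n b" for b
      by (simp add: lv_def[symmetric] lv_cscale split: prod.split)
    have "nft R s' n (lext fscale (\<lambda>b. rep (?X b (Suc n))) (rep (z (Suc n)))) =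
        lext fscale (?F n) (rep (z (Suc n)))"
      unfolding lin_lext_comp[OF lin_nft] nft_rep_Suc[OF X] by (simp add: lv_def *)
    also have "\<dots> = lext fscale (?F n) (lv R s n z)"
      unfolding nft_rep_Suc[OF assms(2), of n, symmetric]
      by (rule lext_cext_nft[OF assms(1), symmetric])
    also have "\<dots> = lext fscale (?F n) (rep (z n))"
      by (simp add: lv_def[of R s n] lext_cext_nft[OF assms(1)])
    also have "\<dots> = nft R s' n (lext fscale (\<lambda>b. rep (?X b n)) (rep (z n)))"
      unfolding lin_lext_comp[OF lin_nft] * ..
    finally show "nft R s' n (lext fscale (\<lambda>b. rep (?X b (Suc n))) (rep (z (Suc n)))) =
        nft R s' n (lext fscale (\<lambda>b. rep (?X b n)) (rep (z n)))" .
  qed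
  finally show ?thesis .
qed

lemma cext_incl:
  assumes "klin R s s' \<phi>"
  shows "cext R s' \<phi> (incl R s v) = \<phi> v"
proof (rule ctens_eqI)
  show "cext R s' \<phi> (incl R s v) \<in> ctens R s'" by (rule cext_ctens[OF assms incl_ctens])
  show "\<phi> v \<in> ctens R s'" by (rule klinD(1)[OF assms])
  fix n
  show "lv R s' n (cext R s' \<phi> (incl R s v)) = lv R s' n (\<phi> v)"
    unfolding lv_cext[OF assms] lv_incl lext_cext_nft[OF assms]
    by (simp add: vs_free)
qed

lemma cext_cscale:
  assumes "klin R s s' \<phi>" "z \<in> ctens R s"
  shows "cext R s' \<phi> (cscale R s r z) = cscale R s' r (cext R s' \<phi> z)"
proof (rule ctens_eqI)
  show "cext R s' \<phi> (cscale R s r z) \<in> ctens R s'" "cscale R s' r (cext R s' \<phi> z) \<in> ctens R s'"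
    by (intro cext_ctens[OF assms(1)] assms(2) cscale_ctens)+
  fix n
  let ?F = "\<lambda>(v, r). nft R s' n (rsc r (lv R s' n (\<phi> v)))"
  have "lext fscale ?F (rsc r p) = nft R s' n (rsc r (lext fscale ?F p))" for p
  proof (rule lin_eqI[of fscale "\<lambda>p. lext fscale ?F (rsc r p)"
        "\<lambda>p. nft R s' n (rsc r (lext fscale ?F p))"])
    show "lin fscale fscale (\<lambda>p. lext fscale ?F (rsc r p))"
      by (rule lin_comp[OF lin_rsc lin_lext[OF vs_free]])
    show "lin fscale fscale (\<lambda>p. nft R s' n (rsc r (lext fscale ?F p)))"
      by (intro lin_comp[OF lin_lext[OF vs_free]] lin_comp[OF lin_rsc lin_nft])
  qed (auto simp: vs_free nft_rsc rsc_rsc)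
  then show "lv R s' n (cext R s' \<phi> (cscale R s r z)) = lv R s' n (cscale R s' r (cext R s' \<phi> z))"
    unfolding lv_cext[OF assms(1)] lv_cscale lext_cext_nft[OF assms(1)] by simp
qed

lemma clinear_cext:
  assumes "klin R s s' \<phi>"
  shows "clinear R s s' (restrict (cext R s' \<phi>) (ctens R s))"
  unfolding clinear_def
proof (intro conjI ballI allI)
  fix x y assume xy: "x \<in> ctens R s" "y \<in> ctens R s"
  then have "cext R s' \<phi> (cadd R s x y) = cadd R s' (cext R s' \<phi> x) (cext R s' \<phi> y)"
    by (intro ctens_eqI[of _ R s'])
      (simp_all add: cext_ctens[OF assms] lv_cext[OF assms] lin_add[OF lin_lext[OF vs_free]])
  then show "restrict (cext R s' \<phi>) (ctens R s) (cadd R s x y) =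
      cadd R s' (restrict (cext R s' \<phi>) (ctens R s) x) (restrict (cext R s' \<phi>) (ctens R s) y)"
    using xy by simp
qed (simp_all add: cext_ctens[OF assms] cext_cscale[OF assms])

lemma ccontinuous_cext:
  assumes "klin R s s' \<phi>"
  shows "ccontinuous R s (restrict (cext R s' \<phi>) (ctens R s))"
  unfolding ccontinuous_def
proof (intro ballI allI exI impI)
  fix x y n assume "x \<in> ctens R s" "y \<in> ctens R s" "y n = x n"
  then show "restrict (cext R s' \<phi>) (ctens R s) y n = restrict (cext R s' \<phi>) (ctens R s) x n"
    by (simp add: ctens_quo[OF cext_ctens[OF assms]] lv_cext[OF assms] lv_def[of R s])
qed

section \<open>The maximal part, homogeneous parts and convergent series\<close>

lemma nft_gen_add_left: "nft R s n (gen (x + y, r)) = nft R s n (gen (x, r)) + nft R s n (gen (y, r))"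
  using trel_intros(1)[of x y r R s n]
  by (simp add: nft_add[symmetric] nf_eq_iff diff_diff_eq)

lemma nft_gen_add_right: "nft R s n (gen (x, r + t)) = nft R s n (gen (x, r)) + nft R s n (gen (x, t))"
  using trel_intros(2)[of x r t R s n]
  by (simp add: nft_add[symmetric] nf_eq_iff diff_diff_eq)

lemma nft_gen_scale: "nft R s n (gen (s c x, r)) = fscale c (nft R s n (gen (x, r)))"
  using trel_intros(3)[of s c x r R n]
  by (simp add: nft_scale[symmetric] nf_eq_iff del: fscale_single)

lemma nft_gen_emb: "nft R s n (gen (x, emb R c * r)) = fscale c (nft R s n (gen (x, r)))"
  using trel_intros(4)[of x R c r s n]
  by (simp add: nft_scale[symmetric] nf_eq_iff del: fscale_single)

lemma nft_gen_ideal: "r \<in> ideal_pow (mid R) n \<Longrightarrow> nft R s n (gen (x, r)) = 0"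
  by (simp add: nf_eq_0 gen_mem_trel)

context local_base begin

text \<open>At level 1 every \<open>v \<otimes> r\<close> equals \<open>c v \<otimes> 1\<close>, where \<open>c\<close> is the residue of \<open>r\<close>: write \<open>r\<close> as \<open>c\<close> plus
  an element of the maximal ideal.\<close>

lemma nft_1_gen:
  assumes "vector_space s"
  shows "nft R s (Suc 0) (gen (v, r)) = nft R s (Suc 0) (gen (s (residue R r) v, 1))"
proof -
  let ?c = "residue R r"
  have "r - emb R ?c \<in> ideal_pow (mid R) (Suc 0)"
    unfolding ideal_pow_1[OF subspace_mid] by (rule residue)
  then have "nft R s (Suc 0) (gen (v, emb R ?c * 1 + (r - emb R ?c))) =
      nft R s (Suc 0) (gen (v, emb R ?c * 1))"
    unfolding nft_gen_add_right by (simp add: nft_gen_ideal del: ideal_pow.simps)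
  then show ?thesis
    unfolding nft_gen_emb nft_gen_scale by simp
qed

text \<open>The reduction to \<open>V\<close> is an isomorphism on level 1, hence its kernel consists of the elements that
  vanish there.\<close>

lemma cmax_iff:
  assumes s: "vector_space s"
  shows "x \<in> cmax R s \<longleftrightarrow> x \<in> ctens R s \<and> lv R s (Suc 0) x = 0"
proof -
  interpret s: vector_space s by (fact s)
  let ?red = "lext s (\<lambda>(v, r). s (residue R r) v)"
  have kill: "?red p = 0" if "p \<in> trel R s (Suc 0)" for p
    by (rule lext_trel_kill[OF s that])
      (simp_all add: residue_add residue_emb_mult residue_mid ideal_pow_1[OF subspace_mid]
        s.scale_right_distrib s.scale_left_distrib mult.commute[of "residue R _"] del: ideal_pow.simps)
  have lin1: "lin s fscale (\<lambda>v. nft R s (Suc 0) (gen (v, 1)))"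
    by (rule linI[OF s vs_free]) (simp_all add: nft_gen_add_left nft_gen_scale)
  have nft_red: "nft R s (Suc 0) p = nft R s (Suc 0) (gen (?red p, 1))" for p
  proof (rule lin_eqI[of fscale "nft R s (Suc 0)" "\<lambda>p. nft R s (Suc 0) (gen (?red p, 1))"])
    show "lin fscale fscale (\<lambda>p. nft R s (Suc 0) (gen (?red p, 1)))"
      by (rule lin_comp[OF lin_lext[OF s] lin1])
    show "nft R s (Suc 0) (gen b) = nft R s (Suc 0) (gen (?red (gen b), 1))" for b
      using nft_1_gen[OF s, of "fst b" "snd b"] by (simp add: s case_prod_unfold)
  qed (rule lin_nft)
  have "creduce R s x = ?red (lv R s (Suc 0) x)"
    unfolding creduce_def lv_def by (simp add: lext_nft[OF kill s])
  moreover have "lv R s (Suc 0) x = nft R s (Suc 0) (gen (?red (lv R s (Suc 0) x), 1))"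
    using nft_red[of "lv R s (Suc 0) x"] by simp
  moreover have "nft R s (Suc 0) (gen (0, 1)) = 0"
    using lin_zero[OF lin1] .
  ultimately have "creduce R s x = 0 \<longleftrightarrow> lv R s (Suc 0) x = 0"
    by (metis lext_zero)
  then show ?thesis by (simp add: cmax_def)
qed

end

lemma sum_eventually_zero:
  fixes f :: "nat \<Rightarrow> 'a::comm_monoid_add"
  assumes "\<And>j. j \<ge> J \<Longrightarrow> f j = 0" "\<And>j. j \<ge> K \<Longrightarrow> f j = 0"
  shows "(\<Sum>j<J. f j) = (\<Sum>j<K. f j)"
proof -
  have "(\<Sum>j<J. f j) = (\<Sum>j<max J K. f j)" "(\<Sum>j<K. f j) = (\<Sum>j<max J K. f j)"
    by (rule sum.mono_neutral_left; use assms in auto)+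
  then show ?thesis by simp
qed

text \<open>If almost all terms vanish at each level, then each component of the sequence of partial sums
  is eventually constant, and the sum can be computed with any number of terms that is large
  enough.\<close>

lemma cseries:
  assumes X: "\<And>j. X j \<in> ctens R s" and conv: "\<And>n. \<exists>J. \<forall>j\<ge>J. lv R s n (X j) = 0"
  shows cseries_ctens: "cseries R s a X \<in> ctens R s"
    and lv_cseries: "\<forall>j\<ge>J. lv R s n (X j) = 0 \<Longrightarrow>
      lv R s n (cseries R s a X) = (\<Sum>j<J. fscale (a j) (lv R s n (X j)))"
proof -
  define S where "S n J = (\<Sum>j<J. fscale (a j) (lv R s n (X j)))" for n J
  have S: "S n J = S n K"
    if "\<And>j. j \<ge> J \<Longrightarrow> lv R s n (X j) = 0" "\<And>j. j \<ge> K \<Longrightarrow> lv R s n (X j) = 0" for n J K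
    unfolding S_def by (rule sum_eventually_zero) (simp_all add: that)
  have lvS: "lv R s n (clin R s X (\<Sum>j<N. Poly_Mapping.single j (a j))) = S n N" for n N
    by (simp add: lv_clin lin_sum[OF lin_lext[OF vs_free]] lext_single[OF vs_free] S_def)
  have val: "cseries R s a X n = quo (trel R s n) (S n J)"
    if J: "\<And>j. j \<ge> J \<Longrightarrow> lv R s n (X j) = 0" for n J
  proof -
    have *: "clin R s X (\<Sum>j<N. Poly_Mapping.single j (a j)) n = quo (trel R s n) (S n J)"
      if "N \<ge> J" for N
    proof -
      have "S n N = S n J" by (rule S) (use J that in auto)
      then show ?thesis
        using lvS[of n N] by (simp add: ctens_quo[OF clin_ctens[OF X]])
    qed
    show ?thesis
      unfolding cseries_def
    proof (rule the_equality)
      show "\<forall>\<^sub>F N in sequentially.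
          clin R s X (\<Sum>j<N. Poly_Mapping.single j (a j)) n = quo (trel R s n) (S n J)"
        unfolding eventually_sequentially using * by blast
      fix c assume "\<forall>\<^sub>F N in sequentially. clin R s X (\<Sum>j<N. Poly_Mapping.single j (a j)) n = c"
      then obtain N0 where "\<And>N. N \<ge> N0 \<Longrightarrow> clin R s X (\<Sum>j<N. Poly_Mapping.single j (a j)) n = c"
        by (auto simp: eventually_sequentially)
      from this[of "max N0 J"] *[of "max N0 J"] show "c = quo (trel R s n) (S n J)" by simp
    qed
  qed
  from conv obtain K where K: "\<And>n j. j \<ge> K n \<Longrightarrow> lv R s n (X j) = 0"
    by metis
  have eq: "cseries R s a X = (\<lambda>n. quo (trel R s n) (S n (K n)))"
    by (rule ext, rule val, rule K)
  have nftS: "nft R s m (S n J) = S m J" if "m \<le> n" for m n J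
    unfolding S_def lin_sum[OF lin_nft] nft_scale using nft_lv_le[OF X that] by simp
  have K': "lv R s n (X j) = 0" if "j \<ge> K (Suc n)" for n j
    using nft_lv_le[OF X, of n "Suc n" j] K[OF that] by simp
  show "cseries R s a X \<in> ctens R s"
    unfolding eq
  proof (rule ctensI)
    fix n
    have "S n (K (Suc n)) = S n (K n)" by (rule S) (use K K' in auto)
    then show "nft R s n (S (Suc n) (K (Suc n))) = nft R s n (S n (K n))" by (simp add: nftS)
  qed
  assume J: "\<forall>j\<ge>J. lv R s n (X j) = 0"
  have "lv R s n (cseries R s a X) = nft R s n (S n (K n))"
    unfolding eq by simp
  also have "\<dots> = S n J"
    using S[of "K n" n J] K J by (simp add: nftS)
  finally show "lv R s n (cseries R s a X) = (\<Sum>j<J. fscale (a j) (lv R s n (X j)))"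
    by (simp add: S_def)
qed

text \<open>The part of degree \<open>i\<close> at level \<open>n\<close>, enlarged by the relators to make membership independent of
  representatives.\<close>

definition hsub :: "('k::field, 'r::comm_ring_1) coeff \<Rightarrow> ('k, 'r, 'v::ab_group_add) mv \<Rightarrow> nat \<Rightarrow>
    int \<Rightarrow> ('v \<times> 'r \<Rightarrow>\<^sub>0 'k) set" where
  "hsub R V n i = free.span ({gen (v, r) | v r. v \<in> hom V i} \<union> trel R (smul V) n)"

lemma subspace_hsub [simp]: "free.subspace (hsub R V n i)"
  unfolding hsub_def by (rule free.subspace_span)

lemma trel_hsub: "p \<in> trel R (smul V) n \<Longrightarrow> p \<in> hsub R V n i"
  unfolding hsub_def by (rule free.span_base) blast

lemma gen_hsub: "v \<in> hom V i \<Longrightarrow> gen (v, r) \<in> hsub R V n i"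
  unfolding hsub_def by (rule free.span_base) blast

lemma nft_hsub:
  assumes "p \<in> hsub R V n i"
  shows "nft R (smul V) n p \<in> hsub R V n i"
  using free.subspace_diff[OF subspace_hsub assms trel_hsub[OF diff_nf[OF subspace_trel, of p]]] by simp

lemma lin_hsub:
  assumes "lin fscale t f" "p \<in> hsub R V n i" "module.subspace t S"
    and "\<And>v r. v \<in> hom V i \<Longrightarrow> f (gen (v, r)) \<in> S" "\<And>q. q \<in> trel R (smul V) n \<Longrightarrow> f q \<in> S"
  shows "f p \<in> S"
  using assms(1) assms(2)[unfolded hsub_def] _ assms(3)
  by (rule lin_span) (use assms(4,5) in auto)

lemma rsc_hsub:
  assumes "p \<in> hsub R V n i"
  shows "rsc r p \<in> hsub R V n i"
  by (rule lin_hsub[OF lin_rsc assms subspace_hsub]) (auto intro: gen_hsub trel_hsub rsc_trel)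

lemma chom_iff:
  "x \<in> chom R V i \<longleftrightarrow> x \<in> carr R V \<and> (\<forall>n. lv R (smul V) n x \<in> hsub R V n i)"
proof -
  let ?A = "{gen (v, r) | v r. v \<in> hom V i}"
  have "(\<exists>p\<in>x n. fst ` Poly_Mapping.keys p \<subseteq> hom V i) \<longleftrightarrow> lv R (smul V) n x \<in> hsub R V n i"
    if x: "x \<in> carr R V" for n
  proof
    assume "\<exists>p\<in>x n. fst ` Poly_Mapping.keys p \<subseteq> hom V i"
    then obtain p where p: "p \<in> x n" "\<And>b. b \<in> Poly_Mapping.keys p \<Longrightarrow> fst b \<in> hom V i" by blast
    have "lext fscale gen p \<in> hsub R V n i"
    proof (rule lext_mem_subspace[OF vs_free subspace_hsub])
      fix b assume "b \<in> Poly_Mapping.keys p"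
      from gen_hsub[OF p(2)[OF this], of "snd b"] show "gen b \<in> hsub R V n i" by simp
    qed
    moreover have "p - lv R (smul V) n x \<in> hsub R V n i"
      using p(1) ctens_quo[OF x, of n] by (intro trel_hsub) (simp add: mem_quo)
    ultimately show "lv R (smul V) n x \<in> hsub R V n i"
      using free.subspace_diff[OF subspace_hsub, of p R V n i "p - lv R (smul V) n x"] by simp
  next
    assume "lv R (smul V) n x \<in> hsub R V n i"
    then obtain a q where a: "a \<in> free.span ?A" and q: "q \<in> free.span (trel R (smul V) n)"
      and eq: "lv R (smul V) n x = a + q"
      unfolding hsub_def free.span_Un by blast
    from q have "q \<in> trel R (smul V) n"
      unfolding trel_eq free.span_span .
    then have "a - lv R (smul V) n x \<in> trel R (smul V) n"
      using free.subspace_neg[OF subspace_trel] eq by simp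
    then have "a \<in> x n"
      using ctens_quo[OF x, of n] by (simp add: mem_quo)
    moreover have "Poly_Mapping.keys a \<subseteq> hom V i \<times> UNIV"
      by (rule keys_subset_span[OF a]) auto
    then have "fst ` Poly_Mapping.keys a \<subseteq> hom V i" by auto
    ultimately show "\<exists>p\<in>x n. fst ` Poly_Mapping.keys p \<subseteq> hom V i" by blast
  qed
  then show ?thesis
    unfolding chom_def by auto
qed

lemma chom_carr: "x \<in> chom R V i \<Longrightarrow> x \<in> carr R V"
  by (simp add: chom_iff)

lemma czero_chom [simp]: "czero R (smul V) \<in> chom R V i"
  by (simp add: chom_iff free.subspace_0)

lemma csub_chom: "x \<in> chom R V i \<Longrightarrow> y \<in> chom R V i \<Longrightarrow> csub R (smul V) x y \<in> chom R V i"
  by (simp add: chom_iff free.subspace_diff)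

lemma incl_chom: "v \<in> hom V i \<Longrightarrow> incl R (smul V) v \<in> chom R V i"
  by (simp add: chom_iff lv_incl nft_hsub gen_hsub)

lemma cseries_chom:
  assumes "\<And>j. X j \<in> chom R V i" "\<And>n. \<exists>J. \<forall>j\<ge>J. lv R (smul V) n (X j) = 0"
  shows "cseries R (smul V) a X \<in> chom R V i"
  unfolding chom_iff
proof (intro conjI allI)
  have X: "\<And>j. X j \<in> carr R V" using assms(1) by (rule chom_carr)
  show "cseries R (smul V) a X \<in> carr R V" by (rule cseries_ctens[OF X assms(2)])
  fix n
  from assms(2)[of n] obtain J where "\<forall>j\<ge>J. lv R (smul V) n (X j) = 0" by blast
  from lv_cseries[OF X assms(2) this, where a = a]
  show "lv R (smul V) n (cseries R (smul V) a X) \<in> hsub R V n i"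
    using assms(1) by (auto simp: chom_iff intro!: free.subspace_sum free.subspace_scale)
qed

lemma cseries_cscale:
  assumes X: "\<And>j. X j \<in> ctens R s" and conv: "\<And>n. \<exists>J. \<forall>j\<ge>J. lv R s n (X j) = 0"
  shows "cseries R s a (\<lambda>j. cscale R s r (X j)) = cscale R s r (cseries R s a X)"
proof (rule ctens_eqI)
  have conv': "\<exists>J. \<forall>j\<ge>J. lv R s n (cscale R s r (X j)) = 0" for n
  proof -
    from conv[of n] obtain J where "\<forall>j\<ge>J. lv R s n (X j) = 0" ..
    then have "\<forall>j\<ge>J. lv R s n (cscale R s r (X j)) = 0"
      by (simp add: lv_cscale lin_zero[OF lin_rsc])
    then show ?thesis ..
  qed
  show "cseries R s a (\<lambda>j. cscale R s r (X j)) \<in> ctens R s"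
    by (rule cseries_ctens[OF cscale_ctens[OF X] conv'])
  show "cscale R s r (cseries R s a X) \<in> ctens R s"
    by (rule cscale_ctens[OF cseries_ctens[OF X conv]])
  fix n
  from conv[of n] obtain J where J: "\<forall>j\<ge>J. lv R s n (X j) = 0" by blast
  then have J': "\<forall>j\<ge>J. lv R s n (cscale R s r (X j)) = 0"
    by (simp add: lv_cscale lin_zero[OF lin_rsc])
  show "lv R s n (cseries R s a (\<lambda>j. cscale R s r (X j))) = lv R s n (cscale R s r (cseries R s a X))"
    unfolding lv_cseries[OF cscale_ctens[OF X] conv' J']
    by (simp add: lv_cscale lv_cseries[OF X conv J] lin_sum[OF lin_rsc] lin_sum[OF lin_nft] lin_scale[OF lin_rsc] nft_scale)
qed

section \<open>Exponential and logarithm in the completed algebra\<close>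

locale mv_alg = local_base R
  for R :: "('k::field_char_0, 'r::comm_ring_1) coeff" +
  fixes V :: "('k, 'r, 'v::ab_group_add) mv"
  assumes mv: "mv_algebra R V"
begin

abbreviation mul where "mul \<equiv> fmul (mv.mult V)"
abbreviation one where "one \<equiv> gen (unit V, 1)"

lemma vs: "vector_space (smul V)"
  using mv by (auto simp: mv_algebra_def graded_space_def)

lemma algebra:
  shows mult_add_left: "mv.mult V (x + y) z = mv.mult V x z + mv.mult V y z"
    and mult_add_right: "mv.mult V x (y + z) = mv.mult V x y + mv.mult V x z"
    and mult_scale_left: "mv.mult V (smul V c x) y = smul V c (mv.mult V x y)"
    and mult_scale_right: "mv.mult V x (smul V c y) = smul V c (mv.mult V x y)"
    and mult_hom: "x \<in> hom V i \<Longrightarrow> y \<in> hom V j \<Longrightarrow> mv.mult V x y \<in> hom V (i + j)"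
    and mult_assoc: "mv.mult V (mv.mult V x y) z = mv.mult V x (mv.mult V y z)"
    and unit_hom: "unit V \<in> hom V 0"
    and unit_left: "mv.mult V (unit V) x = x"
    and unit_right: "mv.mult V x (unit V) = x"
proof -
  have "graded_comm_algebra V" using mv by (simp add: mv_algebra_def)
  note * = this[unfolded graded_comm_algebra_def]
  have "\<forall>x y z. mv.mult V (x + y) z = mv.mult V x z + mv.mult V y z"
    using * by (elim conjE)
  then show "mv.mult V (x + y) z = mv.mult V x z + mv.mult V y z"
    by simp
  have "\<forall>x y z. mv.mult V x (y + z) = mv.mult V x y + mv.mult V x z"
    using * by (elim conjE)
  then show "mv.mult V x (y + z) = mv.mult V x y + mv.mult V x z"
    by simp
  have "\<forall>c x y. mv.mult V (smul V c x) y = smul V c (mv.mult V x y)"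
    using * by (elim conjE)
  then show "mv.mult V (smul V c x) y = smul V c (mv.mult V x y)"
    by simp
  have "\<forall>c x y. mv.mult V x (smul V c y) = smul V c (mv.mult V x y)"
    using * by (elim conjE)
  then show "mv.mult V x (smul V c y) = smul V c (mv.mult V x y)"
    by simp
  have "\<forall>i j. \<forall>x\<in>hom V i. \<forall>y\<in>hom V j. mv.mult V x y \<in> hom V (i + j)"
    using * by (elim conjE)
  then show "x \<in> hom V i \<Longrightarrow> y \<in> hom V j \<Longrightarrow> mv.mult V x y \<in> hom V (i + j)"
    by simp
  have "\<forall>x y z. mv.mult V (mv.mult V x y) z = mv.mult V x (mv.mult V y z)"
    using * by (elim conjE)
  then show "mv.mult V (mv.mult V x y) z = mv.mult V x (mv.mult V y z)"
    by simp
  have "unit V \<in> hom V 0"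
    using * by (elim conjE)
  then show "unit V \<in> hom V 0"
    by simp
  have "\<forall>x. mv.mult V (unit V) x = x \<and> mv.mult V x (unit V) = x"
    using * by (elim conjE)
  then show "mv.mult V (unit V) x = x"
    by simp
  have "\<forall>x. mv.mult V (unit V) x = x \<and> mv.mult V x (unit V) = x"
    using * by (elim conjE)
  then show "mv.mult V x (unit V) = x"
    by simp
qed

lemma lin_mult_left: "lin (smul V) (smul V) (\<lambda>x. mv.mult V x y)"
  by (rule linI[OF vs vs]) (simp_all add: mult_add_left mult_scale_left)

lemma lin_mult_right: "lin (smul V) (smul V) (mv.mult V x)"
  by (rule linI[OF vs vs]) (simp_all add: mult_add_right mult_scale_right)

lemma mul_trel:
  "p \<in> trel R (smul V) i \<Longrightarrow> q \<in> trel R (smul V) j \<Longrightarrow> mul p q \<in> trel R (smul V) (i + j)"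
  by (rule fmul_trel[OF lin_mult_left lin_mult_right])

lemma mul_trel_left: "p \<in> trel R (smul V) n \<Longrightarrow> mul p q \<in> trel R (smul V) n"
  using mul_trel[of p n q 0] by (simp add: trel_0)

lemma mul_trel_right: "q \<in> trel R (smul V) n \<Longrightarrow> mul p q \<in> trel R (smul V) n"
  using mul_trel[of p 0 q n] by (simp add: trel_0)

lemma mul_assoc: "mul (mul p q) u = mul p (mul q u)"
  by (rule fmul_assoc) (rule mult_assoc)

lemma mul_one_left [simp]: "mul one p = p"
  by (rule fmul_unit_left) (rule unit_left)

lemma mul_one_right [simp]: "mul p one = p"
  by (rule fmul_unit_right) (rule unit_right)

lemma nft_mul_left [simp]: "nft R (smul V) n (mul (nft R (smul V) n p) q) = nft R (smul V) n (mul p q)"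
  using mul_trel_left[OF diff_nf[OF subspace_trel[of R "smul V" n], of p], of q]
  by (subst eq_commute) (simp add: nf_eq_iff lin_diff[OF lin_fmul_left])

lemma nft_mul_right [simp]: "nft R (smul V) n (mul p (nft R (smul V) n q)) = nft R (smul V) n (mul p q)"
  using mul_trel_right[OF diff_nf[OF subspace_trel[of R "smul V" n], of q], of p]
  by (subst eq_commute) (simp add: nf_eq_iff lin_diff[OF lin_fmul_right])

lemma mul_hsub:
  assumes "p \<in> hsub R V n i" "q \<in> hsub R V n j"
  shows "mul p q \<in> hsub R V n (i + j)"
proof (rule lin_hsub[OF lin_fmul_left assms(1) subspace_hsub])
  fix v r assume v: "v \<in> hom V i"
  show "mul (gen (v, r)) q \<in> hsub R V n (i + j)"
    by (rule lin_hsub[OF lin_fmul_right assms(2) subspace_hsub])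
      (simp_all add: gen_hsub mult_hom v trel_hsub mul_trel_right)
qed (simp add: trel_hsub mul_trel_left)

lemma lv_cmult: "lv R (smul V) n (cmult R V x y) =
    nft R (smul V) n (mul (lv R (smul V) n x) (lv R (smul V) n y))"
  unfolding cmult_def fmul_def[symmetric] lv_quo by (simp add: lv_def)

lemma cmult_carr:
  assumes "x \<in> carr R V" "y \<in> carr R V"
  shows "cmult R V x y \<in> carr R V"
  unfolding cmult_def fmul_def[symmetric]
proof (rule ctensI)
  fix n
  have "nft R (smul V) n (mul (rep (x m)) (rep (y m))) =
      nft R (smul V) n (mul (nft R (smul V) n (rep (x m))) (nft R (smul V) n (rep (y m))))" for m
    by simp
  from this[of n] this[of "Suc n"]
  show "nft R (smul V) n (mul (rep (x (Suc n))) (rep (y (Suc n)))) =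
      nft R (smul V) n (mul (rep (x n)) (rep (y n)))"
    unfolding nft_rep_Suc[OF assms(1)] nft_rep_Suc[OF assms(2)] lv_def by simp
qed

lemma cmult_chom:
  "x \<in> chom R V i \<Longrightarrow> y \<in> chom R V j \<Longrightarrow> cmult R V x y \<in> chom R V (i + j)"
  by (simp add: chom_iff lv_cmult cmult_carr nft_hsub mul_hsub)

lemma cunit_carr [simp]: "cunit R V \<in> carr R V"
  by (simp add: cunit_def)

lemma lv_cunit: "lv R (smul V) n (cunit R V) = nft R (smul V) n one"
  by (simp add: cunit_def lv_incl)

lemma cunit_chom: "cunit R V \<in> chom R V 0"
  by (simp add: cunit_def incl_chom unit_hom)

primrec fpow :: "('v \<times> 'r \<Rightarrow>\<^sub>0 'k) \<Rightarrow> nat \<Rightarrow> ('v \<times> 'r \<Rightarrow>\<^sub>0 'k)" where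
  "fpow p 0 = one"
| "fpow p (Suc j) = mul p (fpow p j)"

lemma nft_fpow_nft [simp]: "nft R (smul V) n (fpow (nft R (smul V) n p) j) = nft R (smul V) n (fpow p j)"
proof (induction j)
  case (Suc j)
  have "nft R (smul V) n (fpow (nft R (smul V) n p) (Suc j)) =
      nft R (smul V) n (mul p (nft R (smul V) n (fpow (nft R (smul V) n p) j)))" by simp
  also have "\<dots> = nft R (smul V) n (fpow p (Suc j))" unfolding Suc by simp
  finally show ?case .
qed simp

lemma fpow_trel: "p \<in> trel R (smul V) (Suc 0) \<Longrightarrow> fpow p j \<in> trel R (smul V) j"
proof (induction j)
  case (Suc j)
  then show ?case using mul_trel[of p "Suc 0" "fpow p j" j] by simp
qed (simp add: trel_0)

lemma cpow_carr: "x \<in> carr R V \<Longrightarrow> cpow R V x j \<in> carr R V"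
  by (induction j) (simp_all add: cmult_carr)

lemma cpow_chom: "x \<in> chom R V 0 \<Longrightarrow> cpow R V x j \<in> chom R V 0"
proof (induction j)
  case (Suc j)
  then show ?case using cmult_chom[of x 0 "cpow R V x j" 0] by simp
qed (simp add: cunit_chom)

lemma lv_cpow: "lv R (smul V) n (cpow R V x j) = nft R (smul V) n (fpow (lv R (smul V) n x) j)"
  by (induction j) (simp_all add: lv_cunit lv_cmult)

lemma cmax_iff': "x \<in> cmax R (smul V) \<longleftrightarrow> x \<in> carr R V \<and> lv R (smul V) (Suc 0) x = 0"
  by (rule cmax_iff[OF vs])

text \<open>The \<open>j\<close>-th power of an element of \<open>V \<otimes> \<mm>\<close> lies in \<open>V \<otimes> \<mm>\<^sup>j\<close>; so every power series converges
  there.\<close>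

lemma lv_cpow_cmax:
  assumes "x \<in> cmax R (smul V)" "n \<le> j"
  shows "lv R (smul V) n (cpow R V x j) = 0"
proof -
  have "fpow (lv R (smul V) n x) j \<in> trel R (smul V) j"
    using assms(1) by (intro fpow_trel) (simp add: cmax_iff' lv_trel)
  then show ?thesis
    using trel_antimono[OF assms(2)] by (auto simp: lv_cpow nf_eq_0)
qed

lemma cpow_series:
  assumes "x \<in> cmax R (smul V)"
  shows "\<And>j. cpow R V x j \<in> carr R V" "\<And>n. \<exists>J. \<forall>j\<ge>J. lv R (smul V) n (cpow R V x j) = 0"
  using assms lv_cpow_cmax by (auto simp: cmax_iff' cpow_carr)

lemma lv_cpow_cseries:
  assumes "x \<in> cmax R (smul V)" "n \<le> J"
  shows "lv R (smul V) n (cseries R (smul V) a (cpow R V x)) =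
    nft R (smul V) n (\<Sum>j<J. fscale (a j) (fpow (lv R (smul V) n x) j))"
proof -
  have "\<forall>j\<ge>J. lv R (smul V) n (cpow R V x j) = 0"
    using lv_cpow_cmax[OF assms(1), of n] assms(2) by simp
  from lv_cseries[OF cpow_series[OF assms(1)] this] show ?thesis
    by (simp add: lv_cpow lin_sum[OF lin_nft] nft_scale)
qed

lemma csub_cunit_cmax:
  assumes "x \<in> carr R V" "lv R (smul V) (Suc 0) x = lv R (smul V) (Suc 0) (cunit R V)"
  shows "csub R (smul V) x (cunit R V) \<in> cmax R (smul V)"
  using assms by (simp add: cmax_iff')

lemma cexp_carr: "S \<in> cmax R (smul V) \<Longrightarrow> cexp R V S \<in> carr R V"
  unfolding cexp_def by (rule cseries_ctens[OF cpow_series])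

lemma cexp_chom:
  assumes "S \<in> cmax R (smul V)" "S \<in> chom R V 0"
  shows "cexp R V S \<in> chom R V 0"
  unfolding cexp_def by (rule cseries_chom[OF cpow_chom[OF assms(2)] cpow_series(2)[OF assms(1)]])

lemma lv_cexp_1:
  assumes "S \<in> cmax R (smul V)"
  shows "lv R (smul V) (Suc 0) (cexp R V S) = lv R (smul V) (Suc 0) (cunit R V)"
  unfolding cexp_def lv_cpow_cseries[OF assms order_refl] by (simp add: exp_coeff_def lv_cunit)

lemma clog_cmax:
  assumes "x \<in> carr R V" "lv R (smul V) (Suc 0) x = lv R (smul V) (Suc 0) (cunit R V)"
  shows "clog R V x \<in> cmax R (smul V)"
  unfolding cmax_iff' clog_def
    lv_cpow_cseries[OF csub_cunit_cmax[OF assms] order_refl]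
  by (simp add: cseries_ctens[OF cpow_series[OF csub_cunit_cmax[OF assms]]] log_coeff_def)

lemma clog_chom:
  assumes "x \<in> chom R V 0" "lv R (smul V) (Suc 0) x = lv R (smul V) (Suc 0) (cunit R V)"
  shows "clog R V x \<in> chom R V 0"
  unfolding clog_def
  by (rule cseries_chom[OF cpow_chom cpow_series(2)[OF csub_cunit_cmax[OF chom_carr[OF assms(1)] assms(2)]]])
    (intro csub_chom assms(1) cunit_chom)

text \<open>Evaluation of polynomials at an element of the lifted algebra. It is multiplicative, so
  identities between power series can be transported to each level, where only finitely many terms
  survive.\<close>

definition pev :: "('v \<times> 'r \<Rightarrow>\<^sub>0 'k) \<Rightarrow> 'k poly \<Rightarrow> ('v \<times> 'r \<Rightarrow>\<^sub>0 'k)" where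
  "pev p P = (\<Sum>i\<le>degree P. fscale (coeff P i) (fpow p i))"

lemma pev_bound: "degree P \<le> n \<Longrightarrow> pev p P = (\<Sum>i\<le>n. fscale (coeff P i) (fpow p i))"
  unfolding pev_def by (rule sum.mono_neutral_left) (auto simp: coeff_eq_0)

lemma pev_add: "pev p (P + Q) = pev p P + pev p Q"
proof -
  have "degree (P + Q) \<le> max (degree P) (degree Q)" by (rule degree_add_le_max)
  then show ?thesis
    by (simp add: pev_bound[of _ "max (degree P) (degree Q)"] free.scale_left_distrib sum.distrib)
qed

lemma pev_smult: "pev p (smult c P) = fscale c (pev p P)"
  by (simp add: pev_bound[of "smult c P" "degree P"] pev_def free.scale_sum_right)

lemma pev_0 [simp]: "pev p 0 = 0"
  by (simp add: pev_def)

lemma pev_1 [simp]: "pev p 1 = one"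
  by (simp add: pev_def)

lemma pev_sum: "pev p (\<Sum>i\<in>I. P i) = (\<Sum>i\<in>I. pev p (P i))"
  by (induction I rule: infinite_finite_induct) (simp_all add: pev_add)

lemma pev_pCons: "pev p (pCons a P) = fscale a one + mul p (pev p P)"
proof -
  have "pev p (pCons a P) = (\<Sum>i\<le>Suc (degree P). fscale (coeff (pCons a P) i) (fpow p i))"
    by (rule pev_bound) (rule degree_pCons_le)
  also have "\<dots> = fscale a one + (\<Sum>i\<le>degree P. fscale (coeff P i) (mul p (fpow p i)))"
    unfolding sum.atMost_Suc_shift by simp
  also have "\<dots> = fscale a one + mul p (pev p P)"
    by (simp add: pev_def lin_sum[OF lin_fmul_right] lin_scale[OF lin_fmul_right])
  finally show ?thesis .
qed

lemma pev_mult: "pev p (P * Q) = mul (pev p P) (pev p Q)"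
proof (induction P)
  case 0
  show ?case by (simp add: lin_zero[OF lin_fmul_left])
next
  case (pCons a P)
  then show ?case
    by (simp add: pev_add pev_smult pev_pCons lin_add[OF lin_fmul_left] mul_assoc
        lin_scale[OF lin_fmul_left, of _ a one] del: fscale_single)
qed

lemma pev_power: "pev p (P ^ i) = fpow (pev p P) i"
  by (induction i) (simp_all add: pev_mult)

end

text \<open>The identity \<open>exp (log (1 + X)) = 1 + X\<close> for truncated series: up to degree \<open>J\<close> the powers of the
  truncated logarithm agree with those of the full one, and \<open>fps_ln 1\<close> is the compositional inverse
  of \<open>fps_exp 1 - 1\<close>.\<close>

lemma coeff_exp_log:
  fixes J :: nat
  defines "L \<equiv> (\<Sum>j<J. monom (log_coeff j :: 'k::field_char_0) j)"
  assumes "k < J"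
  shows "coeff (\<Sum>i<J. smult (exp_coeff i) (L ^ i)) k = (if k \<le> 1 then 1 else 0)"
proof -
  have ln: "fps_nth (fps_ln 1 :: 'k fps) j = log_coeff j" for j
    by (cases j) (simp_all add: fps_ln_def log_coeff_def)
  have "coeff L j = log_coeff j" if "j < J" for j
    using that by (simp add: L_def coeff_sum)
  then have L: "fps_nth (fps_of_poly L) j = fps_nth (fps_ln 1 :: 'k fps) j" if "j < J" for j
    using that by (simp add: ln)
  have pow: "fps_nth (fps_of_poly L ^ i) j = fps_nth ((fps_ln 1 :: 'k fps) ^ i) j" if "j < J" for i j
    using that
  proof (induction i arbitrary: j)
    case (Suc i)
    then show ?case using L by (auto simp: fps_mult_nth intro!: sum.cong)
  qed simp
  have "coeff (\<Sum>i<J. smult (exp_coeff i) (L ^ i)) k =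
      (\<Sum>i<J. exp_coeff i * fps_nth ((fps_ln 1 :: 'k fps) ^ i) k)"
    using pow[OF assms(2), folded fps_of_poly_power] by (simp add: coeff_sum)
  also have "\<dots> = (\<Sum>i\<in>{0..k}. exp_coeff i * fps_nth ((fps_ln 1 :: 'k fps) ^ i) k)"
    using assms(2) startsby_zero_power_prefix[of "fps_ln 1 :: 'k fps"] ln[of 0]
    by (intro sum.mono_neutral_right) (auto simp: log_coeff_def)
  also have "\<dots> = fps_nth (fps_compose (fps_exp 1) (fps_ln 1 :: 'k fps)) k"
    by (simp add: fps_compose_nth exp_coeff_def)
  also have "fps_compose (fps_exp 1) (fps_ln 1 :: 'k fps) = fps_compose (fps_exp 1 - 1) (fps_inv (fps_exp 1 - 1)) + 1"
    by (simp add: fps_ln_fps_exp_inv fps_compose_sub_distrib)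
  also have "fps_compose (fps_exp 1 - 1) (fps_inv (fps_exp 1 - 1)) = (fps_X :: 'k fps)"
    by (rule fps_inv_right) simp_all
  finally show ?thesis by (cases k) auto
qed

context mv_alg begin

text \<open>Evaluate the truncated identity at \<open>x - 1\<close>: the terms of high degree lie in a high step of the
  filtration and vanish at the given level.\<close>

lemma cexp_clog:
  assumes "x \<in> carr R V" "lv R (smul V) (Suc 0) x = lv R (smul V) (Suc 0) (cunit R V)"
  shows "cexp R V (clog R V x) = x"
proof (rule ctens_eqI)
  define y where "y = csub R (smul V) x (cunit R V)"
  have y: "y \<in> cmax R (smul V)"
    unfolding y_def by (rule csub_cunit_cmax[OF assms])
  have clog: "clog R V x \<in> cmax R (smul V)" by (rule clog_cmax[OF assms])
  show "cexp R V (clog R V x) \<in> carr R V" by (rule cexp_carr[OF clog])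
  show "x \<in> carr R V" by fact
  fix n
  let ?N = "nft R (smul V) n"
  define p where "p = lv R (smul V) n y"
  \<comment> \<open>at least \<open>n\<close> terms for convergence, and at least the terms of degrees 0 and 1\<close>
  define J where "J = n + 2"
  have J: "n \<le> J" "2 \<le> J" by (simp_all add: J_def)
  define L where "L = (\<Sum>j<J. monom (log_coeff j :: 'k) j)"
  define P where "P = (\<Sum>i<J. smult (exp_coeff i) (L ^ i))"
  have pev_monom: "pev p (monom c j) = fscale c (fpow p j)" for c j
    by (induction j) (simp_all add: monom_0 monom_Suc pev_pCons lin_scale[OF lin_fmul_right] 
       lin_zero[OF lin_fmul_right] del: fscale_single)
  have "lv R (smul V) n (clog R V x) = ?N (pev p L)"
    unfolding clog_def y_def[symmetric] lv_cpow_cseries[OF y J(1)]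
    by (simp add: L_def pev_sum pev_monom p_def[symmetric])
  then have "lv R (smul V) n (cexp R V (clog R V x)) = ?N (\<Sum>i<J. fscale (exp_coeff i) (fpow (?N (pev p L)) i))"
    unfolding cexp_def lv_cpow_cseries[OF clog J(1)] by simp
  also have "\<dots> = ?N (pev p P)"
    by (simp add: P_def pev_sum pev_smult pev_power lin_sum[OF lin_nft] nft_scale)
  also have "pev p P = (\<Sum>k\<le>max (degree P) J. fscale (coeff P k) (fpow p k))"
    by (rule pev_bound) simp
  also have "?N \<dots> = (\<Sum>k\<le>max (degree P) J. fscale (coeff P k) (?N (fpow p k)))"
    by (simp add: lin_sum[OF lin_nft] nft_scale)
  also have "\<dots> = (\<Sum>k\<in>{0, 1}. fscale (coeff P k) (?N (fpow p k)))"
  proof (rule sum.mono_neutral_right)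
    have "p \<in> trel R (smul V) (Suc 0)"
      using y by (simp add: p_def cmax_iff' lv_trel)
    then have "?N (fpow p k) = 0" if "k \<ge> J" for k
      using fpow_trel[of p k] trel_antimono[of n k R "smul V"] that J(1) by (auto simp: nf_eq_0)
    moreover have "coeff P k = 0" if "k < J" "k \<notin> {0, 1}" for k
      using coeff_exp_log[OF that(1), where 'k = 'k] that(2) by (simp add: P_def L_def)
    ultimately show "\<forall>k\<in>{..max (degree P) J} - {0, 1}. fscale (coeff P k) (?N (fpow p k)) = 0"
      by (metis DiffD2 free.scale_zero_left free.scale_zero_right not_le)
  qed (use J in auto)
  also have "\<dots> = ?N one + ?N p"
    using coeff_exp_log[of 0 J, where 'k = 'k] coeff_exp_log[of 1 J, where 'k = 'k] J
    by (simp add: P_def L_def)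
  also have "\<dots> = lv R (smul V) n x"
    by (simp add: p_def y_def lv_cunit nft_diff)
  finally show "lv R (smul V) n (cexp R V (clog R V x)) = lv R (smul V) n x" .
qed

end

section \<open>Coproducts and convolution of linear maps\<close>

text \<open>A linear map \<open>D : V \<rightarrow> V \<otimes> V\<close>; it will be the coproduct or the reduced coproduct.\<close>

definition colin :: "('k::field \<Rightarrow> 'v \<Rightarrow> 'v) \<Rightarrow> ('v \<Rightarrow> ('v::ab_group_add list \<Rightarrow>\<^sub>0 'k) set) \<Rightarrow> bool" where
  "colin s D \<longleftrightarrow> (\<forall>v. D v \<in> tpow s 2) \<and> lin s fscale (\<lambda>v. nf (mrel s 2) (rep (D v)))"

lemma colinD:
  assumes "colin s D"
  shows "D v \<in> tpow s 2" "lin s fscale (\<lambda>v. nf (mrel s 2) (rep (D v)))"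
  using assms by (simp_all add: colin_def)

lemma length_colin:
  "colin s D \<Longrightarrow> ws \<in> Poly_Mapping.keys (rep (D v)) \<Longrightarrow> length ws = 2"
  using tpow_rep(3)[OF colinD(1)] .

lemma lext_nf_mrel:
  assumes "mlin s t n \<Psi>" "vector_space t"
  shows "lext t \<Psi> (nf (mrel s n) p) = lext t \<Psi> p"
  using lext_mrel[OF assms diff_nf[OF subspace_mrel], of p]
    lin_diff[OF lin_lext[OF assms(2)], of \<Psi> p "nf (mrel s n) p"] by simp

lemma lin_lext_colin:
  assumes "colin s D" "mlin s t 2 \<Psi>" "vector_space t"
  shows "lin s t (\<lambda>v. lext t \<Psi> (rep (D v)))"
proof -
  have "lin s t (\<lambda>v. lext t \<Psi> (nf (mrel s 2) (rep (D v))))"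
    by (rule lin_comp[OF colinD(2)[OF assms(1)] lin_lext[OF assms(3)]])
  then show ?thesis by (simp add: lext_nf_mrel[OF assms(2,3)])
qed

lemma nf_tpow:
  assumes "t \<in> tpow s n" "p \<in> t"
  shows "nf (mrel s n) (rep t) = nf (mrel s n) p"
proof -
  have "p \<in> quo (mrel s n) (rep t)"
    using assms(2) tpow_rep(2)[OF assms(1)] by blast
  then show ?thesis
    using nf_eq_iff[OF subspace_mrel, of s n p "rep t"] by (simp add: mem_quo)
qed

text \<open>The transpose of the insertion of \<open>D\<close> in the first slot.\<close>

definition ins :: "('k::field \<Rightarrow> 'a \<Rightarrow> 'a) \<Rightarrow> ('v \<Rightarrow> ('v list \<Rightarrow>\<^sub>0 'k) set) \<Rightarrow>
    ('v list \<Rightarrow> 'a::ab_group_add) \<Rightarrow> 'v list \<Rightarrow> 'a" where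
  "ins t D \<Psi> zs = lext t (\<lambda>ws. \<Psi> (ws @ drop (Suc 0) zs)) (rep (D (zs ! 0)))"

lemma lext_slot_map_0:
  assumes "mlin s u n \<Psi>" "vector_space u"
  shows "lext u \<Psi> (rep (slot_map s n D 0 t)) = lext u (ins u D \<Psi>) (rep t)"
  unfolding ins_def lext_slot_map[OF assms] by simp

lemma mlin_append:
  assumes "mlin s t (n + length ys) \<Psi>"
  shows "mlin s t n (\<lambda>ws. \<Psi> (ws @ ys))"
  unfolding mlin_def
proof (intro allI impI)
  fix xs zs :: "'b list" assume "length xs + length zs + 1 = n"
  then have "length xs + length (zs @ ys) + 1 = n + length ys" by simp
  then have "lin s t (\<lambda>x. \<Psi> (xs @ x # (zs @ ys)))"
    using assms unfolding mlin_def by blast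
  then show "lin s t (\<lambda>x. \<Psi> ((xs @ x # zs) @ ys))" by simp
qed

lemma mlin_ins:
  assumes D: "colin s D" and \<Psi>: "mlin s t (Suc (Suc n)) \<Psi>" and t: "vector_space t"
  shows "mlin s t (Suc n) (ins t D \<Psi>)"
  unfolding mlin_def
proof (intro allI impI)
  fix xs ys :: "'b list"
  assume len: "length xs + length ys + 1 = Suc n"
  show "lin s t (\<lambda>x. ins t D \<Psi> (xs @ x # ys))"
  proof (cases xs)
    case Nil
    have "mlin s t 2 (\<lambda>ws. \<Psi> (ws @ ys))"
      by (rule mlin_append) (use len \<Psi> Nil in simp)
    from lin_lext_colin[OF D this t] show ?thesis
      by (simp add: ins_def Nil)
  next
    case (Cons z zs)
    have s: "vector_space s" using linD(1)[OF colinD(2)[OF D]] .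
    have "lin s t (\<lambda>x. lext t (\<lambda>ws. \<Psi> (ws @ zs @ x # ys)) (rep (D z)))"
    proof (rule lin_lext_param[OF s t])
      fix ws assume "ws \<in> Poly_Mapping.keys (rep (D z))"
      then have "length (ws @ zs) + length ys + 1 = Suc (Suc n)"
        using length_colin[OF D] len Cons by simp
      then have "lin s t (\<lambda>x. \<Psi> ((ws @ zs) @ x # ys))"
        using \<Psi> unfolding mlin_def by blast
      then show "lin s t (\<lambda>x. \<Psi> (ws @ zs @ x # ys))" by simp
    qed
    then show ?thesis by (simp add: ins_def Cons)
  qed
qed

text \<open>The target of the linear maps to be convolved. It will be the space of normal forms at a fixed
  level. The lifted unit of \<open>W\<close> is a unit only for normal forms, so the counit laws below assume the unit
  law for the values of the given map.\<close>

locale target_algebra =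
  fixes t :: "'k::field \<Rightarrow> 'a::ab_group_add \<Rightarrow> 'a" and m :: "'a \<Rightarrow> 'a \<Rightarrow> 'a"
  assumes lin_m_left: "lin t t (\<lambda>x. m x y)"
    and lin_m_right: "lin t t (m x)"
    and m_assoc: "m (m x y) z = m x (m y z)"
begin

lemma vs_t: "vector_space t"
  by (rule linD(1)[OF lin_m_right])

end

context mv_alg begin

lemma coalgebra:
  shows comul_tpow: "comul V v \<in> tpow (smul V) 2"
    and comul_add: "p \<in> comul V v \<Longrightarrow> q \<in> comul V w \<Longrightarrow> p + q \<in> comul V (v + w)"
    and comul_scale: "p \<in> comul V v \<Longrightarrow> fscale c p \<in> comul V (smul V c v)"
    and comul_hom: "v \<in> hom V i \<Longrightarrow> \<exists>p\<in>comul V v. \<forall>xs\<in>Poly_Mapping.keys p. length xs = 2 \<and>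
        (\<exists>a b. xs ! 0 \<in> hom V a \<and> xs ! 1 \<in> hom V b \<and> a + b = i)"
    and counit_add: "counit V (v + w) = counit V v + counit V w"
    and counit_scale: "counit V (smul V c v) = c * counit V v"
    and counit_hom: "v \<in> hom V i \<Longrightarrow> i \<noteq> 0 \<Longrightarrow> counit V v = 0"
    and coassoc: "slot_map (smul V) 3 (comul V) 0 (comul V v) =
      slot_map (smul V) 3 (comul V) 1 (comul V v)"
    and counit_left: "p \<in> comul V v \<Longrightarrow>
      lext (smul V) (\<lambda>xs. smul V (counit V (xs ! 0)) (xs ! 1)) p = v"
    and counit_right: "p \<in> comul V v \<Longrightarrow>
      lext (smul V) (\<lambda>xs. smul V (counit V (xs ! 1)) (xs ! 0)) p = v"
proof -
  have "graded_cocomm_coalgebra V" using mv by (simp add: mv_algebra_def)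
  note * = this[unfolded graded_cocomm_coalgebra_def]
  have "\<forall>v. comul V v \<in> tpow (smul V) 2"
    using * by (elim conjE)
  then show "comul V v \<in> tpow (smul V) 2" by simp
  have "\<forall>v w. \<forall>p\<in>comul V v. \<forall>q\<in>comul V w. p + q \<in> comul V (v + w)"
    using * by (elim conjE)
  then show "p \<in> comul V v \<Longrightarrow> q \<in> comul V w \<Longrightarrow> p + q \<in> comul V (v + w)" by simp
  have "\<forall>c v. \<forall>p\<in>comul V v. fscale c p \<in> comul V (smul V c v)"
    using * by (elim conjE)
  then show "p \<in> comul V v \<Longrightarrow> fscale c p \<in> comul V (smul V c v)" by simp
  have "\<forall>i. \<forall>v\<in>hom V i. \<exists>p\<in>comul V v. \<forall>xs\<in>Poly_Mapping.keys p. length xs = 2 \<and>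
        (\<exists>a b. xs ! 0 \<in> hom V a \<and> xs ! 1 \<in> hom V b \<and> a + b = i)"
    using * by (elim conjE)
  then show "v \<in> hom V i \<Longrightarrow> \<exists>p\<in>comul V v. \<forall>xs\<in>Poly_Mapping.keys p. length xs = 2 \<and>
        (\<exists>a b. xs ! 0 \<in> hom V a \<and> xs ! 1 \<in> hom V b \<and> a + b = i)" by simp
  have "\<forall>v w. counit V (v + w) = counit V v + counit V w"
    using * by (elim conjE)
  then show "counit V (v + w) = counit V v + counit V w" by simp
  have "\<forall>c v. counit V (smul V c v) = c * counit V v"
    using * by (elim conjE)
  then show "counit V (smul V c v) = c * counit V v" by simp
  have "\<forall>i. \<forall>v\<in>hom V i. i \<noteq> 0 \<longrightarrow> counit V v = 0"
    using * by (elim conjE)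
  then show "v \<in> hom V i \<Longrightarrow> i \<noteq> 0 \<Longrightarrow> counit V v = 0" by simp
  have "\<forall>v. slot_map (smul V) 3 (comul V) 0 (comul V v) = slot_map (smul V) 3 (comul V) 1 (comul V v)"
    using * by (elim conjE)
  then show "slot_map (smul V) 3 (comul V) 0 (comul V v) = slot_map (smul V) 3 (comul V) 1 (comul V v)"
    by (rule spec)
  have "\<forall>v. \<forall>p\<in>comul V v. lext (smul V) (\<lambda>xs. smul V (counit V (xs ! 0)) (xs ! 1)) p = v"
    using * by (elim conjE)
  then show "p \<in> comul V v \<Longrightarrow> lext (smul V) (\<lambda>xs. smul V (counit V (xs ! 0)) (xs ! 1)) p = v"
    by simp
  have "\<forall>v. \<forall>p\<in>comul V v. lext (smul V) (\<lambda>xs. smul V (counit V (xs ! 1)) (xs ! 0)) p = v"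
    using * by (elim conjE)
  then show "p \<in> comul V v \<Longrightarrow> lext (smul V) (\<lambda>xs. smul V (counit V (xs ! 1)) (xs ! 0)) p = v"
    by simp
qed

lemma augmentation:
  shows comul_unit: "comul V (unit V) = quo (mrel (smul V) 2) (gen [unit V, unit V])"
    and counit_unit: "counit V (unit V) = 1"
  using mv by (simp_all add: mv_algebra_def augmented_def)

lemma rep_comul: "rep (comul V v) \<in> comul V v"
  by (rule tpow_rep(1)[OF comul_tpow])

lemma colin_comul: "colin (smul V) (comul V)"
  unfolding colin_def
proof (intro conjI allI comul_tpow linI vs vs_free)
  note nf_lin = lin_nf[OF subspace_mrel[of "smul V" 2]]
  fix v w c
  show "nf (mrel (smul V) 2) (rep (comul V (v + w))) =
      nf (mrel (smul V) 2) (rep (comul V v)) + nf (mrel (smul V) 2) (rep (comul V w))"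
    using nf_tpow[OF comul_tpow comul_add[OF rep_comul rep_comul], of v w]
    by (simp add: lin_add[OF nf_lin])
  show "nf (mrel (smul V) 2) (rep (comul V (smul V c v))) = fscale c (nf (mrel (smul V) 2) (rep (comul V v)))"
    using nf_tpow[OF comul_tpow comul_scale[OF rep_comul], of c v]
    by (simp add: lin_scale[OF nf_lin])
qed

abbreviation coaug :: "'v \<Rightarrow> 'v" where
  "coaug v \<equiv> v - smul V (counit V v) (unit V)"

lemma lin_coaug: "lin (smul V) (smul V) coaug"
proof -
  interpret V: vector_space "smul V" by (rule vs)
  show ?thesis
    by (rule linI[OF vs vs])
      (simp_all add: counit_add counit_scale V.scale_left_distrib V.scale_right_diff_distrib)
qed

lemma rcomul_eq: "rcomul V v = quo (mrel (smul V) 2)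
    (rep (comul V (coaug v)) - gen [coaug v, unit V] - gen [unit V, coaug v])"
  unfolding rcomul_def Let_def ..

lemma rcomul_tpow: "rcomul V v \<in> tpow (smul V) 2"
proof -
  have "\<forall>xs\<in>Poly_Mapping.keys (rep (comul V (coaug v)) - gen [coaug v, unit V] - gen [unit V, coaug v]).
      length xs = 2"
    using length_colin[OF colin_comul]
    by (auto simp: in_keys_iff lookup_minus lookup_single when_def split: if_splits)
  then show ?thesis unfolding rcomul_eq tpow_def by blast
qed

lemma lin_nf_word2:
  shows "lin (smul V) fscale (\<lambda>x. nf (mrel (smul V) 2) (gen [x, y]))"
    and "lin (smul V) fscale (\<lambda>y. nf (mrel (smul V) 2) (gen [x, y]))"
proof -
  let ?N = "mrel (smul V) 2"
  note nf_lin = lin_nf[OF subspace_mrel[of "smul V" 2]]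
  have add: "gen (xs @ (x + x') # ys) - gen (xs @ x # ys) - gen (xs @ x' # ys) \<in> ?N"
    and scale: "gen (xs @ smul V c x # ys) - fscale c (gen (xs @ x # ys)) \<in> ?N"
    if "length xs + length ys + 1 = 2" for xs ys x x' c
    unfolding mrel_def using that by (intro free.span_base; fastforce)+
  show "lin (smul V) fscale (\<lambda>x. nf ?N (gen [x, y]))"
    using add[of "[]" "[y]"] scale[of "[]" "[y]"]
    by (intro linI vs vs_free)
      (simp_all add: lin_add[OF nf_lin, symmetric] lin_scale[OF nf_lin, symmetric] nf_eq_iff
        diff_diff_eq del: fscale_single)
  show "lin (smul V) fscale (\<lambda>y. nf ?N (gen [x, y]))"
    using add[of "[x]" "[]"] scale[of "[x]" "[]"]
    by (intro linI vs vs_free)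
      (simp_all add: lin_add[OF nf_lin, symmetric] lin_scale[OF nf_lin, symmetric] nf_eq_iff
        diff_diff_eq del: fscale_single)
qed

lemma colin_rcomul: "colin (smul V) (rcomul V)"
proof -
  let ?N = "mrel (smul V) 2"
  have "nf ?N (rep (rcomul V v)) =
      nf ?N (rep (comul V (coaug v))) - nf ?N (gen [coaug v, unit V]) - nf ?N (gen [unit V, coaug v])" for v
    unfolding rcomul_eq by (simp add: lin_diff[OF lin_nf])
  moreover have "lin (smul V) fscale (\<lambda>v. nf ?N (rep (comul V (coaug v))) -
      nf ?N (gen [coaug v, unit V]) - nf ?N (gen [unit V, coaug v]))"
    by (intro lin_diff_fun lin_comp[OF lin_coaug colinD(2)[OF colin_comul]]
        lin_comp[OF lin_coaug lin_nf_word2(1)] lin_comp[OF lin_coaug lin_nf_word2(2)])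
  ultimately show ?thesis
    unfolding colin_def by (simp add: rcomul_tpow)
qed

lemma rcomul_iter_tpow: "rcomul_iter V k v \<in> tpow (smul V) (Suc k)"
proof (induction k)
  case 0
  show ?case by (auto simp: tpow_def)
next
  case (Suc k)
  have "slot_map (smul V) (k + 2) (rcomul V) 0 (rcomul_iter V k v) \<in> tpow (smul V) (k + 2)"
    by (rule slot_map_tpow) (use tpow_rep(3)[OF Suc] length_colin[OF colin_rcomul] in auto)
  then show ?case by simp
qed

text \<open>The iterates insert the reduced coproduct in the first slot at the end; the same element is
  obtained when the reduced coproduct is applied first and the first factor is iterated.\<close>

lemma lext_rcomul_iter_Suc:
  assumes t: "vector_space t" and "mlin (smul V) t (k + 2) \<Psi>"
  shows "lext t \<Psi> (rep (rcomul_iter V (Suc k) v)) =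
    lext t (\<lambda>xs. lext t (\<lambda>ws. \<Psi> (ws @ [xs ! 1])) (rep (rcomul_iter V k (xs ! 0)))) (rep (rcomul V v))"
  using assms(2)
proof (induction k arbitrary: \<Psi> v)
  case 0
  have 2: "mlin (smul V) t (Suc (Suc 0)) \<Psi>" using "0.prems" by (simp add: numeral_2_eq_2)
  have "mlin (smul V) t (Suc 0) (ins t (rcomul V) \<Psi>)"
    by (rule mlin_ins[OF colin_rcomul 2 t])
  from lext_rep_tpow[OF this t rcomul_iter_tpow, of "gen [v]" v]
  have "lext t \<Psi> (rep (rcomul_iter V (Suc 0) v)) = ins t (rcomul V) \<Psi> [v]"
    using lext_slot_map_0[OF "0.prems" t] by (simp add: quo_refl t)
  also have "\<dots> = lext t \<Psi> (rep (rcomul V v))"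
    by (simp add: ins_def)
  also have "\<dots> = lext t (\<lambda>xs. lext t (\<lambda>ws. \<Psi> (ws @ [xs ! 1])) (rep (rcomul_iter V 0 (xs ! 0)))) (rep (rcomul V v))"
  proof (rule lext_cong)
    fix xs assume "xs \<in> Poly_Mapping.keys (rep (rcomul V v))"
    then have "length xs = 2" by (rule length_colin[OF colin_rcomul])
    then have xs: "[xs ! 0, xs ! 1] = xs"
      by (auto simp: length_Suc_conv numeral_2_eq_2)
    have "mlin (smul V) t (Suc 0) (\<lambda>ws. \<Psi> (ws @ [xs ! 1]))"
      by (rule mlin_append) (use 2 in simp)
    from lext_rep_tpow[OF this t rcomul_iter_tpow, of "gen [xs ! 0]" "xs ! 0"]
    show "\<Psi> xs = lext t (\<lambda>ws. \<Psi> (ws @ [xs ! 1])) (rep (rcomul_iter V 0 (xs ! 0)))"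
      using xs by (simp add: quo_refl t)
  qed
  finally show ?case .
next
  case (Suc k)
  have \<Psi>: "mlin (smul V) t (Suc k + 2) \<Psi>" by fact
  then have ins: "mlin (smul V) t (k + 2) (ins t (rcomul V) \<Psi>)"
    using mlin_ins[OF colin_rcomul, of t "Suc k" \<Psi>] t by simp
  have "lext t \<Psi> (rep (rcomul_iter V (Suc (Suc k)) v)) =
      lext t (ins t (rcomul V) \<Psi>) (rep (rcomul_iter V (Suc k) v))"
    unfolding rcomul_iter.simps(2)[of V "Suc k"] by (rule lext_slot_map_0[OF \<Psi> t])
  also have "\<dots> = lext t (\<lambda>xs. lext t (\<lambda>ws. ins t (rcomul V) \<Psi> (ws @ [xs ! 1]))
      (rep (rcomul_iter V k (xs ! 0)))) (rep (rcomul V v))"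
    by (rule Suc.IH[OF ins])
  also have "\<dots> = lext t (\<lambda>xs. lext t (\<lambda>ws. \<Psi> (ws @ [xs ! 1]))
      (rep (rcomul_iter V (Suc k) (xs ! 0)))) (rep (rcomul V v))"
  proof (rule lext_cong)
    fix xs assume "xs \<in> Poly_Mapping.keys (rep (rcomul V v))"
    have "mlin (smul V) t (k + 2) (\<lambda>ws. \<Psi> (ws @ [xs ! 1]))"
      by (rule mlin_append) (use \<Psi> in simp)
    from lext_slot_map_0[OF this t]
    have "lext t (\<lambda>ws. \<Psi> (ws @ [xs ! 1])) (rep (rcomul_iter V (Suc k) (xs ! 0))) =
        lext t (ins t (rcomul V) (\<lambda>ws. \<Psi> (ws @ [xs ! 1]))) (rep (rcomul_iter V k (xs ! 0)))"
      by simp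
    also have "\<dots> = lext t (\<lambda>ws. ins t (rcomul V) \<Psi> (ws @ [xs ! 1])) (rep (rcomul_iter V k (xs ! 0)))"
    proof (rule lext_cong)
      fix ws assume "ws \<in> Poly_Mapping.keys (rep (rcomul_iter V k (xs ! 0)))"
      then have "length ws = Suc k" by (rule tpow_rep(3)[OF rcomul_iter_tpow])
      then show "ins t (rcomul V) (\<lambda>ws. \<Psi> (ws @ [xs ! 1])) ws = ins t (rcomul V) \<Psi> (ws @ [xs ! 1])"
        by (simp add: ins_def nth_append)
    qed
    finally show "lext t (\<lambda>ws. ins t (rcomul V) \<Psi> (ws @ [xs ! 1])) (rep (rcomul_iter V k (xs ! 0))) =
        lext t (\<lambda>ws. \<Psi> (ws @ [xs ! 1])) (rep (rcomul_iter V (Suc k) (xs ! 0)))" by simp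
  qed
  finally show ?case .
qed

end

locale conv_alg = mv_alg R V + target_algebra t m
  for R :: "('k::field_char_0, 'r::comm_ring_1) coeff" and V :: "('k, 'r, 'v::ab_group_add) mv"
    and t :: "'k \<Rightarrow> 'a::ab_group_add \<Rightarrow> 'a" and m
begin

definition star :: "('v \<Rightarrow> 'a) \<Rightarrow> ('v \<Rightarrow> 'a) \<Rightarrow> 'v \<Rightarrow> 'a" where
  "star \<alpha> \<beta> v = lext t (\<lambda>xs. m (\<alpha> (xs ! 0)) (\<beta> (xs ! 1))) (rep (comul V v))"

lemma mlin_m:
  assumes "lin (smul V) t \<alpha>" "lin (smul V) t \<beta>"
  shows "mlin (smul V) t 2 (\<lambda>xs. m (\<alpha> (xs ! 0)) (\<beta> (xs ! 1)))"
  by (rule mlin_2I)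
    (simp_all add: lin_comp[OF assms(1) lin_m_left] lin_comp[OF assms(2) lin_m_right])

lemma lin_star:
  assumes "lin (smul V) t \<alpha>" "lin (smul V) t \<beta>"
  shows "lin (smul V) t (star \<alpha> \<beta>)"
  unfolding star_def by (rule lin_lext_colin[OF colin_comul mlin_m[OF assms] vs_t])

lemma star_eq:
  assumes "lin (smul V) t \<alpha>" "lin (smul V) t \<beta>" "p \<in> comul V v"
  shows "star \<alpha> \<beta> v = lext t (\<lambda>xs. m (\<alpha> (xs ! 0)) (\<beta> (xs ! 1))) p"
  unfolding star_def by (rule lext_rep_tpow[OF mlin_m[OF assms(1,2)] vs_t comul_tpow assms(3)])

lemma star_unit:
  assumes "lin (smul V) t \<alpha>" "lin (smul V) t \<beta>"
  shows "star \<alpha> \<beta> (unit V) = m (\<alpha> (unit V)) (\<beta> (unit V))"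
  by (subst star_eq[OF assms, of "gen [unit V, unit V]"])
    (simp_all add: comul_unit quo_refl vs_t)

text \<open>Both sides are the trilinear function \<open>\<alpha> \<cdot> \<beta> \<cdot> \<gamma>\<close> evaluated on an iterated coproduct; coassociativity
  says that the two iterated coproducts agree.\<close>

lemma star_assoc:
  assumes \<alpha>: "lin (smul V) t \<alpha>" and \<beta>: "lin (smul V) t \<beta>" and \<gamma>: "lin (smul V) t \<gamma>"
  shows "star (star \<alpha> \<beta>) \<gamma> v = star \<alpha> (star \<beta> \<gamma>) v"
proof -
  let ?\<Psi> = "\<lambda>xs. m (m (\<alpha> (xs ! 0)) (\<beta> (xs ! 1))) (\<gamma> (xs ! 2))"
  have \<Psi>: "mlin (smul V) t 3 ?\<Psi>"
    by (rule mlin_3I)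
      (simp_all add: lin_comp[OF \<gamma> lin_m_right] lin_comp[OF lin_comp[OF \<alpha> lin_m_left] lin_m_left]
        lin_comp[OF lin_comp[OF \<beta> lin_m_right] lin_m_left])
  note len = length_colin[OF colin_comul]
  have "star (star \<alpha> \<beta>) \<gamma> v = lext t ?\<Psi> (rep (slot_map (smul V) 3 (comul V) 0 (comul V v)))"
    unfolding lext_slot_map[OF \<Psi> vs_t] star_def lin_lext_comp[OF lin_m_left]
  proof (intro lext_cong)
    fix zs ws assume "zs \<in> Poly_Mapping.keys (rep (comul V v))"
      "ws \<in> Poly_Mapping.keys (rep (comul V (zs ! 0)))"
    then have "length zs = 2" "length ws = 2" by (auto dest: len)
    then show "m (m (\<alpha> (ws ! 0)) (\<beta> (ws ! 1))) (\<gamma> (zs ! 1)) = ?\<Psi> (take 0 zs @ ws @ drop (Suc 0) zs)"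
      by (simp add: nth_append)
  qed
  also have "\<dots> = lext t ?\<Psi> (rep (slot_map (smul V) 3 (comul V) 1 (comul V v)))"
    unfolding coassoc ..
  also have "\<dots> = star \<alpha> (star \<beta> \<gamma>) v"
    unfolding lext_slot_map[OF \<Psi> vs_t] star_def lin_lext_comp[OF lin_m_right]
  proof (intro lext_cong)
    fix zs ws assume "zs \<in> Poly_Mapping.keys (rep (comul V v))"
      "ws \<in> Poly_Mapping.keys (rep (comul V (zs ! 1)))"
    then have "length zs = 2" "length ws = 2" by (auto dest: len)
    then show "?\<Psi> (take 1 zs @ ws @ drop (Suc 1) zs) = m (\<alpha> (zs ! 0)) (m (\<beta> (ws ! 0)) (\<gamma> (ws ! 1)))"
      by (simp add: nth_append m_assoc)
  qed
  finally show ?thesis .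
qed

lemma star_counit_left:
  assumes "lin (smul V) t \<beta>" "\<And>v. m e (\<beta> v) = \<beta> v"
  shows "star (\<lambda>v. t (counit V v) e) \<beta> v = \<beta> v"
proof -
  have "star (\<lambda>v. t (counit V v) e) \<beta> v =
      lext t (\<lambda>xs. \<beta> (smul V (counit V (xs ! 0)) (xs ! 1))) (rep (comul V v))"
    by (simp add: star_def lin_scale[OF lin_m_left] assms(2) lin_scale[OF assms(1)])
  also have "\<dots> = \<beta> v"
    unfolding lin_lext_comp[OF assms(1), symmetric] counit_left[OF rep_comul] ..
  finally show ?thesis .
qed

lemma star_counit_right:
  assumes "lin (smul V) t \<beta>" "\<And>v. m (\<beta> v) e = \<beta> v"
  shows "star \<beta> (\<lambda>v. t (counit V v) e) v = \<beta> v"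
proof -
  have "star \<beta> (\<lambda>v. t (counit V v) e) v =
      lext t (\<lambda>xs. \<beta> (smul V (counit V (xs ! 1)) (xs ! 0))) (rep (comul V v))"
    by (simp add: star_def lin_scale[OF lin_m_right] assms(2) lin_scale[OF assms(1)])
  also have "\<dots> = \<beta> v"
    unfolding lin_lext_comp[OF assms(1), symmetric] counit_right[OF rep_comul] ..
  finally show ?thesis .
qed

text \<open>Substitute \<open>\<delta>(w) = \<delta>\<^sub>r(w) + w \<otimes> 1 + 1 \<otimes> w\<close>, where \<open>\<delta>\<^sub>r\<close> is the reduced coproduct and \<open>w\<close> the part
  of \<open>v\<close> in the kernel of the counit.\<close>

lemma star_reduced:
  assumes \<alpha>: "lin (smul V) t \<alpha>" and \<beta>: "lin (smul V) t \<beta>"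
  shows "star \<alpha> \<beta> v = lext t (\<lambda>xs. m (\<alpha> (xs ! 0)) (\<beta> (xs ! 1))) (rep (rcomul V v)) +
    m (\<alpha> v) (\<beta> (unit V)) + m (\<alpha> (unit V)) (\<beta> (coaug v))"
proof -
  let ?M = "\<lambda>xs. m (\<alpha> (xs ! 0)) (\<beta> (xs ! 1))"
  have "lext t ?M (rep (rcomul V v)) = lext t ?M
      (rep (comul V (coaug v)) - gen [coaug v, unit V] - gen [unit V, coaug v])"
    by (rule lext_rep_tpow[OF mlin_m[OF \<alpha> \<beta>] vs_t rcomul_tpow]) (simp add: rcomul_eq quo_refl)
  also have "\<dots> = star \<alpha> \<beta> (coaug v) - m (\<alpha> (coaug v)) (\<beta> (unit V)) - m (\<alpha> (unit V)) (\<beta> (coaug v))"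
    by (simp add: lin_diff[OF lin_lext[OF vs_t]] star_def vs_t)
  finally have "star \<alpha> \<beta> (coaug v) = lext t ?M (rep (rcomul V v)) +
      m (\<alpha> (coaug v)) (\<beta> (unit V)) + m (\<alpha> (unit V)) (\<beta> (coaug v))"
    by (simp add: algebra_simps)
  moreover have "star \<alpha> \<beta> (coaug v) =
      star \<alpha> \<beta> v - t (counit V v) (m (\<alpha> (unit V)) (\<beta> (unit V)))"
    using lin_star[OF \<alpha> \<beta>] by (simp add: lin_diff lin_scale star_unit[OF \<alpha> \<beta>])
  moreover have "m (\<alpha> (coaug v)) (\<beta> (unit V)) =
      m (\<alpha> v) (\<beta> (unit V)) - t (counit V v) (m (\<alpha> (unit V)) (\<beta> (unit V)))"
    by (simp add: lin_diff[OF \<alpha>] lin_scale[OF \<alpha>] lin_diff[OF lin_m_left] lin_scale[OF lin_m_left])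
  ultimately show ?thesis by (simp add: algebra_simps)
qed

end

text \<open>Convergence of the convolution exponential of \<open>\<phi>\<close>. If \<open>\<phi>\<close> vanished at 1, then its \<open>d\<close>-th power would
  factor through the \<open>(d-1)\<close>-th iterate of the reduced coproduct and vanish at \<open>v\<close> for large \<open>d\<close>. In
  general \<open>\<phi> 1\<close> is only small, and a factor 1 in the iterated coproduct of \<open>v\<close> contributes one step of
  the filtration instead: as soon as \<open>d\<close> exceeds the number \<open>K\<close> of factors that the reduced
  coproduct allows, the power lies in step \<open>d - K\<close>.\<close>

locale filtered_conv_alg = conv_alg R V t m
  for R :: "('k::field_char_0, 'r::comm_ring_1) coeff" and V :: "('k, 'r, 'v::ab_group_add) mv"
    and t :: "'k \<Rightarrow> 'a::ab_group_add \<Rightarrow> 'a" and m +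
  fixes F :: "nat \<Rightarrow> 'a set"
  assumes subspace_F: "module.subspace t (F i)"
    and F_0: "F 0 = UNIV"
    and F_antimono: "i \<le> j \<Longrightarrow> F j \<subseteq> F i"
    and F_mult: "x \<in> F i \<Longrightarrow> y \<in> F j \<Longrightarrow> m x y \<in> F (i + j)"
begin

text \<open>The invariant of the induction on \<open>d\<close>: modulo step \<open>d - K\<close> of the filtration, \<open>\<alpha>\<close> factors through
  the \<open>K\<close>-th iterate of the reduced coproduct, for all \<open>K\<close> at once.\<close>

definition good :: "nat \<Rightarrow> ('v \<Rightarrow> 'a) \<Rightarrow> bool" where
  "good d \<alpha> \<longleftrightarrow> lin (smul V) t \<alpha> \<and> \<alpha> (unit V) \<in> F d \<and>
     (\<forall>K. \<exists>\<Phi>. mlin (smul V) t (Suc K) \<Phi> \<and>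
       (\<forall>v. \<alpha> v - lext t \<Phi> (rep (rcomul_iter V K v)) \<in> F (d - K)))"

lemma good_0: "lin (smul V) t \<alpha> \<Longrightarrow> good 0 \<alpha>"
  unfolding good_def using lin_const_zero[OF vs vs_t]
  by (auto simp: F_0 mlin_def intro!: exI[of _ "\<lambda>_. 0"])

text \<open>By \<open>star_reduced\<close> the product is \<open>\<alpha>(v) \<phi>(1)\<close>, which gains a step of the filtration from \<open>\<phi>(1)\<close>, plus
  \<open>\<alpha>(1) \<phi>(w)\<close>, which lies in step \<open>d\<close>, plus the value of \<open>\<alpha> \<cdot> \<phi>\<close> on the reduced coproduct, which uses
  up one more iterate.\<close>

lemma good_star:
  assumes \<alpha>: "good d \<alpha>" and \<phi>: "lin (smul V) t \<phi>" "\<phi> (unit V) \<in> F 1"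
  shows "good (Suc d) (star \<alpha> \<phi>)"
proof -
  interpret t: vector_space t by (rule vs_t)
  note sub = subspace_F
  have lin_\<alpha>: "lin (smul V) t \<alpha>" and \<alpha>1: "\<alpha> (unit V) \<in> F d"
    and \<alpha>_ex: "\<exists>\<Phi>. mlin (smul V) t (Suc K) \<Phi> \<and>
      (\<forall>v. \<alpha> v - lext t \<Phi> (rep (rcomul_iter V K v)) \<in> F (d - K))" for K
    using \<alpha> by (auto simp: good_def)
  have F_le: "x \<in> F i \<Longrightarrow> j \<le> i \<Longrightarrow> x \<in> F j" for x i j
    using F_antimono by blast
  have F_ideal: "x \<in> F i \<Longrightarrow> m x y \<in> F i" for x y i
    using F_mult[of x i y 0] by (simp add: F_0)
  let ?a = "\<phi> (unit V)"
  have "\<exists>\<Phi>. mlin (smul V) t (Suc K) \<Phi> \<and>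
      (\<forall>v. star \<alpha> \<phi> v - lext t \<Phi> (rep (rcomul_iter V K v)) \<in> F (Suc d - K))" for K
  proof (cases K)
    case 0
    let ?\<Phi> = "\<lambda>xs. star \<alpha> \<phi> (xs ! 0)"
    have \<Phi>: "mlin (smul V) t (Suc 0) ?\<Phi>"
      using lin_star[OF lin_\<alpha> \<phi>(1)] by (simp add: mlin_def)
    have "lext t ?\<Phi> (rep (rcomul_iter V 0 v)) = star \<alpha> \<phi> v" for v
      using lext_rep_tpow[OF \<Phi> vs_t rcomul_iter_tpow, of "gen [v]" v] by (simp add: quo_refl vs_t)
    then show ?thesis
      using \<Phi> 0 t.subspace_0[OF sub] by auto
  next
    case (Suc k)
    obtain \<Phi>1 where \<Phi>1: "mlin (smul V) t (Suc (Suc k)) \<Phi>1"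
      "\<And>v. \<alpha> v - lext t \<Phi>1 (rep (rcomul_iter V (Suc k) v)) \<in> F (d - Suc k)"
      using \<alpha>_ex[of "Suc k"] by blast
    obtain \<Phi>0 where \<Phi>0: "mlin (smul V) t (Suc k) \<Phi>0"
      "\<And>v. \<alpha> v - lext t \<Phi>0 (rep (rcomul_iter V k v)) \<in> F (d - k)"
      using \<alpha>_ex[of k] by blast
    \<comment> \<open>\<open>\<Phi>1\<close> serves the term \<open>\<alpha>(v) \<phi>(1)\<close>, \<open>\<Phi>0\<close> the term that passes through the reduced coproduct\<close>
    let ?G = "\<lambda>ws. m (\<Phi>0 (butlast ws)) (\<phi> (last ws))"
    let ?H = "\<lambda>ws. m (\<Phi>1 ws) ?a + ?G ws"
    have ml0: "mlin (smul V) t (Suc (Suc k)) ?G"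
      unfolding mlin_def
    proof (intro allI impI)
      fix xs ys :: "'v list" assume len: "length xs + length ys + 1 = Suc (Suc k)"
      show "lin (smul V) t (\<lambda>x. ?G (xs @ x # ys))"
      proof (cases ys rule: rev_cases)
        case Nil
        then show ?thesis
          by (simp add: butlast_append lin_comp[OF \<phi>(1) lin_m_right])
      next
        case (snoc zs z)
        then have "lin (smul V) t (\<lambda>x. \<Phi>0 (xs @ x # zs))"
          using \<Phi>0(1) len by (simp add: mlin_def)
        from lin_comp[OF this lin_m_left] show ?thesis
          using snoc by (simp add: butlast_append)
      qed
    qed
    have ml: "mlin (smul V) t (Suc (Suc k)) ?H"
      using \<Phi>1(1) ml0 lin_comp[OF _ lin_m_left]
      unfolding mlin_def by (intro allI impI lin_plus) blast+
    have "star \<alpha> \<phi> v - lext t ?H (rep (rcomul_iter V (Suc k) v)) \<in> F (d - k)" for v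
    proof -
      let ?T = "rep (rcomul_iter V (Suc k) v)"
      let ?I = "\<lambda>x. lext t \<Phi>0 (rep (rcomul_iter V k x))"
      have "lext t ?H ?T = m (lext t \<Phi>1 ?T) ?a + lext t ?G ?T"
        by (simp only: lin_lext_comp[OF lin_m_left] lext_add_fun[OF vs_t])
      also have "lext t ?G ?T = lext t (\<lambda>xs. m (?I (xs ! 0)) (\<phi> (xs ! 1))) (rep (rcomul V v))"
        using lext_rcomul_iter_Suc[OF vs_t, of k ?G v] ml0
        by (simp add: lin_lext_comp[OF lin_m_left])
      finally have eq: "lext t ?H ?T = m (lext t \<Phi>1 ?T) ?a +
          lext t (\<lambda>xs. m (?I (xs ! 0)) (\<phi> (xs ! 1))) (rep (rcomul V v))" .
      have "star \<alpha> \<phi> v - lext t ?H ?T = m (\<alpha> v - lext t \<Phi>1 ?T) ?a + m (\<alpha> (unit V)) (\<phi> (coaug v)) +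
          lext t (\<lambda>xs. m (\<alpha> (xs ! 0) - ?I (xs ! 0)) (\<phi> (xs ! 1))) (rep (rcomul V v))"
        unfolding eq star_reduced[OF lin_\<alpha> \<phi>(1)] lin_diff[OF lin_m_left]
        by (simp add: lin_diff[OF lin_m_left] lext_diff_fun[OF vs_t])
      moreover have "m (\<alpha> v - lext t \<Phi>1 ?T) ?a \<in> F (d - k)"
        by (rule F_le[OF F_mult[OF \<Phi>1(2) \<phi>(2)]]) simp
      moreover have "m (\<alpha> (unit V)) (\<phi> (coaug v)) \<in> F (d - k)"
        by (rule F_le[OF F_ideal[OF \<alpha>1]]) simp
      moreover have "lext t (\<lambda>xs. m (\<alpha> (xs ! 0) - ?I (xs ! 0)) (\<phi> (xs ! 1))) (rep (rcomul V v)) \<in> F (d - k)"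
        by (intro lext_mem_subspace vs_t sub F_ideal \<Phi>0(2))
      ultimately show ?thesis
        by (simp add: t.subspace_add[OF sub])
    qed
    then show ?thesis
      using ml Suc by auto
  qed
  moreover have "star \<alpha> \<phi> (unit V) \<in> F (Suc d)"
    unfolding star_unit[OF lin_\<alpha> \<phi>(1)] using F_mult[OF \<alpha>1 \<phi>(2)] by simp
  ultimately show ?thesis
    unfolding good_def using lin_star[OF lin_\<alpha> \<phi>(1)] by blast
qed

text \<open>Take for \<open>K\<close> an iterate of the reduced coproduct that vanishes at \<open>v\<close>.\<close>

lemma good_conilpotent:
  "\<exists>K. \<forall>d \<alpha>. good d \<alpha> \<longrightarrow> \<alpha> v \<in> F (d - K)"
proof -
  obtain K where K: "\<And>k. k \<ge> K \<Longrightarrow> rcomul_iter V k v = quo (mrel (smul V) (k + 1)) 0"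
    using mv unfolding mv_algebra_def conilpotent_def by blast
  have "\<alpha> v \<in> F (d - K)" if good: "good d \<alpha>" for d \<alpha>
  proof -
    obtain \<Phi> where \<Phi>: "mlin (smul V) t (Suc K) \<Phi>"
      "\<alpha> v - lext t \<Phi> (rep (rcomul_iter V K v)) \<in> F (d - K)"
      using good by (auto simp: good_def)
    have "lext t \<Phi> (rep (rcomul_iter V K v)) = lext t \<Phi> 0"
      by (rule lext_rep_tpow[OF \<Phi>(1) vs_t rcomul_iter_tpow]) (simp add: K quo_refl)
    then show ?thesis using \<Phi>(2) by simp
  qed
  then show ?thesis by blast
qed

end

section \<open>The exponential of a linear map for the convolution product\<close>

lemma (in local_base) lv_cscale_emb: "lv R s n (cscale R s (emb R c) x) = fscale c (lv R s n x)"
  using nft_rsc_emb[of R s n c 1 "lv R s n x"] by (simp add: lv_cscale)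

locale mv_pair = V: mv_alg R V + W: mv_alg R W
  for R :: "('k::field_char_0, 'r::comm_ring_1) coeff"
    and V :: "('k, 'r, 'v::ab_group_add) mv" and W :: "('k, 'r, 'w::ab_group_add) mv"
begin

text \<open>The product of \<open>W\<close> on normal forms at level \<open>n\<close>, and the map \<open>v \<mapsto> f(v)\<close> at level \<open>n\<close>.\<close>

abbreviation lm where "lm n \<equiv> (\<lambda>x y. nft R (smul W) n (W.mul x y))"

abbreviation ev :: "(('k, 'r, 'v) ct \<Rightarrow> ('k, 'r, 'w) ct) \<Rightarrow> nat \<Rightarrow> 'v \<Rightarrow> 'w \<times> 'r \<Rightarrow>\<^sub>0 'k" where
  "ev f n \<equiv> (\<lambda>v. lv R (smul W) n (f (incl R (smul V) v)))"

abbreviation klin_map :: "(('k, 'r, 'v) ct \<Rightarrow> ('k, 'r, 'w) ct) \<Rightarrow> bool" where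
  "klin_map f \<equiv> klin R (smul V) (smul W) (\<lambda>v. f (incl R (smul V) v))"

abbreviation st where "st n \<equiv> conv_alg.star V fscale (lm n)"

lemma level_algebra: "filtered_conv_alg R V fscale (lm n) (trel R (smul W))"
proof (intro filtered_conv_alg.intro conv_alg.intro target_algebra.intro
    filtered_conv_alg_axioms.intro V.mv_alg_axioms)
  fix x y z
  show "lin fscale fscale (\<lambda>x. lm n x y)" by (rule lin_comp[OF lin_fmul_left lin_nft])
  show "lin fscale fscale (lm n x)" by (rule lin_comp[OF lin_fmul_right lin_nft])
  show "lm n (lm n x y) z = lm n x (lm n y z)" by (simp add: W.mul_assoc)
next
  fix x y i j assume "x \<in> trel R (smul W) i" "y \<in> trel R (smul W) j"
  then have xy: "W.mul x y \<in> trel R (smul W) (i + j)" by (rule W.mul_trel)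
  show "lm n x y \<in> trel R (smul W) (i + j)"
  proof (cases "i + j \<le> n")
    case True
    then have "W.mul x y - lm n x y \<in> trel R (smul W) (i + j)"
      using diff_nf[OF subspace_trel] trel_antimono by blast
    from free.subspace_diff[OF subspace_trel xy this] show ?thesis by simp
  next
    case False
    then have "lm n x y = 0"
      using xy trel_antimono[of n "i + j" R "smul W"] by (auto simp: nf_eq_0)
    then show ?thesis using free.subspace_0[OF subspace_trel] by simp
  qed
qed (simp_all add: trel_0 trel_antimono)

lemma conv_fun:
  assumes f: "klin_map f" and g: "klin_map g"
  defines "\<psi> \<equiv> \<lambda>v. clin R (smul W)
      (\<lambda>xs. cmult R W (f (incl R (smul V) (xs ! 0))) (g (incl R (smul V) (xs ! 1)))) (rep (comul V v))"
  shows lv_conv_fun: "lv R (smul W) n (\<psi> v) = st n (ev f n) (ev g n) v"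
    and klin_conv_fun: "klin R (smul V) (smul W) \<psi>"
proof -
  have lv: "lv R (smul W) n (\<psi> v) = st n (ev f n) (ev g n) v" for n v
  proof -
    interpret L: filtered_conv_alg R V fscale "lm n" "trel R (smul W)" by (rule level_algebra)
    show ?thesis unfolding \<psi>_def L.star_def lv_clin W.lv_cmult ..
  qed
  show "lv R (smul W) n (\<psi> v) = st n (ev f n) (ev g n) v" by (rule lv)
  show "klin R (smul V) (smul W) \<psi>"
    unfolding klin_def
  proof (intro conjI allI)
    fix v show "\<psi> v \<in> carr R W"
      unfolding \<psi>_def by (intro clin_ctens W.cmult_carr klinD(1)[OF f] klinD(1)[OF g])
  next
    fix n
    interpret L: filtered_conv_alg R V fscale "lm n" "trel R (smul W)" by (rule level_algebra)
    show "lin (smul V) fscale (\<lambda>v. lv R (smul W) n (\<psi> v))"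
      unfolding lv by (rule L.lin_star[OF klinD(2)[OF f] klinD(2)[OF g]])
  qed
qed

lemma
  assumes f: "klin_map f" and g: "klin_map g"
  shows ev_conv: "ev (conv R V W f g) n v = st n (ev f n) (ev g n) v"
    and klin_conv: "klin_map (conv R V W f g)"
    and conv_eq_cext: "z \<in> carr R V \<Longrightarrow> conv R V W f g z =
      cext R (smul W) (\<lambda>v. conv R V W f g (incl R (smul V) v)) z"
proof -
  have 1: "conv R V W f g (incl R (smul V) v) = clin R (smul W)
      (\<lambda>xs. cmult R W (f (incl R (smul V) (xs ! 0))) (g (incl R (smul V) (xs ! 1)))) (rep (comul V v))" for v
    unfolding conv_def using cext_incl[OF klin_conv_fun[OF f g]] by simp
  show "ev (conv R V W f g) n v = st n (ev f n) (ev g n) v"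
    unfolding 1 lv_conv_fun[OF f g] ..
  show "klin_map (conv R V W f g)"
    unfolding 1 by (rule klin_conv_fun[OF f g])
  show "conv R V W f g z = cext R (smul W) (\<lambda>v. conv R V W f g (incl R (smul V) v)) z"
    if "z \<in> carr R V"
    unfolding 1 using that by (simp add: conv_def)
qed

lemma klin_conv_unit_fun:
  "klin R (smul V) (smul W) (\<lambda>v. incl R (smul W) (smul W (counit V v) (unit W)))"
proof -
  interpret W: vector_space "smul W" by (rule W.vs)
  have "lin (smul V) (smul W) (\<lambda>v. smul W (counit V v) (unit W))"
    by (rule linI[OF V.vs W.vs]) (simp_all add: V.counit_add V.counit_scale W.scale_left_distrib)
  then show ?thesis
    unfolding klin_def by (simp add: lin_comp[OF _ lin_lv_incl[OF W.vs]])
qed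

lemma
  shows conv_unit_incl: "conv_unit R V W (incl R (smul V) v) =
      incl R (smul W) (smul W (counit V v) (unit W))"
    and ev_conv_unit: "ev (conv_unit R V W) n v = fscale (counit V v) (nft R (smul W) n W.one)"
    and klin_conv_unit: "klin_map (conv_unit R V W)"
    and conv_unit_eq_cext: "z \<in> carr R V \<Longrightarrow> conv_unit R V W z =
      cext R (smul W) (\<lambda>v. conv_unit R V W (incl R (smul V) v)) z"
proof -
  show 1: "conv_unit R V W (incl R (smul V) v) =
      incl R (smul W) (smul W (counit V v) (unit W))" for v
    unfolding conv_unit_def using cext_incl[OF klin_conv_unit_fun] by simp
  show "ev (conv_unit R V W) n v = fscale (counit V v) (nft R (smul W) n W.one)"
    unfolding 1 lv_incl nft_gen_scale ..
  show "klin_map (conv_unit R V W)"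
    unfolding 1 by (rule klin_conv_unit_fun)
  show "conv_unit R V W z = cext R (smul W) (\<lambda>v. conv_unit R V W (incl R (smul V) v)) z"
    if "z \<in> carr R V"
    unfolding 1 using that by (simp add: conv_unit_def)
qed

lemma klin_conv_pow: "klin_map f \<Longrightarrow> klin_map (conv_pow R V W f j)"
  by (induction j) (simp_all add: klin_conv_unit klin_conv)

lemma conv_pow_eq_cext:
  "klin_map f \<Longrightarrow> z \<in> carr R V \<Longrightarrow> conv_pow R V W f j z =
    cext R (smul W) (\<lambda>v. conv_pow R V W f j (incl R (smul V) v)) z"
proof (cases j)
  case 0
  assume "z \<in> carr R V"
  then show ?thesis
    unfolding 0 conv_pow.simps by (rule conv_unit_eq_cext)
next
  case (Suc i)
  assume "klin_map f" "z \<in> carr R V"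
  then show ?thesis
    unfolding Suc conv_pow.simps by (intro conv_eq_cext klin_conv_pow)
qed

lemma conv_pow_carr: "klin_map f \<Longrightarrow> z \<in> carr R V \<Longrightarrow> conv_pow R V W f j z \<in> carr R W"
  by (subst conv_pow_eq_cext) (auto intro: cext_ctens[OF klin_conv_pow])

lemma conv_pow_cscale:
  assumes f: "klin_map f" and z: "z \<in> carr R V"
  shows "conv_pow R V W f j (cscale R (smul V) r z) = cscale R (smul W) r (conv_pow R V W f j z)"
  using cext_cscale[OF klin_conv_pow[OF f] z]
  by (simp only: conv_pow_eq_cext[OF f z, symmetric] conv_pow_eq_cext[OF f cscale_ctens[OF z], symmetric])

text \<open>The powers are defined by multiplication from the left. Coassociativity allows to multiply
  from the right instead, as the definition of conilpotency requires.\<close>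

lemma ev_conv_pow_Suc:
  assumes f: "klin_map f"
  shows "ev (conv_pow R V W f (Suc j)) n = st n (ev (conv_pow R V W f j) n) (ev f n)"
proof (induction j)
  interpret L: filtered_conv_alg R V fscale "lm n" "trel R (smul W)" by (rule level_algebra)
  let ?e = "nft R (smul W) n W.one"
  note lin_f = klinD(2)[OF f, of n] and lin_pow = klinD(2)[OF klin_conv_pow[OF f], of n]
  have e: "lm n ?e (ev f n v) = ev f n v" "lm n (ev f n v) ?e = ev f n v" for v
    by simp_all
  case 0
  have *: "ev (conv_unit R V W) n = (\<lambda>v. fscale (counit V v) ?e)"
    by (rule ext) (rule ev_conv_unit)
  have "st n (ev f n) (ev (conv_unit R V W) n) v = st n (ev (conv_unit R V W) n) (ev f n) v" for v
    unfolding * L.star_counit_right[of "ev f n", OF lin_f e(2)]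
      L.star_counit_left[of "ev f n", OF lin_f e(1)] ..
  then show ?case
    by (simp add: ev_conv[OF f klin_conv_unit] fun_eq_iff)
next
  interpret L: filtered_conv_alg R V fscale "lm n" "trel R (smul W)" by (rule level_algebra)
  note lin_f = klinD(2)[OF f, of n] and lin_pow = klinD(2)[OF klin_conv_pow[OF f], of n]
  case (Suc j)
  have "ev (conv_pow R V W f (Suc (Suc j))) n = st n (ev f n) (ev (conv_pow R V W f (Suc j)) n)"
    by (simp only: conv_pow.simps(2)[of R V W f "Suc j"] ev_conv[OF f klin_conv_pow[OF f]])
  also have "\<dots> = st n (ev f n) (st n (ev (conv_pow R V W f j) n) (ev f n))"
    unfolding Suc ..
  also have "\<dots> = st n (st n (ev f n) (ev (conv_pow R V W f j) n)) (ev f n)"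
    by (rule ext) (rule L.star_assoc[OF lin_f lin_pow lin_f, symmetric])
  also have "st n (ev f n) (ev (conv_pow R V W f j) n) = ev (conv_pow R V W f (Suc j)) n"
    by (simp only: conv_pow.simps(2) ev_conv[OF f klin_conv_pow[OF f]])
  finally show ?case .
qed

lemma ev_conv_pow_eventually_0:
  assumes f: "klin_map f" and f1: "lv R (smul W) (Suc 0) (f (cunit R V)) = 0"
  shows "\<exists>J. \<forall>j\<ge>J. ev (conv_pow R V W f j) n v = 0"
proof -
  interpret L: filtered_conv_alg R V fscale "lm n" "trel R (smul W)" by (rule level_algebra)
  have "f (cunit R V) \<in> carr R W"
    using klinD(1)[OF f] by (simp add: cunit_def)
  then have "ev f n (unit V) \<in> trel R (smul W) 1"
    using lv_trel[OF _ f1, of n] by (simp add: cunit_def)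
  then have good: "L.good j (ev (conv_pow R V W f j) n)" for j
  proof (induction j)
    case 0
    show ?case using klinD(2)[OF klin_conv_pow[OF f]] by (rule L.good_0)
  next
    case (Suc j)
    then show ?case
      unfolding ev_conv_pow_Suc[OF f] by (intro L.good_star klinD(2)[OF f])
  qed
  obtain K where K: "\<And>j. ev (conv_pow R V W f j) n v \<in> trel R (smul W) (j - K)"
    using L.good_conilpotent[of v] good by blast
  have "ev (conv_pow R V W f j) n v = 0" if "j \<ge> K + n" for j
  proof -
    have "n \<le> j - K" using that by simp
    from subsetD[OF trel_antimono[OF this] K]
    have "nft R (smul W) n (ev (conv_pow R V W f j) n v) = 0"
      by (simp only: nf_eq_0[OF subspace_trel])
    then show ?thesis by simp
  qed
  then show ?thesis by blast
qed

text \<open>As \<open>\<delta>(1) = 1 \<otimes> 1\<close>, convolution is multiplication of values at 1.\<close>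

lemma conv_pow_cunit:
  assumes f: "klin_map f"
  shows "conv_pow R V W f j (cunit R V) = cpow R W (f (cunit R V)) j"
proof (induction j)
  case 0
  interpret W: vector_space "smul W" by (rule W.vs)
  show ?case
    using conv_unit_incl[of "unit V"] by (simp add: cunit_def V.counit_unit)
next
  case (Suc j)
  let ?g = "conv_pow R V W f j"
  have g: "klin_map ?g" by (rule klin_conv_pow[OF f])
  have fc: "f (cunit R V) \<in> carr R W" using klinD(1)[OF f] by (simp add: cunit_def)
  have "conv R V W f ?g (cunit R V) = cmult R W (f (cunit R V)) (?g (cunit R V))"
  proof (rule ctens_eqI)
    show "conv R V W f ?g (cunit R V) \<in> carr R W"
      using conv_pow_carr[OF f, of "cunit R V" "Suc j"] by simp
    show "cmult R W (f (cunit R V)) (?g (cunit R V)) \<in> carr R W"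
      by (intro W.cmult_carr fc conv_pow_carr f V.cunit_carr)
    fix n
    interpret L: filtered_conv_alg R V fscale "lm n" "trel R (smul W)" by (rule level_algebra)
    have "ev (conv R V W f ?g) n (unit V) = lm n (ev f n (unit V)) (ev ?g n (unit V))"
      unfolding ev_conv[OF f g] by (rule L.star_unit[OF klinD(2)[OF f] klinD(2)[OF g]])
    then show "lv R (smul W) n (conv R V W f ?g (cunit R V)) =
        lv R (smul W) n (cmult R W (f (cunit R V)) (?g (cunit R V)))"
      by (simp add: cunit_def W.lv_cmult)
  qed
  then show ?case using Suc by simp
qed

lemma conv_pow_chom:
  assumes f: "klin_map f" "\<And>i v. v \<in> hom V i \<Longrightarrow> f (incl R (smul V) v) \<in> chom R W i"
  shows "v \<in> hom V i \<Longrightarrow> conv_pow R V W f j (incl R (smul V) v) \<in> chom R W i"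
proof (induction j arbitrary: v i)
  case 0
  show ?case
  proof (cases "i = 0")
    case True
    then show ?thesis
      unfolding chom_iff conv_pow.simps ev_conv_unit
      using klinD(1)[OF klin_conv_unit]
      by (auto intro!: free.subspace_scale nft_hsub gen_hsub W.unit_hom)
  next
    case False
    then show ?thesis
      unfolding chom_iff conv_pow.simps ev_conv_unit
      using klinD(1)[OF klin_conv_unit] V.counit_hom[OF 0]
      by (simp add: free.subspace_0)
  qed
next
  case (Suc j)
  let ?g = "conv_pow R V W f j"
  have g: "klin_map ?g" by (rule klin_conv_pow[OF f(1)])
  obtain p where p: "p \<in> comul V v" "\<And>xs. xs \<in> Poly_Mapping.keys p \<Longrightarrow>
      \<exists>a b. xs ! 0 \<in> hom V a \<and> xs ! 1 \<in> hom V b \<and> a + b = i"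
    using V.comul_hom[OF Suc.prems] by blast
  have "ev (conv R V W f ?g) n v \<in> hsub R W n i" for n
  proof -
    interpret L: filtered_conv_alg R V fscale "lm n" "trel R (smul W)" by (rule level_algebra)
    show ?thesis
      unfolding ev_conv[OF f(1) g] L.star_eq[OF klinD(2)[OF f(1)] klinD(2)[OF g] p(1)]
    proof (rule lext_mem_subspace[OF vs_free subspace_hsub])
      fix xs assume "xs \<in> Poly_Mapping.keys p"
      then obtain a b where "xs ! 0 \<in> hom V a" "xs ! 1 \<in> hom V b" "a + b = i"
        using p(2) by blast
      then show "lm n (ev f n (xs ! 0)) (ev ?g n (xs ! 1)) \<in> hsub R W n i"
        using W.mul_hsub[of "ev f n (xs ! 0)" n a "ev ?g n (xs ! 1)" b] f(2) Suc.IH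
        by (auto simp: chom_iff intro!: nft_hsub)
    qed
  qed
  then show ?case
    using klinD(1)[OF klin_conv[OF f(1) g]] by (simp add: chom_iff)
qed

lemma cext_chom:
  assumes \<phi>: "klin R (smul V) (smul W) \<phi>" "\<And>v. v \<in> hom V i \<Longrightarrow> \<phi> v \<in> chom R W i"
    and z: "z \<in> chom R V i"
  shows "cext R (smul W) \<phi> z \<in> chom R W i"
  unfolding chom_iff
proof (intro conjI allI)
  show "cext R (smul W) \<phi> z \<in> carr R W" by (rule cext_ctens[OF \<phi>(1) chom_carr[OF z]])
  fix n
  have "lv R (smul V) n z \<in> hsub R V n i" using z by (simp add: chom_iff)
  then show "lv R (smul W) n (cext R (smul W) \<phi> z) \<in> hsub R W n i"
    unfolding lv_cext[OF \<phi>(1)]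
  proof (rule lin_hsub[OF lin_lext[OF vs_free]])
    show "lext fscale (\<lambda>(v, r). nft R (smul W) n (rsc r (lv R (smul W) n (\<phi> v)))) (gen (v, r)) \<in> hsub R W n i"
      if "v \<in> hom V i" for v r
      using \<phi>(2)[OF that] by (simp add: vs_free chom_iff nft_hsub rsc_hsub)
    show "lext fscale (\<lambda>(v, r). nft R (smul W) n (rsc r (lv R (smul W) n (\<phi> v)))) q \<in> hsub R W n i"
      if "q \<in> trel R (smul V) n" for q
      by (simp add: cext_kill[OF \<phi>(1) that] free.subspace_0)
  qed simp
qed

text \<open>What is used of a map in \<open>Lin\<^sup>0\<close>; only the values on \<open>V\<close> itself matter.\<close>

definition small :: "(('k, 'r, 'v) ct \<Rightarrow> ('k, 'r, 'w) ct) \<Rightarrow> bool" where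
  "small f \<longleftrightarrow> klin_map f \<and> f (cunit R V) \<in> cmax R (smul W) \<and>
     (\<forall>i. \<forall>v\<in>hom V i. f (incl R (smul V) v) \<in> chom R W i)"

lemma incl_add: "incl R (smul V) (v + w) = cadd R (smul V) (incl R (smul V) v) (incl R (smul V) w)"
  by (rule ctens_eqI[of _ R "smul V"]) (simp_all add: lv_incl nft_gen_add_left)

lemma incl_scale: "incl R (smul V) (smul V c v) = cscale R (smul V) (emb R c) (incl R (smul V) v)"
  by (rule ctens_eqI[of _ R "smul V"]) (simp_all add: V.lv_cscale_emb lv_incl nft_gen_scale)

lemma klin_map_clinear:
  assumes "clinear R (smul V) (smul W) f"
  shows "klin_map f"
  unfolding klin_def
proof (intro conjI allI linI V.vs vs_free)
  show "f (incl R (smul V) v) \<in> carr R W" for v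
    using assms by (simp add: clinear_def)
  show "ev f n (v + w) = ev f n v + ev f n w" for n v w
    using assms by (simp add: clinear_def incl_add)
  show "ev f n (smul V c v) = fscale c (ev f n v)" for n c v
    using assms by (simp add: clinear_def incl_scale V.lv_cscale_emb)
qed

lemma small_Lin0:
  assumes "f \<in> Lin0 R V W"
  shows "small f"
proof -
  interpret V: vector_space "smul V" by (rule V.vs)
  have "f (incl R (smul V) (smul V 1 (unit V))) \<in> cmax R (smul W)"
    using assms unfolding Lin0_def by blast
  moreover have "f x \<in> chom R W i" if "x \<in> chom R V i" for x i
    using assms that by (auto simp: Lin0_def Lin_def has_degree_def)
  ultimately show ?thesis
    using assms klin_map_clinear[of f]
    by (simp add: small_def Lin0_def Lin_def incl_chom cunit_def)
qed

context
  fixes f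
  assumes f: "small f"
begin

lemma klin_f: "klin_map f"
  using f by (simp add: small_def)

lemma conv_pow_conv: "\<exists>J. \<forall>j\<ge>J. lv R (smul W) n (conv_pow R V W f j (incl R (smul V) v)) = 0"
  using f by (intro ev_conv_pow_eventually_0) (simp_all add: small_def W.cmax_iff')

definition exp_fun :: "'v \<Rightarrow> ('k, 'r, 'w) ct" where
  "exp_fun v = cseries R (smul W) exp_coeff (\<lambda>j. conv_pow R V W f j (incl R (smul V) v))"

lemma lv_exp_fun:
  assumes "\<forall>j\<ge>J. ev (conv_pow R V W f j) n v = 0"
  shows "lv R (smul W) n (exp_fun v) = (\<Sum>j<J. fscale (exp_coeff j) (ev (conv_pow R V W f j) n v))"
  unfolding exp_fun_def
  by (rule lv_cseries[OF conv_pow_carr[OF klin_f incl_ctens] conv_pow_conv assms])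

lemma klin_exp_fun: "klin R (smul V) (smul W) exp_fun"
  unfolding klin_def
proof (intro conjI allI linI V.vs vs_free)
  show "exp_fun v \<in> carr R W" for v
    unfolding exp_fun_def
    by (rule cseries_ctens[OF conv_pow_carr[OF klin_f incl_ctens] conv_pow_conv])
  note lin_pow = klinD(2)[OF klin_conv_pow[OF klin_f]]
  fix n
  show "lv R (smul W) n (exp_fun (v + w)) = lv R (smul W) n (exp_fun v) + lv R (smul W) n (exp_fun w)" for v w
  proof -
    obtain J1 J2 where "\<forall>j\<ge>J1. ev (conv_pow R V W f j) n v = 0"
      "\<forall>j\<ge>J2. ev (conv_pow R V W f j) n w = 0"
      using conv_pow_conv by meson
    then have v: "\<forall>j\<ge>max J1 J2. ev (conv_pow R V W f j) n v = 0"
      and w: "\<forall>j\<ge>max J1 J2. ev (conv_pow R V W f j) n w = 0"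
      by simp_all
    then have "\<forall>j\<ge>max J1 J2. ev (conv_pow R V W f j) n (v + w) = 0"
      by (simp add: lin_add[OF lin_pow])
    from lv_exp_fun[OF this] lv_exp_fun[OF v] lv_exp_fun[OF w] show ?thesis
      by (simp add: lin_add[OF lin_pow] free.scale_right_distrib sum.distrib)
  qed
  show "lv R (smul W) n (exp_fun (smul V c v)) = fscale c (lv R (smul W) n (exp_fun v))" for c v
  proof -
    obtain J where J: "\<forall>j\<ge>J. ev (conv_pow R V W f j) n v = 0"
      using conv_pow_conv by meson
    then have "\<forall>j\<ge>J. ev (conv_pow R V W f j) n (smul V c v) = 0"
      by (simp add: lin_scale[OF lin_pow])
    from lv_exp_fun[OF this] lv_exp_fun[OF J] show ?thesis
      by (simp add: lin_scale[OF lin_pow] free.scale_sum_right mult.commute)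
  qed
qed

text \<open>The exponential is the continuous \<open>R\<close>-linear extension of its restriction to \<open>V\<close>, from which its
  linearity, continuity and degree follow. The bound for convergence depends on the vector of
  \<open>V\<close>, but a level of \<open>z\<close> involves only finitely many of them.\<close>

lemma conv_exp_eq_cext:
  assumes z: "z \<in> carr R V"
  shows "conv_exp R V W f z = cext R (smul W) exp_fun z"
proof -
  let ?X = "\<lambda>j. conv_pow R V W f j z"
  let ?F = "\<lambda>n j (v, r). nft R (smul W) n (rsc r (ev (conv_pow R V W f j) n v))"
  have lvX: "lv R (smul W) n (?X j) = lext fscale (?F n j) (lv R (smul V) n z)" for n j
    by (subst conv_pow_eq_cext[OF klin_f z]) (rule lv_cext[OF klin_conv_pow[OF klin_f]])
  have J: "\<exists>J. \<forall>j\<ge>J. \<forall>b\<in>Poly_Mapping.keys (lv R (smul V) n z). ev (conv_pow R V W f j) n (fst b) = 0" for n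
  proof -
    obtain J where "\<And>v. \<forall>j\<ge>J v. ev (conv_pow R V W f j) n v = 0"
      using conv_pow_conv by metis
    then show ?thesis
      by (intro exI[of _ "Max (insert 0 ((\<lambda>b. J (fst b)) ` Poly_Mapping.keys (lv R (smul V) n z)))"]) auto
  qed
  have X0: "lv R (smul W) n (?X j) = 0"
    if "\<forall>b\<in>Poly_Mapping.keys (lv R (smul V) n z). ev (conv_pow R V W f j) n (fst b) = 0" for n j
    unfolding lvX lext_def
    by (rule sum.neutral) (use that in \<open>simp add: case_prod_unfold lin_zero[OF lin_rsc]\<close>)
  have conv: "\<exists>J. \<forall>j\<ge>J. lv R (smul W) n (?X j) = 0" for n
    using J[of n] X0 by blast
  note carr = conv_pow_carr[OF klin_f z]
  have "cseries R (smul W) exp_coeff ?X = cext R (smul W) exp_fun z"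
  proof (rule ctens_eqI)
    show "cseries R (smul W) exp_coeff ?X \<in> carr R W"
      by (rule cseries_ctens[OF carr conv])
    show "cext R (smul W) exp_fun z \<in> carr R W"
      by (rule cext_ctens[OF klin_exp_fun z])
    fix n
    obtain J where J: "\<And>j b. j \<ge> J \<Longrightarrow> b \<in> Poly_Mapping.keys (lv R (smul V) n z) \<Longrightarrow>
        ev (conv_pow R V W f j) n (fst b) = 0"
      using J[of n] by blast
    then have "\<forall>j\<ge>J. lv R (smul W) n (?X j) = 0" using X0 by blast
    then have "lv R (smul W) n (cseries R (smul W) exp_coeff ?X) =
        (\<Sum>j<J. fscale (exp_coeff j) (lext fscale (?F n j) (lv R (smul V) n z)))"
      unfolding lvX[symmetric] by (rule lv_cseries[OF carr conv])
    also have "\<dots> = lext fscale (\<lambda>b. \<Sum>j<J. fscale (exp_coeff j) (?F n j b)) (lv R (smul V) n z)"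
      unfolding lext_def free.scale_sum_right
      by (subst sum.swap) (simp add: mult.commute)
    also have "\<dots> = lext fscale (\<lambda>(v, r). nft R (smul W) n (rsc r (lv R (smul W) n (exp_fun v)))) (lv R (smul V) n z)"
    proof (rule lext_cong)
      fix b assume b: "b \<in> Poly_Mapping.keys (lv R (smul V) n z)"
      then have "\<forall>j\<ge>J. ev (conv_pow R V W f j) n (fst b) = 0" using J by blast
      from lv_exp_fun[OF this]
      show "(\<Sum>j<J. fscale (exp_coeff j) (?F n j b)) =
          (case b of (v, r) \<Rightarrow> nft R (smul W) n (rsc r (lv R (smul W) n (exp_fun v))))"
        by (simp add: case_prod_unfold lin_sum[OF lin_rsc] lin_sum[OF lin_nft] lin_scale[OF lin_rsc] nft_scale)
    qed
    also have "\<dots> = lv R (smul W) n (cext R (smul W) exp_fun z)"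
      by (rule lv_cext[OF klin_exp_fun, symmetric])
    finally show "lv R (smul W) n (cseries R (smul W) exp_coeff ?X) =
        lv R (smul W) n (cext R (smul W) exp_fun z)" .
  qed
  then show ?thesis using z by (simp add: conv_exp_def)
qed

lemma conv_exp_cscale:
  "z \<in> carr R V \<Longrightarrow> conv_exp R V W f (cscale R (smul V) r z) = cscale R (smul W) r (conv_exp R V W f z)"
  by (simp add: conv_exp_eq_cext cext_cscale[OF klin_exp_fun])

lemma conv_exp_czero: "conv_exp R V W f (czero R (smul V)) = czero R (smul W)"
  by (rule ctens_eqI[of _ R "smul W"])
    (simp_all add: conv_exp_eq_cext cext_ctens[OF klin_exp_fun] lv_cext[OF klin_exp_fun])

lemma conv_exp_cunit: "conv_exp R V W f (cunit R V) = cexp R W (f (cunit R V))"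
  by (simp add: conv_exp_def cexp_def conv_pow_cunit[OF klin_f])

lemma conv_exp_chom:
  assumes "z \<in> chom R V i"
  shows "conv_exp R V W f z \<in> chom R W i"
  unfolding conv_exp_eq_cext[OF chom_carr[OF assms]]
proof (rule cext_chom[OF klin_exp_fun _ assms])
  fix v assume v: "v \<in> hom V i"
  show "exp_fun v \<in> chom R W i"
    unfolding exp_fun_def
    using f v by (intro cseries_chom conv_pow_chom conv_pow_conv) (simp_all add: small_def)
qed

lemma lv_conv_exp_cong:
  assumes "z \<in> carr R V" "z' \<in> carr R V" "lv R (smul V) n z = lv R (smul V) n z'"
  shows "lv R (smul W) n (conv_exp R V W f z) = lv R (smul W) n (conv_exp R V W f z')"
  using assms by (simp add: conv_exp_eq_cext lv_cext[OF klin_exp_fun])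

lemma lv_conv_exp_1:
  assumes "z \<in> carr R V" "lv R (smul V) (Suc 0) z = lv R (smul V) (Suc 0) (cunit R V)"
  shows "lv R (smul W) (Suc 0) (conv_exp R V W f z) = lv R (smul W) (Suc 0) (cunit R W)"
  using lv_conv_exp_cong[OF assms(1) V.cunit_carr assms(2)] f
  by (simp add: conv_exp_cunit W.lv_cexp_1 small_def)

end

end

section \<open>The ground field as an MV-algebra\<close>

lemma vs_mult: "vector_space ((*) :: 'k::field \<Rightarrow> 'k \<Rightarrow> 'k)"
  by unfold_locales (simp_all add: algebra_simps)

lemma ground_simps [simp]:
  "smul (ground R) = (*)" "hom (ground R) = (\<lambda>i. if i = 0 then UNIV else {0})"
  "mv.mult (ground R) = (*)" "unit (ground R) = 1"
  "comul (ground R) = (\<lambda>c. quo (mrel (*) 2) (Poly_Mapping.single [1, 1] c))"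
  "counit (ground R) = (\<lambda>c. c)" "Delta (ground R) = (\<lambda>_. czero R (*))"
  by (simp_all add: ground_def)

text \<open>Multiplying out words identifies every tensor power of \<open>\<Bbbk>\<close> with \<open>\<Bbbk>\<close>. All coalgebra axioms for \<open>\<Bbbk>\<close>
  are equalities of cosets and will be checked after this identification.\<close>

abbreviation wprod :: "('k::field list \<Rightarrow>\<^sub>0 'k) \<Rightarrow> 'k" where
  "wprod \<equiv> lext (*) prod_list"

lemma mlin_prod_list: "mlin (*) (*) n (prod_list :: 'k::field list \<Rightarrow> 'k)"
  unfolding mlin_def
  by (auto intro!: linI vs_mult simp: algebra_simps)

text \<open>The entries of a word are pulled out as scalars from left to right; \<open>i\<close> counts those already
  replaced by 1.\<close>

lemma gen_word_cong:
  "gen (replicate i 1 @ ws) - Poly_Mapping.single (replicate (i + length ws) 1) (prod_list ws)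
    \<in> mrel (*) (i + length (ws :: 'k::field list))"
proof (induction ws arbitrary: i)
  case Nil
  show ?case by (simp add: free.subspace_0)
next
  case (Cons x ws)
  let ?N = "mrel (*) (i + length (x # ws))"
  have len: "length (replicate i (1::'k)) + length ws + 1 = i + length (x # ws)" by simp
  have "gen (replicate i 1 @ x * 1 # ws) - Poly_Mapping.single (replicate i 1 @ 1 # ws) x \<in> ?N"
    unfolding mrel_def using len by (intro free.span_base) blast
  then have 1: "gen (replicate i 1 @ x # ws) - fscale x (gen (replicate i 1 @ 1 # ws)) \<in> ?N"
    by simp
  have 2: "gen (replicate i 1 @ 1 # ws) -
      Poly_Mapping.single (replicate (i + length (x # ws)) 1) (prod_list ws) \<in> ?N"
    using Cons.IH[of "Suc i"] by (simp add: replicate_app_Cons_same)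
  show ?case
    using free.subspace_add[OF subspace_mrel 1 free.subspace_scale[OF subspace_mrel 2, of x]]
    by (simp add: free.scale_right_diff_distrib del: replicate.simps)
qed

lemma word_cong:
  assumes "\<And>ws. ws \<in> Poly_Mapping.keys p \<Longrightarrow> length ws = n"
  shows "p - Poly_Mapping.single (replicate n 1) (wprod p) \<in> mrel (*) n"
proof -
  have "lin (*) fscale (\<lambda>c :: 'a. Poly_Mapping.single (replicate n (1::'a)) c)"
    by (intro linI vs_mult vs_free) (simp_all add: single_add)
  from lin_lext_comp[OF this, of prod_list p]
  have "p - Poly_Mapping.single (replicate n 1) (wprod p) =
      lext fscale (\<lambda>ws. gen ws - Poly_Mapping.single (replicate n 1) (prod_list ws)) p"
    by (simp add: lext_diff_fun[OF vs_free])
  also have "\<dots> \<in> mrel (*) n"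
    using gen_word_cong[of 0] assms
    by (intro lext_mem_subspace vs_free subspace_mrel) auto
  finally show ?thesis .
qed

lemma quo_eq_wprod:
  assumes "\<And>ws. ws \<in> Poly_Mapping.keys p \<Longrightarrow> length ws = n"
    "\<And>ws. ws \<in> Poly_Mapping.keys q \<Longrightarrow> length ws = n" "wprod p = wprod q"
  shows "quo (mrel (*) n) p = quo (mrel (*) n) q"
proof -
  have "p - Poly_Mapping.single (replicate n 1) (wprod p) \<in> mrel (*) n"
    "q - Poly_Mapping.single (replicate n 1) (wprod q) \<in> mrel (*) n"
    by (rule word_cong, fact)+
  from free.subspace_diff[OF subspace_mrel this] show ?thesis
    using assms(3) by (simp add: quo_eq_iff)
qed

lemma tpow_eq_wprod:
  assumes "x \<in> tpow (*) n" "y \<in> tpow (*) n" "wprod (rep x) = wprod (rep y)"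
  shows "x = y"
  using quo_eq_wprod[OF tpow_rep(3)[OF assms(1)] tpow_rep(3)[OF assms(2)] assms(3)]
    tpow_rep(2)[OF assms(1)] tpow_rep(2)[OF assms(2)] by simp

lemma quo_tpow: "(\<And>ws. ws \<in> Poly_Mapping.keys p \<Longrightarrow> length ws = n) \<Longrightarrow> quo (mrel s n) p \<in> tpow s n"
  unfolding tpow_def by blast

lemma wprod_coset: "p \<in> quo (mrel (*) n) q \<Longrightarrow> wprod p = wprod q"
  by (rule lext_mem_coset[OF mlin_prod_list vs_mult])

lemma wprod_rep_quo [simp]: "wprod (rep (quo (mrel (*) n) p)) = wprod p"
  by (rule wprod_coset[OF rep_mem[OF quo_refl]]) simp

lemma wprod_slot_map:
  fixes D :: "'k::field \<Rightarrow> ('k list \<Rightarrow>\<^sub>0 'k) set"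
  shows "wprod (rep (slot_map (*) n D i t)) =
    lext (*) (\<lambda>zs. prod_list (take i zs) * (wprod (rep (D (zs ! i))) * prod_list (drop (Suc i) zs))) (rep t)"
proof -
  have "lin (*) (*) (\<lambda>x. a * (x * b))" for a b :: 'k
    by (intro linI vs_mult) (simp_all add: algebra_simps)
  note * = lin_lext_comp[OF this, symmetric]
  show ?thesis
    unfolding lext_slot_map[OF mlin_prod_list vs_mult] prod_list.append * ..
qed

context local_base begin

lemma is_decomp_ground: "is_decomp (ground R) v g \<longleftrightarrow> g = (\<lambda>i. if i = 0 then v else 0)"
proof
  assume g: "is_decomp (ground R) v g"
  then have 0: "g i = 0" if "i \<noteq> 0" for i
    using that by (auto simp: is_decomp_def split: if_splits)
  then have "{i. g i \<noteq> 0} \<subseteq> {0}" by blast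
  then have "(\<Sum>i | g i \<noteq> 0. g i) = (\<Sum>i\<in>{0}. g i)"
    by (intro sum.mono_neutral_left) auto
  then show "g = (\<lambda>i. if i = 0 then v else 0)"
    using g 0 by (auto simp: is_decomp_def)
next
  assume g: "g = (\<lambda>i. if i = 0 then v else 0)"
  have "{i. g i \<noteq> 0} = (if v = 0 then {} else {0})" by (auto simp: g)
  then show "is_decomp (ground R) v g"
    by (simp add: is_decomp_def) (simp add: g)
qed

lemma component_ground: "component (ground R) v = (\<lambda>i. if i = 0 then v else 0)"
  unfolding component_def is_decomp_ground by simp

lemma graded_space_ground: "graded_space (ground R)"
  unfolding graded_space_def is_decomp_ground by (simp add: vs_mult idl.subspace_single_0)

lemma graded_comm_algebra_ground: "graded_comm_algebra (ground R)"
  unfolding graded_comm_algebra_def by (simp add: algebra_simps koszul_def)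

text \<open>The sums in \<open>swap\<close> run over nonzero components only, so a word with a zero entry is sent to 0
  and not to the swapped word; multiplying out does not see the difference.\<close>

lemma swap_ground:
  assumes "\<And>ws. ws \<in> Poly_Mapping.keys p \<Longrightarrow> length ws = 2"
  shows "wprod (swap (ground R) p) = wprod p"
    and "ws \<in> Poly_Mapping.keys (swap (ground R) p) \<Longrightarrow> length ws = 2"
proof -
  let ?s = "\<lambda>xs :: 'k list. let f = component (ground R) (xs ! 0); g = component (ground R) (xs ! 1) in
     \<Sum>i | f i \<noteq> 0. \<Sum>j | g j \<noteq> 0. Poly_Mapping.single [g j, f i] (koszul i j)"
  have set: "{i. (if i = 0 then v else 0) \<noteq> 0} = (if v = 0 then {} else {0::int})" for v :: 'k
    by auto
  have s: "?s xs = (if xs ! 0 = 0 \<or> xs ! 1 = 0 then 0 else gen [xs ! 1, xs ! 0])" for xs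
    unfolding component_ground Let_def set by (simp add: koszul_def)
  have "wprod (swap (ground R) p) = lext (*) (\<lambda>xs. wprod (?s xs)) p"
    unfolding swap_def lext_lext[OF vs_mult] ..
  also have "\<dots> = wprod p"
  proof (rule lext_cong)
    fix xs assume "xs \<in> Poly_Mapping.keys p"
    then have "length xs = 2" by (rule assms)
    then have "xs = [xs ! 0, xs ! 1]"
      by (auto simp: length_Suc_conv numeral_2_eq_2)
    then have "prod_list xs = xs ! 0 * xs ! 1"
      by (metis mult.right_neutral prod_list.Cons prod_list.Nil)
    then show "wprod (?s xs) = prod_list xs"
      unfolding s by (auto simp: vs_mult)
  qed
  finally show "wprod (swap (ground R) p) = wprod p" .
  have "swap (ground R) p \<in> {q. Poly_Mapping.keys q \<subseteq> {ws. length ws = 2}}"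
    unfolding swap_def
  proof (rule lext_mem_subspace[OF vs_free subspace_keys])
    show "?s xs \<in> {q. Poly_Mapping.keys q \<subseteq> {ws. length ws = 2}}" for xs
      unfolding s by simp
  qed
  then show "ws \<in> Poly_Mapping.keys (swap (ground R) p) \<Longrightarrow> length ws = 2" by blast
qed

lemma comul_ground_tpow: "comul (ground R) v \<in> tpow (*) 2"
  unfolding ground_simps by (rule quo_tpow) (auto split: if_splits)

lemma wprod_comul_ground: "p \<in> comul (ground R) v \<Longrightarrow> wprod p = v"
  using wprod_coset[of p 2 "Poly_Mapping.single [1, 1] v"] by (simp add: lext_single[OF vs_mult])

lemma graded_cocomm_coalgebra_ground: "graded_cocomm_coalgebra (ground R)"
proof -
  note rep = tpow_rep(1)[OF comul_ground_tpow]
  note len = length_keys_tpow[OF comul_ground_tpow]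
  have mlin: "mlin (*) (*) 2 (\<lambda>xs :: 'k list. xs ! 0 * xs ! 1)"
    by (rule mlin_2I) (auto intro!: linI vs_mult simp: algebra_simps)
  have counit: "lext (*) (\<lambda>xs. xs ! 0 * xs ! 1) p = v" if "p \<in> comul (ground R) v" for p v
    using lext_mem_coset[OF mlin vs_mult, of p "Poly_Mapping.single [1, 1] v"] that
    by (simp add: lext_single[OF vs_mult])
  have counit': "lext (*) (\<lambda>xs. xs ! 1 * xs ! 0) p = v" if "p \<in> comul (ground R) v" for p v
    using counit[OF that] by (simp add: mult.commute)
  have slot: "slot_map (*) 3 (comul (ground R)) i (comul (ground R) v) \<in> tpow (*) 3"
    if "i \<le> 1" for i v
    using slot_map_tpow[of "comul (ground R) v" 1 "comul (ground R)" i "(*)"] len[OF rep] that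
    by (simp add: numeral_2_eq_2 numeral_3_eq_3)
  have wprod_slot: "wprod (rep (slot_map (*) 3 (comul (ground R)) i (comul (ground R) v))) = v"
    if "i \<le> 1" for i v
  proof -
    have "wprod (rep (slot_map (*) 3 (comul (ground R)) i (comul (ground R) v))) = wprod (rep (comul (ground R) v))"
      unfolding wprod_slot_map
    proof (rule lext_cong)
      fix zs assume "zs \<in> Poly_Mapping.keys (rep (comul (ground R) v))"
      then have "i < length zs" using len[OF rep] that by fastforce
      then have "prod_list zs = prod_list (take i zs) * (zs ! i * prod_list (drop (Suc i) zs))"
        using arg_cong[OF id_take_nth_drop[of i zs], of prod_list] by simp
      then show "prod_list (take i zs) * (wprod (rep (comul (ground R) (zs ! i))) *
          prod_list (drop (Suc i) zs)) = prod_list zs"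
        by (simp only: wprod_comul_ground[OF rep])
    qed
    then show ?thesis by (simp only: wprod_comul_ground[OF rep])
  qed
  have coassoc: "slot_map (*) 3 (comul (ground R)) 0 (comul (ground R) v) =
      slot_map (*) 3 (comul (ground R)) 1 (comul (ground R) v)" for v
    by (rule tpow_eq_wprod[OF slot slot]) (simp_all only: wprod_slot zero_le_one order_refl)
  have swap: "swap (ground R) p \<in> comul (ground R) v" if "p \<in> comul (ground R) v" for p v
  proof -
    have "quo (mrel (*) 2) (swap (ground R) p) = quo (mrel (*) 2) (Poly_Mapping.single [1, 1] v)"
    proof (rule quo_eq_wprod)
      show "wprod (swap (ground R) p) = wprod (Poly_Mapping.single [1, 1] v)"
        using swap_ground(1)[OF len[OF that]] wprod_comul_ground[OF that]
        by (simp add: lext_single[OF vs_mult])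
    qed (use swap_ground(2)[OF len[OF that]] in \<open>auto split: if_splits\<close>)
    then show ?thesis using quo_refl[OF subspace_mrel] by (simp del: quo_nf) blast
  qed
  have add: "p + q \<in> comul (ground R) (v + w)"
    if "p \<in> comul (ground R) v" "q \<in> comul (ground R) w" for p q v w
    using free.subspace_add[OF subspace_mrel, of "p - Poly_Mapping.single [1, 1] v" "(*)" 2
        "q - Poly_Mapping.single [1, 1] w"] that
    by (simp add: mem_quo single_add algebra_simps)
  have scale: "fscale c p \<in> comul (ground R) (c * v)" if "p \<in> comul (ground R) v" for p c v
    using free.subspace_scale[OF subspace_mrel, of "p - Poly_Mapping.single [1, 1] v" "(*)" 2 c] that
    by (simp add: mem_quo free.scale_right_diff_distrib)
  have hom: "\<exists>p\<in>comul (ground R) v. \<forall>xs\<in>Poly_Mapping.keys p. length xs = 2 \<and>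
        (\<exists>a b. xs ! 0 \<in> hom (ground R) a \<and> xs ! 1 \<in> hom (ground R) b \<and> a + b = i)"
    if "v \<in> hom (ground R) i" for v i
  proof (rule bexI[of _ "Poly_Mapping.single [1, 1] v"])
    show "Poly_Mapping.single [1, 1] v \<in> comul (ground R) v" by (simp add: quo_refl)
    have "v = 0" if "i \<noteq> 0" using that \<open>v \<in> hom (ground R) i\<close> by simp
    then show "\<forall>xs\<in>Poly_Mapping.keys (Poly_Mapping.single [1, 1] v). length xs = 2 \<and>
        (\<exists>a b. xs ! 0 \<in> hom (ground R) a \<and> xs ! 1 \<in> hom (ground R) b \<and> a + b = i)"
      by (cases "i = 0") (auto intro!: exI[of _ 0])
  qed
  show ?thesis
    unfolding graded_cocomm_coalgebra_def ground_simps(1,6)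
    by (intro conjI allI ballI impI comul_ground_tpow add scale hom coassoc swap counit counit')
      (simp_all only: ground_simps(2) if_False singleton_iff)
qed

lemma conilpotent_ground: "conilpotent (ground R)"
proof -
  note rep = tpow_rep(1)[OF comul_ground_tpow]
  note len = length_keys_tpow[OF comul_ground_tpow]
  let ?p = "rep (comul (ground R) 0) - gen [0, 1] - gen [1, 0]"
  have rcomul: "rcomul (ground R) v = quo (mrel (*) 2) ?p" for v
    by (simp add: rcomul_def)
  have "Poly_Mapping.keys (c - gen [0, 1] - gen [1, 0]) \<subseteq> Poly_Mapping.keys c \<union> {[0, 1], [1, 0]}"
    for c :: "'k list \<Rightarrow>\<^sub>0 'k"
    by (auto simp: in_keys_iff lookup_minus lookup_single when_def split: if_splits)
  then have "length ws = 2" if "ws \<in> Poly_Mapping.keys ?p" for ws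
    using len[OF rep, of ws 0] that by fastforce
  then have tpow: "rcomul (ground R) v \<in> tpow (*) 2" for v
    unfolding rcomul by (rule quo_tpow)
  have "wprod ?p = 0"
    using wprod_comul_ground[OF rep]
    by (simp add: lin_diff[OF lin_lext[OF vs_mult]] vs_mult del: ground_simps)
  then have wprod: "wprod (rep (rcomul (ground R) v)) = 0" for v
    unfolding rcomul by simp
  have iter: "rcomul_iter (ground R) k v \<in> tpow (*) (Suc k)" for k v
  proof (induction k)
    case 0
    show ?case by (auto intro: quo_tpow)
  next
    case (Suc k)
    have "slot_map (*) (k + 2) (rcomul (ground R)) 0 (rcomul_iter (ground R) k v) \<in> tpow (*) (k + 2)"
      by (rule slot_map_tpow) (use tpow_rep(3)[OF Suc] tpow_rep(3)[OF tpow] in auto)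
    then show ?case by simp
  qed
  have "rcomul_iter (ground R) k v = quo (mrel (*) (Suc k)) 0" if "k \<ge> 1" for k v
  proof (rule tpow_eq_wprod[OF iter])
    show "quo (mrel (*) (Suc k)) 0 \<in> tpow (*) (Suc k)" by (rule quo_tpow) simp
    from that obtain j where "k = Suc j" by (cases k) auto
    then have "wprod (rep (rcomul_iter (ground R) k v)) = 0"
      by (simp add: wprod_slot_map wprod) (simp add: lext_def)
    then show "wprod (rep (rcomul_iter (ground R) k v)) = wprod (rep (quo (mrel (*) (Suc k)) 0))"
      by simp
  qed
  then show ?thesis
    unfolding conilpotent_def by (auto intro!: exI[of _ 1])
qed

lemma mv_algebra_ground: "mv_algebra R (ground R)"
proof -
  have "augmented (ground R)"
    by (simp add: augmented_def)
  moreover have "cadd R (*) (czero R (*)) (czero R (*)) = (czero R (*) :: ('k, 'r, 'k) ct)"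
    by (rule ctens_eqI[of _ R "(*)"]) simp_all
  moreover have "cscale R (*) r (czero R (*)) = (czero R (*) :: ('k, 'r, 'k) ct)" for r
    by (rule ctens_eqI[of _ R "(*)"]) (simp_all add: lv_cscale lin_zero[OF lin_rsc])
  moreover have "has_degree R (ground R) (ground R) 1 (Delta (ground R))"
    using czero_chom[of R "ground R"] by (simp add: has_degree_def)
  ultimately show ?thesis
    unfolding mv_algebra_def
    by (simp add: graded_space_ground graded_comm_algebra_ground graded_cocomm_coalgebra_ground
        conilpotent_ground clinear_def ccontinuous_def)
qed

lemma cscale_1: "x \<in> ctens R s \<Longrightarrow> cscale R s 1 x = x"
  by (rule ctens_eqI[of _ R s]) (simp_all add: lv_cscale)

text \<open>The completion of \<open>\<Bbbk> \<otimes> R\<close> is the limit of \<open>R / \<mm>\<^sup>n\<close>, hence a free \<open>R\<close>-module on 1 as \<open>R\<close> is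
  complete. The map \<open>\<theta>\<close> is \<open>c \<otimes> r \<mapsto> c r\<close>, and \<open>r\<close> is the limit of the images of the components of
  \<open>z\<close>.\<close>

lemma carr_ground:
  assumes z: "z \<in> ctens R (*)"
  obtains r where "z = cscale R (*) r (cunit R (ground R))"
proof -
  let ?sR = "\<lambda>c r. emb R c * r"
  have sR: "vector_space ?sR"
    by unfold_locales (simp_all add: emb_add emb_mult algebra_simps)
  let ?\<theta> = "lext ?sR (\<lambda>(c, r). emb R c * r)"
  note lin_\<theta> = lin_lext[OF sR, of "\<lambda>(c, r). emb R c * r"]
  have sub: "module.subspace ?sR (ideal_pow (mid R) n)" for n
  proof -
    interpret sR: vector_space ?sR by (rule sR)
    show ?thesis
      using subspace_ideal_pow[of "mid R" n]
      by (simp add: sR.subspace_def idl.subspace_def)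
  qed
  have \<theta>_trel: "?\<theta> p \<in> ideal_pow (mid R) n" if "p \<in> trel R (*) n" for p n
    using lin_\<theta> that[unfolded trel_eq]
  proof (rule lin_span)
    fix a :: "'k \<times> 'r \<Rightarrow>\<^sub>0 'k"
    assume "a \<in> trel0 R (*) \<union> {gen (x, r) | x r. r \<in> ideal_pow (mid R) n}"
    then consider "a \<in> trel0 R (*)" | x r where "a = gen (x, r)" "r \<in> ideal_pow (mid R) n"
      by blast
    then show "?\<theta> a \<in> ideal_pow (mid R) n"
    proof cases
      case 1
      then have "?\<theta> a = 0"
        by (cases rule: trel0_cases; hypsubst)
          (simp_all add: lin_diff[OF lin_\<theta>] lin_scale[OF lin_\<theta>] sR emb_add emb_mult
            distrib_left distrib_right mult.assoc mult.left_commute del: fscale_single)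
      then show ?thesis using idl.subspace_0[OF subspace_ideal_pow] by simp
    qed (simp add: sR idl.subspace_scale)
  qed (rule sub)
  have nft_\<theta>: "nft R (*) n p = nft R (*) n (gen (1, ?\<theta> p))" for n and p :: "'k \<times> 'r \<Rightarrow>\<^sub>0 'k"
  proof (rule lin_eqI[of fscale "nft R (*) n" "\<lambda>p. nft R (*) n (gen (1, ?\<theta> p))"])
    have "lin ?sR fscale (\<lambda>r. nft R (*) n (gen (1 :: 'k, r)))"
      by (rule linI[OF sR vs_free]) (simp_all add: nft_gen_add_right nft_gen_emb)
    from lin_comp[OF lin_\<theta> this]
    show "lin fscale fscale (\<lambda>p. nft R (*) n (gen (1 :: 'k, ?\<theta> p)))" .
    show "nft R (*) n (gen b) = nft R (*) n (gen (1, ?\<theta> (gen b)))" for b :: "'k \<times> 'r"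
      using nft_gen_scale[of R "(*)" n "fst b" 1 "snd b"] nft_gen_emb[of R "(*)" n 1 "fst b" "snd b"]
      by (simp add: sR case_prod_unfold)
  qed (rule lin_nft)
  define x where "x n = ?\<theta> (lv R (*) n z)" for n
  have "x (Suc n) - x n \<in> ideal_pow (mid R) n" for n
    unfolding x_def lin_diff[OF lin_\<theta>, symmetric]
    using diff_nf[OF subspace_trel, of "lv R (*) (Suc n) z" R "(*)" n] nft_lv_le[OF z, of n "Suc n"]
    by (intro \<theta>_trel) simp
  from complete[OF this] obtain l where l: "\<And>n. l - x n \<in> ideal_pow (mid R) n" by blast
  have "z = cscale R (*) l (cunit R (ground R))"
  proof (rule ctens_eqI[OF z])
    show "cscale R (*) l (cunit R (ground R)) \<in> ctens R (*)"
      by (simp add: cunit_def)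
    fix n
    have "lv R (*) n z = nft R (*) n (gen (1, x n))"
      using nft_\<theta>[of n "lv R (*) n z"] by (simp add: x_def)
    also have "\<dots> = nft R (*) n (gen (1, x n + (l - x n)))"
      unfolding nft_gen_add_right nft_gen_ideal[OF l] by simp
    also have "\<dots> = lv R (*) n (cscale R (*) l (cunit R (ground R)))"
      by (simp add: lv_cscale cunit_def lv_incl nft_rsc)
    finally show "lv R (*) n z = lv R (*) n (cscale R (*) l (cunit R (ground R)))" .
  qed
  then show ?thesis by (rule that)
qed

end

section \<open>Solutions of the quantum master equation as morphisms\<close>

context mv_alg begin

lemma ground_pair: "mv_pair R (ground R) V"
  by (intro mv_pair.intro mv_alg.intro mv_alg_axioms.intro local_base_axioms mv_algebra_ground mv)

lemma Lin_ground:
  assumes "s \<in> Lin R (ground R) V"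
  shows "s (cscale R (*) r (cunit R (ground R))) = cscale R (smul V) r (s (cunit R (ground R)))"
  using assms by (simp add: Lin_def clinear_def cunit_def)

lemma Delta_cscale: "x \<in> carr R V \<Longrightarrow> Delta V (cscale R (smul V) r x) = cscale R (smul V) r (Delta V x)"
  using mv by (simp add: mv_algebra_def clinear_def)

lemma cscale_czero: "cscale R (smul V) r (czero R (smul V)) = czero R (smul V)"
  by (rule ctens_eqI[of _ R "smul V"]) (simp_all add: lv_cscale lin_zero[OF lin_rsc])

text \<open>The differential of \<open>\<Bbbk>\<close> is zero and \<open>exp(s)(1) = exp(s(1))\<close>, so the condition on morphisms,
  evaluated at 1, is the quantum master equation.\<close>

lemma MV_ground_value:
  assumes s: "s \<in> MV R (ground R) V"
  shows "s (cunit R (ground R)) \<in> QME R V"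
proof -
  interpret P: mv_pair R "ground R" V by (rule ground_pair)
  have small: "P.small s" using s by (intro P.small_Lin0) (simp add: MV_def)
  have "Delta V (cexp R V (s (cunit R (ground R)))) = conv_exp R (ground R) V s (czero R (*))"
    unfolding P.conv_exp_cunit[OF small, symmetric]
    using s P.V.cunit_carr by (simp add: MV_def)
  also have "\<dots> = czero R (smul V)"
    using P.conv_exp_czero[OF small] by simp
  finally have "Delta V (cexp R V (s (cunit R (ground R)))) = czero R (smul V)" .
  moreover have "s (cunit R (ground R)) \<in> chom R V 0"
    using small unfolding P.small_def cunit_def by simp
  ultimately show ?thesis
    using small by (simp add: QME_def P.small_def)
qed

text \<open>A morphism from \<open>\<Bbbk>\<close> is \<open>R\<close>-linear on a module generated by 1.\<close>

lemma MV_ground_ext: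
  assumes s: "s \<in> MV R (ground R) V" and f: "f \<in> extensional (ctens R (*))"
    and eq: "\<And>r. f (cscale R (*) r (cunit R (ground R))) =
      cscale R (smul V) r (s (cunit R (ground R)))"
  shows "f = s"
proof
  fix z
  have sL: "s \<in> Lin R (ground R) V" using s by (simp add: MV_def Lin0_def)
  show "f z = s z"
  proof (cases "z \<in> ctens R (*)")
    case True
    then obtain r where "z = cscale R (*) r (cunit R (ground R))" by (rule carr_ground)
    then show ?thesis using eq Lin_ground[OF sL] by simp
  next
    case False
    then show ?thesis
      using sL f by (auto simp: Lin_def PiE_def extensional_def)
  qed
qed

text \<open>The morphism is \<open>r \<cdot> 1 \<mapsto> r \<cdot> S\<close>, whose exponential is \<open>r \<cdot> 1 \<mapsto> r \<cdot> exp(S)\<close>.\<close>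

lemma MV_ground_exists:
  assumes S: "S \<in> QME R V"
  shows "\<exists>s\<in>MV R (ground R) V. s (cunit R (ground R)) = S"
proof -
  interpret P: mv_pair R "ground R" V by (rule ground_pair)
  have S0: "S \<in> chom R V 0" and Smax: "S \<in> cmax R (smul V)"
    and QME: "Delta V (cexp R V S) = czero R (smul V)"
    using S by (auto simp: QME_def)
  have Sc: "S \<in> carr R V" by (rule chom_carr[OF S0])
  define \<phi> where "\<phi> c = cscale R (smul V) (emb R c) S" for c
  have lv_\<phi>: "lv R (smul V) n (\<phi> c) = fscale c (lv R (smul V) n S)" for n c
    by (simp add: \<phi>_def lv_cscale_emb)
  have klin: "klin R (*) (smul V) \<phi>"
    unfolding klin_def
    by (intro conjI allI linI vs_mult vs_free)
      (simp_all add: lv_\<phi> free.scale_left_distrib, simp add: \<phi>_def Sc)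
  have \<phi>_chom: "\<phi> c \<in> chom R V i" if "c \<in> hom (ground R) i" for c i
    using that S0 klinD(1)[OF klin, of c]
    by (cases "i = 0") (auto simp: chom_iff lv_\<phi> free.subspace_scale free.subspace_0)
  define s where "s = restrict (cext R (smul V) \<phi>) (ctens R (*))"
  have s_incl: "s (incl R (*) c) = \<phi> c" for c
    by (simp add: s_def cext_incl[OF klin])
  have s1: "s (cunit R (ground R)) = S"
    by (simp add: cunit_def s_incl \<phi>_def cscale_1 Sc)
  have "has_degree R (ground R) V 0 s"
    unfolding has_degree_def
  proof (intro allI ballI)
    fix i x assume x: "x \<in> chom R (ground R) i"
    have "cext R (smul V) \<phi> x \<in> chom R V i"
      by (rule P.cext_chom) (use klin \<phi>_chom x in simp_all)
    then show "s x \<in> chom R V (i + 0)"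
      using chom_carr[OF x] by (simp add: s_def)
  qed
  then have "s \<in> Lin R (ground R) V"
    using clinear_cext[OF klin] ccontinuous_cext[OF klin] cext_ctens[OF klin]
    unfolding Lin_def s_def by auto
  then have Lin0: "s \<in> Lin0 R (ground R) V"
    using Smax klinD(1)[OF klin] by (simp add: Lin0_def s_incl cmax_iff' lv_\<phi>)
  have small: "P.small s" by (rule P.small_Lin0[OF Lin0])
  have "Delta V (conv_exp R (ground R) V s z) = czero R (smul V)" if z: "z \<in> ctens R (*)" for z
  proof -
    obtain r where z: "z = cscale R (*) r (cunit R (ground R))" using z by (rule carr_ground)
    have "conv_exp R (ground R) V s z = cscale R (smul V) r (cexp R V S)"
      using P.conv_exp_cscale[OF small P.V.cunit_carr, of r] P.conv_exp_cunit[OF small]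
      by (simp add: z s1)
    then show ?thesis
      by (simp add: Delta_cscale cexp_carr[OF Smax] QME cscale_czero)
  qed
  then have "s \<in> MV R (ground R) V"
    using P.conv_exp_czero[OF small] by (simp add: MV_def Lin0)
  with s1 show ?thesis by blast
qed

lemma bij_betw_MV_ground_QME:
  "bij_betw (\<lambda>s. s (cunit R (ground R))) (MV R (ground R) V) (QME R V)"
proof (rule bij_betwI')
  fix s s' assume s: "s \<in> MV R (ground R) V" and s': "s' \<in> MV R (ground R) V"
  have L: "s \<in> Lin R (ground R) V" using s by (simp add: MV_def Lin0_def)
  have "s = s'" if "s (cunit R (ground R)) = s' (cunit R (ground R))"
    by (rule MV_ground_ext[OF s']) (use L Lin_ground[OF L] that in \<open>auto simp: Lin_def PiE_def\<close>)
  then show "s (cunit R (ground R)) = s' (cunit R (ground R)) \<longleftrightarrow> s = s'" by blast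
qed (use MV_ground_value MV_ground_exists in blast)+

end

context mv_pair begin

lemma MV_small: "f \<in> MV R V W \<Longrightarrow> small f"
  by (rule small_Lin0) (simp add: MV_def)

lemma conv_exp_cexp:
  assumes f: "f \<in> MV R V W" and S: "S \<in> QME R V"
  defines "x \<equiv> conv_exp R V W f (cexp R V S)"
  shows "x \<in> chom R W 0" "lv R (smul W) (Suc 0) x = lv R (smul W) (Suc 0) (cunit R W)"
    "Delta W x = czero R (smul W)"
proof -
  note small = MV_small[OF f]
  have S0: "S \<in> chom R V 0" and Smax: "S \<in> cmax R (smul V)"
    and QME: "Delta V (cexp R V S) = czero R (smul V)"
    using S by (auto simp: QME_def)
  note carr = V.cexp_carr[OF Smax]
  show "x \<in> chom R W 0"
    unfolding x_def by (rule conv_exp_chom[OF small V.cexp_chom[OF Smax S0]])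
  show "lv R (smul W) (Suc 0) x = lv R (smul W) (Suc 0) (cunit R W)"
    unfolding x_def by (rule lv_conv_exp_1[OF small carr V.lv_cexp_1[OF Smax]])
  show "Delta W x = czero R (smul W)"
    using f carr QME conv_exp_czero[OF small] by (simp add: x_def MV_def)
qed

text \<open>The solution assigned to \<open>S\<close> has exponential \<open>exp(f)(exp(S))\<close>, and \<open>exp(f)\<close> commutes with the
  differentials.\<close>

lemma QME_map_QME:
  assumes f: "f \<in> MV R V W" and S: "S \<in> QME R V"
  shows "QME_map R V W f S \<in> QME R W"
  using W.cexp_clog[OF chom_carr[OF conv_exp_cexp(1)[OF assms]] conv_exp_cexp(2)[OF assms]]
    W.clog_chom[OF conv_exp_cexp(1,2)[OF assms]]
    W.clog_cmax[OF chom_carr[OF conv_exp_cexp(1)[OF assms]] conv_exp_cexp(2)[OF assms]]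
    conv_exp_cexp(3)[OF assms]
  by (simp add: QME_def QME_map_def)

text \<open>On \<open>\<Bbbk>\<close> the convolution logarithm is the logarithm of the value at 1.\<close>

lemma conv_log_ground:
  assumes h: "\<And>r. h (cscale R (*) r (cunit R (ground R))) = cscale R (smul W) r x"
    and x: "x \<in> carr R W" "lv R (smul W) (Suc 0) x = lv R (smul W) (Suc 0) (cunit R W)"
  shows "conv_log R (ground R) W h (cscale R (*) r (cunit R (ground R))) =
    cscale R (smul W) r (clog R W x)"
proof -
  interpret P: mv_pair R "ground R" W by (rule W.ground_pair)
  let ?one = "cunit R (ground R)"
  let ?y = "csub R (smul W) x (cunit R W)"
  have one: "?one \<in> ctens R (*)" using P.V.cunit_carr by simp
  have y: "?y \<in> cmax R (smul W)" by (rule W.csub_cunit_cmax[OF x])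
  define g where "g = (\<lambda>z\<in>ctens R (*). csub R (smul W) (h z) (conv_unit R (ground R) W z))"
  have unit: "conv_unit R (ground R) W (cscale R (*) r ?one) = cscale R (smul W) r (cunit R W)" for r
    using P.conv_pow_cscale[OF P.klin_conv_unit P.V.cunit_carr, of 0 r]
      P.conv_pow_cunit[OF P.klin_conv_unit, of 0] by simp
  have g: "g (cscale R (*) r ?one) = cscale R (smul W) r ?y" for r
  proof (rule ctens_eqI[of _ R "smul W"])
    show "g (cscale R (*) r ?one) \<in> carr R W"
      by (simp add: g_def one h unit x)
    show "cscale R (smul W) r ?y \<in> carr R W" by (simp add: x)
    show "lv R (smul W) n (g (cscale R (*) r ?one)) = lv R (smul W) n (cscale R (smul W) r ?y)" for n
      by (simp add: g_def one h unit lv_cscale lin_diff[OF lin_rsc] nft_diff)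
  qed
  have g_incl: "g (incl R (*) c) = cscale R (smul W) (emb R c) ?y" for c
    using P.incl_scale[of c 1] g[of "emb R c"] by (simp add: cunit_def)
  have klin: "P.klin_map g"
    unfolding klin_def ground_simps g_incl
    by (intro conjI allI linI vs_mult vs_free)
      (simp_all add: x V.lv_cscale_emb free.scale_left_distrib)
  have g1: "g ?one = ?y"
    using g[of 1] by (simp add: V.cscale_1 one x)
  have "conv_pow R (ground R) W g j (cscale R (*) r ?one) = cscale R (smul W) r (cpow R W ?y j)" for j
    using P.conv_pow_cscale[OF klin P.V.cunit_carr, of j r] P.conv_pow_cunit[OF klin, of j]
    by (simp add: g1)
  then have "conv_log R (ground R) W h (cscale R (*) r ?one) =
      cseries R (smul W) log_coeff (\<lambda>j. cscale R (smul W) r (cpow R W ?y j))"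
    by (simp add: conv_log_def g_def[symmetric] one)
  also have "\<dots> = cscale R (smul W) r (clog R W x)"
    unfolding clog_def by (rule cseries_cscale[OF W.cpow_series[OF y]])
  finally show ?thesis .
qed

text \<open>The composite is linear on a module generated by 1 with the solution \<open>QME_map R V W f (s 1)\<close> as
  value at 1; by the bijection for \<open>W\<close> that solution belongs to a morphism, which therefore is the
  composite.\<close>

lemma mv_comp_ground:
  assumes f: "f \<in> MV R V W" and s: "s \<in> MV R (ground R) V"
  shows "mv_comp R (ground R) V W f s \<in> MV R (ground R) W"
    and "mv_comp R (ground R) V W f s (cunit R (ground R)) =
      QME_map R V W f (s (cunit R (ground R)))"
proof -
  interpret P: mv_pair R "ground R" V by (rule V.ground_pair)
  let ?one = "cunit R (ground R)"
  let ?S = "s ?one"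
  let ?T = "QME_map R V W f ?S"
  let ?x = "conv_exp R V W f (cexp R V ?S)"
  have one: "?one \<in> ctens R (*)" using P.V.cunit_carr by simp
  have S: "?S \<in> QME R V" by (rule V.MV_ground_value[OF s])
  then have carr: "cexp R V ?S \<in> carr R V" by (intro V.cexp_carr) (simp add: QME_def)
  note small = P.MV_small[OF s]
  have h: "compose (ctens R (*)) (conv_exp R V W f) (conv_exp R (ground R) V s) (cscale R (*) r ?one) =
      cscale R (smul W) r ?x" for r
    using P.conv_exp_cscale[OF small P.V.cunit_carr, of r] P.conv_exp_cunit[OF small]
      conv_exp_cscale[OF MV_small[OF f] carr, of r]
    by (simp add: compose_def one)
  have comp: "mv_comp R (ground R) V W f s (cscale R (*) r ?one) = cscale R (smul W) r ?T" for r
    unfolding mv_comp_def QME_map_def ground_simps(1)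
    by (rule conv_log_ground[OF h chom_carr[OF conv_exp_cexp(1)[OF f S]] conv_exp_cexp(2)[OF f S]])
  have T: "?T \<in> QME R W" by (rule QME_map_QME[OF f S])
  have Tc: "?T \<in> carr R W" using T by (auto simp: QME_def intro: chom_carr)
  show "mv_comp R (ground R) V W f s ?one = ?T"
    using comp[of 1] by (simp add: V.cscale_1 one Tc)
  obtain s' where s': "s' \<in> MV R (ground R) W" "s' ?one = ?T"
    using W.MV_ground_exists[OF T] by blast
  have "mv_comp R (ground R) V W f s = s'"
    by (rule W.MV_ground_ext[OF s'(1)])
      (simp_all add: comp s'(2), simp add: mv_comp_def conv_log_def Let_def)
  then show "mv_comp R (ground R) V W f s \<in> MV R (ground R) W"
    using s'(1) by simp
qed

end

theorem theorem39:
  fixes R :: "('k::field_char_0, 'r::comm_ring_1) coeff"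
    and V :: "('k, 'r, 'v::ab_group_add) mv"
    and W :: "('k, 'r, 'w::ab_group_add) mv"
  assumes "complete_local R"
    and "mv_algebra R V"
  shows "mv_algebra R (ground R) \<and>
    bij_betw (\<lambda>s. s (cunit R (ground R))) (MV R (ground R) V) (QME R V) \<and>
    (mv_algebra R W \<longrightarrow>
      (\<forall>f\<in>MV R V W.
        (\<forall>S\<in>QME R V. QME_map R V W f S \<in> QME R W) \<and>
        (\<forall>s\<in>MV R (ground R) V.
          mv_comp R (ground R) V W f s \<in> MV R (ground R) W \<and>
          mv_comp R (ground R) V W f s (cunit R (ground R)) =
            QME_map R V W f (s (cunit R (ground R))))))"
proof -
  interpret V: mv_alg R V using assms by unfold_locales
  have "(\<forall>S\<in>QME R V. QME_map R V W f S \<in> QME R W) \<and>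
      (\<forall>s\<in>MV R (ground R) V. mv_comp R (ground R) V W f s \<in> MV R (ground R) W \<and>
        mv_comp R (ground R) V W f s (cunit R (ground R)) =
          QME_map R V W f (s (cunit R (ground R))))"
    if "mv_algebra R W" "f \<in> MV R V W" for f
  proof -
    interpret mv_pair R V W
      using assms that(1) by unfold_locales
    show ?thesis using QME_map_QME[OF that(2)] mv_comp_ground[OF that(2)] by blast
  qed
  then show ?thesis
    using V.mv_algebra_ground V.bij_betw_MV_ground_QME by blast
qed

end
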